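(* Let $S$ be a complex surface and $L\subset S$ a rational curve (an embedded $\mathbb{CP}^1$) whose normal bundle is isomorphic to $\mathcal O(n)$, $n\ge 2$. Let $\mathcal L=\{L_a\}$ be the complete $(n+1)$-parameter family of deformations of $L$ in $S$, and let $\mathcal E$ be the ordinary differential equation of order $n+1$ defining this complete family of deformations, i.e. the codimension-one submanifold of $J^{n+1}(S)$ formed by the lifts of the curves $L_a$. Then all generalized Wilczynski invariants $\mathcal W_3,\dots,\mathcal W_{n+1}$ of $\mathcal E$ vanish identically.
   Context: Everything is in the complex analytic category. By Kodaira's theory, a rational curve $L$ with normal bundle $\mathcal O(n)$ in a complex surface $S$ is included in a complete family $\mathcal L=\{L_a\}$ of its deformations, depending on $n+1$ parameters. $J^{k}(S)$ is the space of $k$-jets of (non-parametrized) holomorphic curves in $S$; local coordinates $(x,y)$ on $S$ induce local coordinates $(x,y_0,\dots,y_k)$ on $J^k(S)$ such that the lift of the graph of $y(x)$ is $(x,y(x),y'(x),\dots,y^{(k)}(x))$. The lifts of the curves $L_a$ to $J^{n+1}(S)$ form a codimension-one submanifold $\mathcal E$, given in local coordinates by $y_{n+1}=f(x,y_0,\dots,y_n)$, on which $(x,y_0,\dots,y_n)$ are local coordinates; these lifts are the leaves of the foliation tangent to the line bundle $E\subset T\mathcal E$ spanned locally by $D=\partial_x+y_1\partial_{y_0}+\dots+y_n\partial_{y_{n-1}}+f\,\partial_{y_n}$. Classical Wilczynski invariants. For a linear ODE $y^{(n+1)}+p_n(x)y^{(n)}+\dots+p_0(x)y=0$ there is locally a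 transformation $(x,y)\mapsto(\lambda(x),\mu(x)y)$ bringing it to the Laguerre–Forsyth form $\tilde y^{(n+1)}+q_{n-2}\tilde y^{(n-2)}+\dots+q_0\tilde y=0$. For $k=3,\dots,n+1$ put $$\tilde\theta_k=\sum_{j=1}^{k-2}(-1)^{j+1}\frac{(2k-j-1)!\,(n-k+j)!}{(k-j)!\,(j-1)!}\,q_{n-k+j}^{(j-1)},\qquad \theta_k(x)=(\lambda'(x))^k\,\tilde\theta_k(\lambda(x));$$ $\theta_k$ does not depend on the choice of $(\lambda,\mu)$ and is a universal polynomial in the $p_i$ and their derivatives. Generalized Wilczynski invariants. The linearization of $y^{(n+1)}=f(x,y,y',\dots,y^{(n)})$ along a solution is $h^{(n+1)}=\sum_{i=0}^n\frac{\partial f}{\partial y_i}h^{(i)}$, with coefficients evaluated along the solution. $W_k$ is the local function on $\mathcal E$ whose restriction to each lifted solution is $\theta_k$ of the linearization along it. The generalized Wilczynski invariant $\mathcal W_k$ is the section of $S^kE^*$ over $\mathcal E$ given by $\mathcal W_k(D,\dots,D)=W_k$; it does not depend on the local coordinates $(x,y)$ on $S$ used to compute it. *)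

theory Defs
  imports "HOL-Complex_Analysis.Complex_Analysis"
begin

section \<open>Complex normed spaces and holomorphic maps between them\<close>

class complex_normed = real_normed_vector +
  fixes scaleC :: "complex \<Rightarrow> 'a \<Rightarrow> 'a" (infixr \<open>*\<^sub>C\<close> 75)
  assumes scaleC_add_right: "c *\<^sub>C (v + w) = c *\<^sub>C v + c *\<^sub>C w"
    and scaleC_add_left: "(b + c) *\<^sub>C v = b *\<^sub>C v + c *\<^sub>C v"
    and scaleC_scaleC: "b *\<^sub>C c *\<^sub>C v = (b * c) *\<^sub>C v"
    and scaleC_of_real: "complex_of_real r *\<^sub>C v = r *\<^sub>R v"
    and norm_scaleC: "norm (c *\<^sub>C v) = cmod c * norm v"

instantiation complex :: complex_normed
begin
definition scaleC_complex :: "complex \<Rightarrow> complex \<Rightarrow> complex" where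
  "scaleC_complex c v = c * v"
instance
  by standard (simp_all add: scaleC_complex_def algebra_simps norm_mult scaleR_conv_of_real)
end

instantiation prod :: (complex_normed, complex_normed) complex_normed
begin
definition scaleC_prod :: "complex \<Rightarrow> 'a \<times> 'b \<Rightarrow> 'a \<times> 'b" where
  "scaleC_prod c v = (c *\<^sub>C fst v, c *\<^sub>C snd v)"
instance
proof
  fix c :: complex and v :: "'a \<times> 'b"
  have "(cmod c * norm (fst v))\<^sup>2 + (cmod c * norm (snd v))\<^sup>2
      = (cmod c)\<^sup>2 * ((norm (fst v))\<^sup>2 + (norm (snd v))\<^sup>2)"
    by (simp add: power_mult_distrib algebra_simps)
  then show "norm (c *\<^sub>C v) = cmod c * norm v"
    by (simp add: scaleC_prod_def norm_prod_def norm_scaleC real_sqrt_mult)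
qed (simp_all add: scaleC_prod_def scaleC_add_right scaleC_add_left scaleC_scaleC
       scaleC_of_real prod_eq_iff)
end

instantiation vec :: (complex_normed, finite) complex_normed
begin
definition scaleC_vec :: "complex \<Rightarrow> 'a ^ 'b \<Rightarrow> 'a ^ 'b" where
  "scaleC_vec c v = (\<chi> i. c *\<^sub>C (v $ i))"
instance
  by standard (simp_all add: scaleC_vec_def scaleC_add_right scaleC_add_left scaleC_scaleC
       scaleC_of_real vec_eq_iff norm_vec_def norm_scaleC L2_set_right_distrib)
end

text \<open>Used for open \<open>U\<close> only.\<close>

definition holo_on :: "'a set \<Rightarrow> ('a::complex_normed \<Rightarrow> 'b::complex_normed) \<Rightarrow> bool" where
  "holo_on U f \<longleftrightarrow>
     (\<forall>x\<in>U. \<exists>f'. (f has_derivative f') (at x) \<and> (\<forall>c v. f' (c *\<^sub>C v) = c *\<^sub>C f' v))"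


section \<open>Complex manifolds\<close>

type_synonym ('p, 'e) chart = "'p set \<times> ('p \<Rightarrow> 'e)"

definition chart_inv :: "('p, 'e) chart \<Rightarrow> 'e \<Rightarrow> 'p" where
  "chart_inv c = inv_into (fst c) (snd c)"

definition is_chart :: "('p::topological_space, 'e::topological_space) chart \<Rightarrow> bool" where
  "is_chart c \<longleftrightarrow> open (fst c) \<and> open (snd c ` fst c) \<and>
     homeomorphism (fst c) (snd c ` fst c) (snd c) (chart_inv c)"

definition compatible :: "('p, 'e::complex_normed) chart \<Rightarrow> ('p, 'e) chart \<Rightarrow> bool" where
  "compatible c d \<longleftrightarrow>
     holo_on (snd c ` (fst c \<inter> fst d)) (snd d \<circ> chart_inv c) \<and>
     holo_on (snd d ` (fst c \<inter> fst d)) (snd c \<circ> chart_inv d)"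

definition complex_atlas :: "('p::topological_space, 'e::complex_normed) chart set \<Rightarrow> bool" where
  "complex_atlas A \<longleftrightarrow>
     (\<forall>c\<in>A. is_chart c) \<and> (\<forall>c\<in>A. \<forall>d\<in>A. compatible c d) \<and> (\<Union>c\<in>A. fst c) = UNIV"

definition max_atlas ::
    "('p::topological_space, 'e::complex_normed) chart set \<Rightarrow> ('p, 'e) chart set" where
  "max_atlas A = {c. is_chart c \<and> (\<forall>d\<in>A. compatible c d)}"

definition prod_atlas ::
    "('p, 'e) chart set \<Rightarrow> ('q, 'f) chart set \<Rightarrow> ('p \<times> 'q, 'e \<times> 'f) chart set" where
  "prod_atlas A B = {(fst c \<times> fst d, map_prod (snd c) (snd d)) | c d. c \<in> A \<and> d \<in> B}"

definition holo_map_on ::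
    "'p set \<Rightarrow> ('p::topological_space, 'e::complex_normed) chart set \<Rightarrow>
     ('q::topological_space, 'f::complex_normed) chart set \<Rightarrow> ('p \<Rightarrow> 'q) \<Rightarrow> bool" where
  "holo_map_on V A B g \<longleftrightarrow> open V \<and> continuous_on V g \<and>
     (\<forall>c\<in>A. \<forall>d\<in>B. holo_on (snd c ` (fst c \<inter> V \<inter> g -` fst d)) (snd d \<circ> g \<circ> chart_inv c))"

text \<open>A tangent vector at \<open>p\<close> is given by its components in all the charts around \<open>p\<close>;
  the components are related by the differentials of the coordinate changes.\<close>

type_synonym ('p, 'e) tvec = "('p, 'e) chart \<Rightarrow> 'e"

definition tangent_space ::
    "('p, 'e::complex_normed) chart set \<Rightarrow> 'p \<Rightarrow> ('p, 'e) tvec set" where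
  "tangent_space A p = {\<xi>.
     (\<forall>c\<in>A. \<forall>d\<in>A. p \<in> fst c \<and> p \<in> fst d \<longrightarrow>
        \<xi> d = frechet_derivative (snd d \<circ> chart_inv c) (at (snd c p)) (\<xi> c)) \<and>
     (\<forall>c. \<not> (c \<in> A \<and> p \<in> fst c) \<longrightarrow> \<xi> c = 0)}"

definition pushforward ::
    "('p, 'e::complex_normed) chart set \<Rightarrow> ('q, 'f::complex_normed) chart set \<Rightarrow>
     ('p \<Rightarrow> 'q) \<Rightarrow> 'p \<Rightarrow> ('p, 'e) tvec \<Rightarrow> ('q, 'f) tvec" where
  "pushforward A B g p \<xi> = (\<lambda>d.
     let c = (SOME c. c \<in> A \<and> p \<in> fst c) in
     if d \<in> B \<and> g p \<in> fst d
     then frechet_derivative (snd d \<circ> g \<circ> chart_inv c) (at (snd c p)) (\<xi> c)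
     else 0)"


section \<open>The projective line\<close>

datatype cp1 = Fin complex | Infty

text \<open>The inverse of the affine coordinate \<open>1/z\<close> around \<open>Infty\<close>.\<close>

definition Fin_inverse :: "complex \<Rightarrow> cp1" where
  "Fin_inverse w = (if w = 0 then Infty else Fin (1 / w))"

instantiation cp1 :: topological_space
begin
definition open_cp1 :: "cp1 set \<Rightarrow> bool" where
  "open_cp1 W \<longleftrightarrow> open (Fin -` W) \<and> open (Fin_inverse -` W)"
instance
  by standard (auto simp: open_cp1_def vimage_Union)
end

definition cp1_atlas :: "(cp1, complex) chart set" where
  "cp1_atlas =
     {(range Fin, \<lambda>p. case p of Fin z \<Rightarrow> z | Infty \<Rightarrow> 0),
      (- {Fin 0}, \<lambda>p. case p of Fin z \<Rightarrow> 1 / z | Infty \<Rightarrow> 0)}"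


section \<open>Rational curves and their normal bundles\<close>

text \<open>Since \<open>cp1\<close> is compact, an injective immersion of \<open>cp1\<close> into a Hausdorff manifold is
  an embedding.\<close>

definition cp1_embedding ::
    "('s::topological_space, 'e::complex_normed) chart set \<Rightarrow> (cp1 \<Rightarrow> 's) \<Rightarrow> bool" where
  "cp1_embedding A g \<longleftrightarrow> holo_map_on UNIV cp1_atlas A g \<and> inj g \<and>
     (\<forall>z. inj_on (pushforward cp1_atlas A g z) (tangent_space cp1_atlas z))"

definition rational_curve ::
    "('s::topological_space, 'e::complex_normed) chart set \<Rightarrow> 's set \<Rightarrow> bool" where
  "rational_curve A C \<longleftrightarrow> (\<exists>g. cp1_embedding A g \<and> range g = C)"

text \<open>The fibre at \<open>g z\<close> of the normal bundle of the curve \<open>range g\<close> consists of the cosets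
  \<open>normal_class A g z \<xi>\<close> modulo the tangent line of the curve.\<close>

definition normal_class ::
    "('s, 'e::complex_normed) chart set \<Rightarrow> (cp1 \<Rightarrow> 's) \<Rightarrow> cp1 \<Rightarrow>
     ('s, 'e) tvec \<Rightarrow> ('s, 'e) tvec set" where
  "normal_class A g z \<xi> =
     {(\<lambda>d. \<xi> d + pushforward cp1_atlas A g z \<zeta> d) | \<zeta>. \<zeta> \<in> tangent_space cp1_atlas z}"

definition holo_field_along ::
    "('s, 'e::complex_normed) chart set \<Rightarrow> (cp1 \<Rightarrow> 's) \<Rightarrow> cp1 set \<Rightarrow>
     (cp1 \<Rightarrow> ('s, 'e) tvec) \<Rightarrow> bool" where
  "holo_field_along A g W \<xi> \<longleftrightarrow> (\<forall>z\<in>W. \<xi> z \<in> tangent_space A (g z)) \<and>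
     (\<forall>c\<in>cp1_atlas. \<forall>d\<in>A.
        holo_on (snd c ` (fst c \<inter> W \<inter> g -` fst d)) (\<lambda>t. \<xi> (chart_inv c t) d))"

definition normal_section ::
    "('s, 'e::complex_normed) chart set \<Rightarrow> (cp1 \<Rightarrow> 's) \<Rightarrow> cp1 set \<Rightarrow>
     (cp1 \<Rightarrow> ('s, 'e) tvec set) \<Rightarrow> bool" where
  "normal_section A g W \<nu> \<longleftrightarrow>
     (\<forall>z0\<in>W. \<exists>W' \<xi>. open W' \<and> z0 \<in> W' \<and> W' \<subseteq> W \<and> holo_field_along A g W' \<xi> \<and>
        (\<forall>z\<in>W'. \<nu> z = normal_class A g z (\<xi> z)))"

text \<open>\<open>\<O>(n)\<close> is the line bundle glued from trivial bundles over \<open>range Fin\<close> and \<open>- {Fin 0}\<close>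
  whose frames \<open>e0\<close>, \<open>e1\<close> satisfy \<open>e1 = z ^ n e0\<close>, so that its global sections
  \<open>f0 e0 = f1 e1\<close> are given by the polynomials \<open>f0\<close> of degree at most \<open>n\<close>. An isomorphism from
  \<open>\<O>(n)\<close> to the normal bundle is a pair \<open>\<nu>0\<close>, \<open>\<nu>1\<close> of images of these frames.\<close>

definition normal_bundle_iso_O ::
    "('s::topological_space, 'e::complex_normed) chart set \<Rightarrow> 's set \<Rightarrow> nat \<Rightarrow> bool" where
  "normal_bundle_iso_O A C n \<longleftrightarrow> (\<exists>g \<nu>0 \<nu>1. cp1_embedding A g \<and> range g = C \<and>
     normal_section A g (range Fin) \<nu>0 \<and> (\<forall>z\<in>range Fin. (\<lambda>_. 0) \<notin> \<nu>0 z) \<and>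
     normal_section A g (- {Fin 0}) \<nu>1 \<and> (\<forall>z\<in>- {Fin 0}. (\<lambda>_. 0) \<notin> \<nu>1 z) \<and>
     (\<forall>z. z \<noteq> 0 \<longrightarrow> \<nu>1 (Fin z) = (\<lambda>\<xi> d. z ^ n *\<^sub>C \<xi> d) ` \<nu>0 (Fin z)))"


section \<open>Complete families of rational curves\<close>

text \<open>\<open>F\<close> parametrizes the curves \<open>L a\<close>, \<open>a \<in> V\<close>, holomorphically.\<close>

definition family_param ::
    "('s::topological_space, 'e::complex_normed) chart set \<Rightarrow>
     ('m::topological_space, 'f::complex_normed) chart set \<Rightarrow>
     ('m \<Rightarrow> 's set) \<Rightarrow> 'm set \<Rightarrow> ('m \<Rightarrow> cp1 \<Rightarrow> 's) \<Rightarrow> bool" where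
  "family_param A B L V F \<longleftrightarrow> open V \<and>
     holo_map_on (V \<times> UNIV) (prod_atlas B cp1_atlas) A (\<lambda>(a, z). F a z) \<and>
     (\<forall>a\<in>V. cp1_embedding A (F a) \<and> range (F a) = L a)"

text \<open>The characteristic (Kodaira) map from the tangent space of the parameter manifold at
  \<open>a\<close> to the sections of the normal bundle of \<open>L a\<close>.\<close>

definition kodaira_map ::
    "('s, 'e::complex_normed) chart set \<Rightarrow> ('m, 'f::complex_normed) chart set \<Rightarrow>
     ('m \<Rightarrow> cp1 \<Rightarrow> 's) \<Rightarrow> 'm \<Rightarrow> ('m, 'f) tvec \<Rightarrow> cp1 \<Rightarrow> ('s, 'e) tvec set" where
  "kodaira_map A B F a \<tau> =
     (\<lambda>z. normal_class A (F a) z (pushforward B A (\<lambda>b. F b z) a \<tau>))"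

text \<open>Completeness is meant in Kodaira's sense: every characteristic map, which is linear, is an
  isomorphism onto the space of global sections of the normal bundle.\<close>

definition complete_family ::
    "('s::topological_space, 'e::complex_normed) chart set \<Rightarrow>
     ('m::topological_space, 'f::complex_normed) chart set \<Rightarrow> ('m \<Rightarrow> 's set) \<Rightarrow> bool" where
  "complete_family A B L \<longleftrightarrow> (\<forall>a. \<exists>V F. a \<in> V \<and> family_param A B L V F \<and>
     bij_betw (kodaira_map A B F a) (tangent_space B a) {\<nu>. normal_section A (F a) UNIV \<nu>})"


section \<open>Jets of curves in a complex surface\<close>

text \<open>Near \<open>p\<close> the curve \<open>C\<close> is the graph of \<open>Y\<close> in the coordinates \<open>(x, y)\<close> given by \<open>d\<close>.\<close>

definition graph_at ::
    "('s::topological_space, complex \<times> complex) chart \<Rightarrow> 's set \<Rightarrow> 's \<Rightarrow>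
     (complex \<Rightarrow> complex) \<Rightarrow> bool" where
  "graph_at d C p Y \<longleftrightarrow> (\<exists>N I. open N \<and> p \<in> N \<and> p \<in> C \<and> N \<subseteq> fst d \<and> open I \<and>
     Y holomorphic_on I \<and> snd d ` (C \<inter> N) = (\<lambda>x. (x, Y x)) ` I)"

text \<open>A \<open>k\<close>-jet is given by its coordinates \<open>(x, y_0, \<dots>, y_k)\<close> (padded with zeros) in all the
  charts \<open>(x, y)\<close> of the surface in which it is transverse to the lines \<open>x = const\<close>.\<close>

type_synonym 's jet =
  "('s, complex \<times> complex) chart \<Rightarrow> (complex \<times> (nat \<Rightarrow> complex)) option"

definition curve_jet ::
    "('s::topological_space, complex \<times> complex) chart set \<Rightarrow> nat \<Rightarrow> 's set \<Rightarrow> 's \<Rightarrow> 's jet" where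
  "curve_jet A k C p = (\<lambda>d.
     if d \<in> max_atlas A \<and> (\<exists>Y. graph_at d C p Y)
     then let x = fst (snd d p); Y = (SOME Y. graph_at d C p Y)
          in Some (x, \<lambda>i. if i \<le> k then (deriv ^^ i) Y x else 0)
     else None)"

definition lifts ::
    "('s::topological_space, complex \<times> complex) chart set \<Rightarrow> nat \<Rightarrow> ('m \<Rightarrow> 's set) \<Rightarrow>
     's jet set" where
  "lifts A k L = {curve_jet A k (L a) p | a p. p \<in> L a}"


section \<open>Ordinary differential equations\<close>

text \<open>For \<open>CARD('b) = n + 1\<close> the coordinates \<open>y_0, \<dots>, y_n\<close> are stored in a vector of type
  \<open>complex ^ 'b\<close> by means of the enumeration \<open>to_nat_on UNIV\<close> of \<open>'b\<close> by \<open>{0..n}\<close>.\<close>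

definition pack :: "(nat \<Rightarrow> complex) \<Rightarrow> complex ^ 'b::finite" where
  "pack y = (\<chi> i. y (to_nat_on (UNIV :: 'b set) i))"

definition unpack :: "complex ^ 'b::finite \<Rightarrow> nat \<Rightarrow> complex" where
  "unpack v i = v $ from_nat_into (UNIV :: 'b set) i"

text \<open>In the coordinates of \<open>J^{n+1}(S)\<close> induced by \<open>d\<close>, the subset \<open>E\<close> is given near
  \<open>(q, f q)\<close>, \<open>q = (x, y_0, \<dots>, y_n)\<close>, by the equation \<open>y_{n+1} = f(x, y_0, \<dots>, y_n)\<close>.\<close>

definition local_equation ::
    "nat \<Rightarrow> 's jet set \<Rightarrow> ('s, complex \<times> complex) chart \<Rightarrow>
     (complex \<times> (complex ^ 'b::finite) \<Rightarrow> complex) \<Rightarrow> complex \<times> (complex ^ 'b) \<Rightarrow> bool" where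
  "local_equation n E d f q \<longleftrightarrow> (\<exists>U V. open U \<and> holo_on U f \<and> open V \<and> V \<subseteq> U \<times> UNIV \<and>
     (q, f q) \<in> V \<and>
     (\<forall>(r, w)\<in>V. (\<exists>j\<in>E. \<exists>x y. j d = Some (x, y) \<and> r = (x, pack y) \<and> w = y (n + 1))
        \<longleftrightarrow> w = f r))"

definition is_solution ::
    "nat \<Rightarrow> (complex \<times> (complex ^ 'b::finite) \<Rightarrow> complex) \<Rightarrow> complex set \<Rightarrow>
     (complex \<Rightarrow> complex) \<Rightarrow> bool" where
  "is_solution n f I Y \<longleftrightarrow> open I \<and> Y holomorphic_on I \<and>
     (\<forall>x\<in>I. (deriv ^^ (n + 1)) Y x = f (x, pack (\<lambda>i. (deriv ^^ i) Y x)))"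

definition solution_through ::
    "nat \<Rightarrow> (complex \<times> (complex ^ 'b::finite) \<Rightarrow> complex) \<Rightarrow> complex \<times> (complex ^ 'b) \<Rightarrow>
     complex \<Rightarrow> complex" where
  "solution_through n f q = (SOME Y. \<exists>I. fst q \<in> I \<and> is_solution n f I Y \<and>
     pack (\<lambda>i. (deriv ^^ i) Y (fst q)) = snd q)"

definition partial_y ::
    "(complex \<times> (complex ^ 'b::finite) \<Rightarrow> complex) \<Rightarrow> nat \<Rightarrow> complex \<times> (complex ^ 'b) \<Rightarrow> complex" where
  "partial_y f i q =
     frechet_derivative f (at q) (0, axis (from_nat_into (UNIV :: 'b set) i) 1)"

text \<open>The coefficients of the linearization \<open>h^(n+1) + p_n h^(n) + \<dots> + p_0 h = 0\<close> along \<open>Y\<close>.\<close>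

definition linearization ::
    "(complex \<times> (complex ^ 'b::finite) \<Rightarrow> complex) \<Rightarrow> (complex \<Rightarrow> complex) \<Rightarrow>
     nat \<Rightarrow> complex \<Rightarrow> complex" where
  "linearization f Y i x = - partial_y f i (x, pack (\<lambda>m. (deriv ^^ m) Y x))"


section \<open>Wilczynski invariants\<close>

definition solves_linear ::
    "nat \<Rightarrow> (nat \<Rightarrow> complex \<Rightarrow> complex) \<Rightarrow> complex set \<Rightarrow> (complex \<Rightarrow> complex) \<Rightarrow> bool" where
  "solves_linear n p J y \<longleftrightarrow>
     (\<forall>x\<in>J. (deriv ^^ (n + 1)) y x + (\<Sum>i\<le>n. p i x * (deriv ^^ i) y x) = 0)"

text \<open>On the neighbourhood \<open>I\<close> of \<open>x\<close>, the transformation \<open>(x, y) \<mapsto> (\<lambda>(x), \<mu>(x) y)\<close> brings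
  the linear equation with coefficients \<open>p\<close> to the Laguerre-Forsyth form with coefficients
  \<open>q\<close>; the functions \<open>y\<close> and \<open>u\<close> correspond to each other if \<open>u(\<lambda>(x)) = \<mu>(x) y(x)\<close>.\<close>

definition laguerre_forsyth ::
    "nat \<Rightarrow> (nat \<Rightarrow> complex \<Rightarrow> complex) \<Rightarrow> complex \<Rightarrow> complex set \<Rightarrow> (complex \<Rightarrow> complex) \<Rightarrow>
     (complex \<Rightarrow> complex) \<Rightarrow> (nat \<Rightarrow> complex \<Rightarrow> complex) \<Rightarrow> bool" where
  "laguerre_forsyth n p x I lam mu q \<longleftrightarrow> open I \<and> x \<in> I \<and>
     lam holomorphic_on I \<and> inj_on lam I \<and> mu holomorphic_on I \<and> (\<forall>t\<in>I. mu t \<noteq> 0) \<and>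
     (\<forall>i\<le>n. q i holomorphic_on lam ` I) \<and>
     (\<forall>t\<in>lam ` I. q n t = 0 \<and> q (n - 1) t = 0) \<and>
     (\<forall>J u. open J \<and> J \<subseteq> I \<and> u holomorphic_on lam ` J \<longrightarrow>
        (solves_linear n p J (\<lambda>t. u (lam t) / mu t) \<longleftrightarrow> solves_linear n q (lam ` J) u))"

definition theta_LF :: "nat \<Rightarrow> nat \<Rightarrow> (nat \<Rightarrow> complex \<Rightarrow> complex) \<Rightarrow> complex \<Rightarrow> complex" where
  "theta_LF n k q t = (\<Sum>j=1..k - 2. (-1) ^ (j + 1) *
     (fact (2 * k - j - 1) * fact (n + j - k) / (fact (k - j) * fact (j - 1))) *
     (deriv ^^ (j - 1)) (q (n + j - k)) t)"

definition wilczynski :: "nat \<Rightarrow> nat \<Rightarrow> (nat \<Rightarrow> complex \<Rightarrow> complex) \<Rightarrow> complex \<Rightarrow> complex" where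
  "wilczynski n k p x = (THE w. \<exists>I lam mu q. laguerre_forsyth n p x I lam mu q \<and>
     w = (deriv lam x) ^ k * theta_LF n k q (lam x))"

definition W_fun ::
    "nat \<Rightarrow> nat \<Rightarrow> (complex \<times> (complex ^ 'b::finite) \<Rightarrow> complex) \<Rightarrow> complex \<times> (complex ^ 'b) \<Rightarrow>
     complex" where
  "W_fun n k f q = wilczynski n k (linearization f (solution_through n f q)) (fst q)"

definition D_field ::
    "nat \<Rightarrow> (complex \<times> (complex ^ 'b::finite) \<Rightarrow> complex) \<Rightarrow> complex \<times> (complex ^ 'b) \<Rightarrow>
     complex \<times> (complex ^ 'b)" where
  "D_field n f q = (1, pack (\<lambda>i. if i < n then unpack (snd q) (i + 1) else f q))"

definition E_line ::
    "nat \<Rightarrow> (complex \<times> (complex ^ 'b::finite) \<Rightarrow> complex) \<Rightarrow> complex \<times> (complex ^ 'b) \<Rightarrow>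
     (complex \<times> (complex ^ 'b)) set" where
  "E_line n f q = {c *\<^sub>C D_field n f q | c. True}"

text \<open>The element of \<open>S^k E^*\<close> at \<open>q\<close> with value \<open>W_k\<close> on \<open>(D, \<dots>, D)\<close>, as a \<open>k\<close>-linear form in
  \<open>v 0, \<dots>, v (k - 1)\<close>; every \<open>v\<close> in \<open>E_line n f q\<close> is \<open>fst v *\<^sub>C D_field n f q\<close>.\<close>

definition gen_wilczynski ::
    "nat \<Rightarrow> nat \<Rightarrow> (complex \<times> (complex ^ 'b::finite) \<Rightarrow> complex) \<Rightarrow> complex \<times> (complex ^ 'b) \<Rightarrow>
     (nat \<Rightarrow> complex \<times> (complex ^ 'b)) \<Rightarrow> complex" where
  "gen_wilczynski n k f q v = (\<Prod>i<k. fst (v i)) * W_fun n k f q"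

end

theory Submission
  imports Defs
begin

text \<open>The solutions of the linearization of the equation along a curve of the family are the
  infinitesimal deformations of the curve, that is, the global sections of its normal bundle. If
  the normal bundle is \<open>\<O>(n)\<close> and \<open>\<zeta>\<close> is an affine coordinate of the curve, these are the
  functions \<open>P(\<zeta>) / \<mu>\<close> with \<open>P\<close> a polynomial of degree at most \<open>n\<close>. Hence \<open>(\<zeta>, \<mu>)\<close>
  transforms the linearization into \<open>u^(n+1) = 0\<close>, and every other transformation to a
  Laguerre-Forsyth form differs from it by a Moebius transformation, so it also leads to
  \<open>u^(n+1) = 0\<close>.

  That the normal bundle of an arbitrary curve of the family is \<open>\<O>(n)\<close> is obtained directly from
  completeness, which says that it has \<open>n + 1\<close> independent sections: some nonzero section vanishes
  to order \<open>n\<close> at a given point, and dividing it by powers of the coordinate gives all sections.\<close>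

section \<open>Power series and linear differential operators\<close>

text \<open>The definitions involve choices: \<open>wilczynski\<close> is a definite description
  over all Laguerre-Forsyth transformations, while \<open>solution_through\<close> and the function
  behind \<open>curve_jet\<close> come from a choice operator. So one good transformation is not
  enough: every transformation must give zero, a solution must be determined near its point by its
  n-jet, and a jet must not depend on the function used to compute it. The curves of the family
  share the parameter s but not the abscissa x. Varying the curve at fixed x is therefore expressed
  in the coordinates (t, s), by \<open>Dt\<close> and \<open>Dx\<close>, and only one-variable
  derivatives occur. Linear operators are evaluated on Taylor series at a point. In the centred
  basis m (z - z(t))^k the k-th function vanishes to order exactly k, so it tests the coefficients
  of index at least k and the derivative of order n + 1; going down from k = n one coefficient is
  reached at a time.\<close>

abbreviation (input) analytic_at :: "(complex \<Rightarrow> complex) \<Rightarrow> complex \<Rightarrow> bool" where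
  "analytic_at f z \<equiv> f analytic_on {z}"

lemma fps_expansion_eqI_shift:
  "(\<lambda>x. f (z + x)) has_fps_expansion F \<Longrightarrow> fps_expansion f z = F"
  using fps_expansion_eqI[of "\<lambda>x. f (z + x)" F] higher_deriv_shift_0[of _ f z]
  by (simp add: fps_expansion_def o_def)

lemma fps_expansion_mult:
  assumes "analytic_at f z" "analytic_at g z"
  shows "fps_expansion (\<lambda>x. f x * g x) z = fps_expansion f z * fps_expansion g z"
  by (rule fps_expansion_eqI_shift)
     (intro has_fps_expansion_mult analytic_at_imp_has_fps_expansion assms)

lemma fps_expansion_power:
  assumes "analytic_at f z"
  shows "fps_expansion (\<lambda>x. f x ^ k) z = fps_expansion f z ^ k"
  by (rule fps_expansion_eqI_shift)
     (intro has_fps_expansion_power analytic_at_imp_has_fps_expansion assms)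

lemma fps_expansion_cmult:
  assumes "analytic_at f z"
  shows "fps_expansion (\<lambda>x. c * f x) z = fps_const c * fps_expansion f z"
  by (rule fps_expansion_eqI_shift)
     (intro has_fps_expansion_cmult_left analytic_at_imp_has_fps_expansion assms)

lemma fps_expansion_add:
  assumes "analytic_at f z" "analytic_at g z"
  shows "fps_expansion (\<lambda>x. f x + g x) z = fps_expansion f z + fps_expansion g z"
  by (rule fps_expansion_eqI_shift)
     (intro has_fps_expansion_add analytic_at_imp_has_fps_expansion assms)

lemma fps_expansion_sum:
  assumes "\<And>i. i \<in> I \<Longrightarrow> analytic_at (f i) z"
  shows "fps_expansion (\<lambda>x. \<Sum>i\<in>I. f i x) z = (\<Sum>i\<in>I. fps_expansion (f i) z)"
  by (rule fps_expansion_eqI_shift)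
     (intro has_fps_expansion_sum analytic_at_imp_has_fps_expansion assms)

lemma fps_expansion_vanish:
  assumes "analytic_at f z" "f z = 0"
  shows "fps_expansion f z = fps_X * fps_shift 1 (fps_expansion f z)"
  by (rule fps_ext) (use assms in \<open>simp add: fps_expansion_def\<close>)

lemma higher_deriv_fps: "(deriv ^^ k) f z = fact k * fps_nth (fps_expansion f z) k"
  by (simp add: fps_expansion_def)

definition lin_op :: "nat \<Rightarrow> (nat \<Rightarrow> complex \<Rightarrow> complex) \<Rightarrow> (complex \<Rightarrow> complex) \<Rightarrow> complex \<Rightarrow> complex"
  where "lin_op n p y x = (deriv ^^ (n + 1)) y x + (\<Sum>i\<le>n. p i x * (deriv ^^ i) y x)"

text \<open>The operator at one point as a functional on Taylor series there. Its linearity is then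
  plain algebra, and products are expanded by multiplying series instead of by rules for higher
  derivatives.\<close>

definition lin_op_fps :: "nat \<Rightarrow> (nat \<Rightarrow> complex) \<Rightarrow> complex fps \<Rightarrow> complex"
  where "lin_op_fps n a F = fact (n + 1) * fps_nth F (n + 1) + (\<Sum>i\<le>n. a i * (fact i * fps_nth F i))"

lemma lin_op_fps: "lin_op n p y x = lin_op_fps n (\<lambda>i. p i x) (fps_expansion y x)"
  unfolding lin_op_def lin_op_fps_def higher_deriv_fps ..

lemma solves_linear_iff: "solves_linear n p J y \<longleftrightarrow> (\<forall>x\<in>J. lin_op n p y x = 0)"
  by (simp add: solves_linear_def lin_op_def)

lemma lin_op_fps_add: "lin_op_fps n a (F + G) = lin_op_fps n a F + lin_op_fps n a G"
  by (simp add: lin_op_fps_def algebra_simps sum.distrib)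

lemma lin_op_fps_cmult: "lin_op_fps n a (fps_const c * F) = c * lin_op_fps n a F"
  by (simp add: lin_op_fps_def algebra_simps sum_distrib_left)

lemma lin_op_fps_sum: "lin_op_fps n a (\<Sum>i\<in>I. F i) = (\<Sum>i\<in>I. lin_op_fps n a (F i))"
proof (induction I rule: infinite_finite_induct)
  case (insert i I) then show ?case by (simp add: lin_op_fps_add)
qed (simp_all add: lin_op_fps_def)

lemma lin_op_cong_ev:
  "eventually (\<lambda>t. y t = y' t) (nhds x) \<Longrightarrow> lin_op n p y x = lin_op n p y' x"
  unfolding lin_op_fps by (simp add: fps_expansion_cong)

text \<open>The binomial theorem puts m (z - c)^i into the span of the m z^j with j \<le> i. With c
  the value of z at the point, this yields solutions with prescribed order of vanishing.\<close>

lemma lin_op_translate: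
  assumes an: "analytic_at m x" "analytic_at z x"
    and sol: "\<And>j. j \<le> i \<Longrightarrow> lin_op n p (\<lambda>t. m t * z t ^ j) x = 0"
  shows "lin_op n p (\<lambda>t. m t * (z t - c) ^ i) x = 0"
proof -
  have "(\<lambda>t. m t * (z t - c) ^ i) = (\<lambda>t. \<Sum>j\<le>i. (of_nat (i choose j) * (-c) ^ (i - j)) * (m t * z t ^ j))"
    by (rule ext) (simp add: binomial_ring[of _ "-c", simplified] sum_distrib_left mult_ac)
  moreover have "analytic_at (\<lambda>t. m t * z t ^ j) x" for j
    by (intro analytic_intros an)
  moreover have "analytic_at (\<lambda>t. (of_nat (i choose j) * (-c) ^ (i - j)) * (m t * z t ^ j)) x" for j
    by (intro analytic_intros an)
  ultimately have "fps_expansion (\<lambda>t. m t * (z t - c) ^ i) x =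
     (\<Sum>j\<le>i. fps_const (of_nat (i choose j) * (-c) ^ (i - j)) * fps_expansion (\<lambda>t. m t * z t ^ j) x)"
    by (simp add: fps_expansion_sum fps_expansion_cmult)
  then show ?thesis
    using sol by (simp add: lin_op_fps lin_op_fps_sum lin_op_fps_cmult)
qed

text \<open>Here and in the next lemma W is thought of as w (1 + b X + c X^2 + ...), which keeps the
  coefficients of W^k homogeneous in w.\<close>

lemma fps_power_nth_1:
  fixes W :: "complex fps"
  assumes "fps_nth W 0 = w" "fps_nth W 1 = w * b"
  shows "fps_nth (W ^ k) 1 = of_nat k * w ^ k * b"
proof (induction k)
  case (Suc k)
  then show ?case using assms by (simp add: fps_mult_nth fps_nth_power_0 algebra_simps)
qed simp

lemma fps_power_nth_2:
  fixes W :: "complex fps"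
  assumes "fps_nth W 0 = w" "fps_nth W 1 = w * b" "fps_nth W 2 = w * c"
  shows "fps_nth (W ^ k) 2 = w ^ k * (of_nat k * c + of_nat k * (of_nat k - 1) / 2 * b\<^sup>2)"
proof (induction k)
  case (Suc k)
  have "fps_nth (W ^ Suc k) 2 = w * fps_nth (W ^ k) 2 + w * b * fps_nth (W ^ k) 1 + w * c * w ^ k"
    using assms by (simp add: fps_mult_nth numeral_2_eq_2 fps_nth_power_0)
  then show ?case unfolding Suc fps_power_nth_1[OF assms(1,2)]
    by (simp add: field_simps power2_eq_square)
qed simp

lemma fps_mult_degree:
  fixes F G :: "complex fps"
  assumes "\<And>j. j > a \<Longrightarrow> fps_nth F j = 0" "\<And>j. j > b \<Longrightarrow> fps_nth G j = 0" "j > a + b"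
  shows "fps_nth (F * G) j = 0"
proof -
  have "fps_nth F i * fps_nth G (j - i) = 0" if "i \<le> j" for i
    using assms(1)[of i] assms(2)[of "j - i"] assms(3) that by (cases "i > a") auto
  then show ?thesis by (auto simp: fps_mult_nth intro!: sum.neutral)
qed

lemma fps_power_degree:
  fixes F :: "complex fps"
  assumes "\<And>j. j > 1 \<Longrightarrow> fps_nth F j = 0" "j > k"
  shows "fps_nth (F ^ k) j = 0"
  using assms(2)
proof (induction k arbitrary: j)
  case (Suc k)
  then show ?case using fps_mult_degree[of 1 F k "F ^ k" j] assms(1) by auto
qed simp

text \<open>Turns a vanishing second derivative on an open set into a degree bound for the Taylor
  series, so that products of n such functions can be bounded by \<open>fps_mult_degree\<close> and
  \<open>fps_power_degree\<close>.\<close>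

lemma fps_expansion_second_deriv_zero:
  assumes "f holomorphic_on S" "open S" "t \<in> S" "\<And>t. t \<in> S \<Longrightarrow> deriv (deriv f) t = 0" "j > 1"
  shows "fps_nth (fps_expansion f t) j = 0"
proof -
  obtain i where j: "j = i + 2" using \<open>j > 1\<close> by (metis add.commute less_eqE Suc_1 Suc_leI)
  have "(deriv ^^ i) (deriv (deriv f)) t = (deriv ^^ i) (\<lambda>_. 0) t"
    using eventually_nhds_in_open[OF assms(2,3)]
    by (intro higher_deriv_cong_ev) (auto elim!: eventually_mono simp: assms(4))
  moreover have "(deriv ^^ j) f = (deriv ^^ i) ((deriv ^^ 2) f)"
    by (simp only: j funpow_add o_apply)
  ultimately have "(deriv ^^ j) f t = 0"
    by (simp add: numeral_2_eq_2)
  then show ?thesis by (simp add: fps_expansion_def)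
qed

text \<open>The series of z - z(t) is X times a series with constant term z'(t). If m and z' do not
  vanish at t, the order of vanishing is thus exactly k.\<close>

lemma fps_expansion_mult_power_vanish:
  assumes "analytic_at m t" "analytic_at z t"
  shows "fps_expansion (\<lambda>s. m s * (z s - z t) ^ k) t =
    fps_X ^ k * (fps_expansion m t * fps_shift 1 (fps_expansion z t) ^ k)"
proof -
  have "fps_expansion (\<lambda>s. z s - z t) t = fps_X * fps_shift 1 (fps_expansion (\<lambda>s. z s - z t) t)"
    by (rule fps_expansion_vanish) (auto intro!: analytic_intros assms)
  also have "fps_expansion (\<lambda>s. z s - z t) t = fps_expansion z t + fps_expansion (\<lambda>s. - z t) t"
    using fps_expansion_add[of z t "\<lambda>s. - z t"] assms by (auto intro!: analytic_intros)
  also have "fps_shift 1 (fps_expansion z t + fps_expansion (\<lambda>s. - z t) t) = fps_shift 1 (fps_expansion z t)"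
    by (rule fps_ext) (simp add: fps_expansion_def)
  finally have "fps_expansion (\<lambda>s. z s - z t) t = fps_X * fps_shift 1 (fps_expansion z t)"
    using fps_expansion_add[of z t "\<lambda>s. - z t"] assms by (auto intro!: analytic_intros)
  moreover have "analytic_at (\<lambda>s. z s - z t) t" "analytic_at (\<lambda>s. (z s - z t)^k) t"
    by (auto intro!: analytic_intros assms)
  ultimately show ?thesis
    by (simp add: fps_expansion_mult assms fps_expansion_power power_mult_distrib mult_ac)
qed

section \<open>Symmetric powers in Laguerre-Forsyth form\<close>

lemma fps_expansion_nth_simps:
  "fps_nth (fps_expansion f t) 0 = f t" "fps_nth (fps_expansion f t) 1 = deriv f t"
  "fps_nth (fps_expansion f t) (Suc 0) = deriv f t"
  "fps_nth (fps_expansion f t) 2 = deriv (deriv f) t / 2"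
  "fps_nth (fps_expansion f t) 3 = deriv (deriv (deriv f)) t / 6"
  by (simp_all add: fps_expansion_def numeral_2_eq_2 numeral_3_eq_3 fact_numeral)

text \<open>The two highest normalised coefficients of an equation with solutions \<open>m * z ^ i\<close> determine
  \<open>m\<close> up to a constant and force the Schwarzian derivative of \<open>z\<close>, which is
  \<open>2 * (B' - B\<^sup>2)\<close> for \<open>B = z'' / (2 * z')\<close>, to vanish.\<close>

lemma lf_symmetric_power_relations:
  fixes m z :: "complex \<Rightarrow> complex"
  assumes "open S" "m holomorphic_on S" "z holomorphic_on S" "1 \<le> n"
    and m0: "\<And>t. t \<in> S \<Longrightarrow> m t \<noteq> 0" and z0: "\<And>t. t \<in> S \<Longrightarrow> deriv z t \<noteq> 0"
    and q0: "\<And>t. t \<in> S \<Longrightarrow> q n t = 0 \<and> q (n - 1) t = 0"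
    and sol: "\<And>t i. t \<in> S \<Longrightarrow> i \<le> n \<Longrightarrow> lin_op n q (\<lambda>t. m t * z t ^ i) t = 0"
    and B: "B = (\<lambda>t. deriv (deriv z) t / (2 * deriv z t))"
    and t: "t \<in> S"
  shows "deriv m t = - of_nat n * B t * m t" "deriv B t = (B t)\<^sup>2"
proof -
  have an: "analytic_at m t" "analytic_at z t" if "t \<in> S" for t
    using assms that by (auto simp: analytic_on_open holomorphic_on_imp_analytic_at)
  \<comment> \<open>\<open>F t k\<close> is the cofactor of X^k in the expansion at t of the
    solution m (z - z(t))^k.\<close>
  define F where "F = (\<lambda>t k. fps_expansion m t * fps_shift 1 (fps_expansion z t) ^ k)"
  have F: "lin_op_fps n (\<lambda>i. q i t) (fps_X ^ k * F t k) = 0" if "t \<in> S" "k \<le> n" for t k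
  proof -
    have "lin_op n q (\<lambda>s. m s * (z s - z t) ^ k) t = 0"
      by (rule lin_op_translate) (use an[OF that(1)] sol that in auto)
    then show ?thesis
      by (simp add: lin_op_fps fps_expansion_mult_power_vanish[OF an[OF that(1)]] F_def)
  qed
  \<comment> \<open>The form w (1 + b X + c X^2 + ...) with w = z', b = B = z'' / (2 z') and c =
    z''' / (6 z').\<close>
  have W: "fps_nth (fps_shift 1 (fps_expansion z t)) 0 = deriv z t"
    "fps_nth (fps_shift 1 (fps_expansion z t)) 1 = deriv z t * B t"
    "fps_nth (fps_shift 1 (fps_expansion z t)) 2 = deriv z t * (deriv (deriv (deriv z)) t / (6 * deriv z t))"
    if "t \<in> S" for t
    using z0[OF that] fps_expansion_nth_simps[of z t]
    by (simp_all add: B numeral_2_eq_2 numeral_3_eq_3)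
  \<comment> \<open>The solution vanishes to order n, so below the top derivative only q_n could
    contribute, and q_n = 0.\<close>
  have F1: "fps_nth (F t n) 1 = 0" if "t \<in> S" for t
  proof -
    have "lin_op_fps n (\<lambda>i. q i t) (fps_X ^ n * F t n) = fact (n + 1) * fps_nth (F t n) 1"
    proof -
      have "q i t * (fact i * fps_nth (fps_X ^ n * F t n) i) = 0" if "i \<le> n" for i
        using q0[OF \<open>t \<in> S\<close>] that by (cases "i = n") (auto simp: fps_X_power_mult_nth)
      then have "(\<Sum>i\<le>n. q i t * (fact i * fps_nth (fps_X ^ n * F t n) i)) = 0"
        by (intro sum.neutral) blast
      then show ?thesis unfolding lin_op_fps_def by (simp add: fps_X_power_mult_nth)
    qed
    then show ?thesis using F[OF that, of n] by (metis fact_nonzero le_refl mult_eq_0_iff)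
  qed
  \<comment> \<open>Now the solution vanishes to order n - 1, and the two terms that could
    contribute have the coefficients q_(n-1) and q_n, both zero.\<close>
  have F2: "fps_nth (F t (n - 1)) 2 = 0" if "t \<in> S" for t
  proof -
    have "lin_op_fps n (\<lambda>i. q i t) (fps_X ^ (n - 1) * F t (n - 1)) = fact (n + 1) * fps_nth (F t (n - 1)) 2"
    proof -
      have "q i t * (fact i * fps_nth (fps_X ^ (n - 1) * F t (n - 1)) i) = 0" if "i \<le> n" for i
        using q0[OF \<open>t \<in> S\<close>] that by (cases "i = n"; cases "i = n - 1") (auto simp: fps_X_power_mult_nth)
      then have "(\<Sum>i\<le>n. q i t * (fact i * fps_nth (fps_X ^ (n - 1) * F t (n - 1)) i)) = 0"
        by (intro sum.neutral) blast
      moreover have "fps_nth (fps_X ^ (n - 1) * F t (n - 1)) (n + 1) = fps_nth (F t (n - 1)) 2"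
        using \<open>1 \<le> n\<close> by (simp add: fps_X_power_mult_nth numeral_2_eq_2)
      ultimately show ?thesis unfolding lin_op_fps_def by simp
    qed
    then show ?thesis using F[OF that, of "n - 1"] by (metis fact_nonzero diff_le_self mult_eq_0_iff)
  qed
  have m': "deriv m t = - of_nat n * B t * m t" if "t \<in> S" for t
  proof -
    have "fps_nth (F t n) 1 = deriv z t ^ n * (deriv m t + of_nat n * B t * m t)"
      using W[OF that]
      unfolding F_def by (simp add: fps_mult_nth fps_power_nth_1[of _ "deriv z t" "B t", simplified] fps_nth_power_0
          fps_expansion_nth_simps algebra_simps)
    then show ?thesis using F1[OF that] z0[OF that] by (simp add: eq_neg_iff_add_eq_0)
  qed
  show "deriv m t = - of_nat n * B t * m t" using m'[OF t] .
  have holz: "deriv z holomorphic_on S" "deriv (deriv z) holomorphic_on S" "B holomorphic_on S"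
    unfolding B using assms by (auto intro!: holomorphic_intros)
  have dB: "(B has_field_derivative deriv B t) (at t)"
    using holz(3) \<open>open S\<close> t by (simp add: holomorphic_derivI)
  have dm: "(m has_field_derivative deriv m t) (at t)"
    using assms t by (simp add: holomorphic_derivI)
  have "deriv (deriv m) t = deriv (\<lambda>s. - of_nat n * B s * m s) t"
    using eventually_nhds_in_open[OF \<open>open S\<close> t] by (intro deriv_cong_ev) (auto elim!: eventually_mono simp: m')
  also have "\<dots> = - of_nat n * deriv B t * m t + of_nat n ^ 2 * (B t)\<^sup>2 * m t"
    by (rule DERIV_imp_deriv) (auto intro!: derivative_eq_intros dB dm simp: m'[OF t] power2_eq_square algebra_simps)
  finally have m'': "deriv (deriv m) t = - of_nat n * deriv B t * m t + of_nat n ^ 2 * (B t)\<^sup>2 * m t" .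
  have dz: "(deriv z has_field_derivative deriv (deriv z) t) (at t)"
    "(deriv (deriv z) has_field_derivative deriv (deriv (deriv z)) t) (at t)"
    using holz \<open>open S\<close> t by (simp_all add: holomorphic_derivI)
  have "deriv B t = deriv (deriv (deriv z)) t / (2 * deriv z t) - 2 * (B t)\<^sup>2"
    unfolding B by (rule DERIV_imp_deriv)
      (use z0[OF t] in \<open>auto intro!: derivative_eq_intros dz simp: field_simps power2_eq_square\<close>)
  \<comment> \<open>The third derivative of z is eliminated in favour of B and B', using B' = z''' /
    (2 z') - 2 B^2.\<close>
  then have c: "deriv (deriv (deriv z)) t / (6 * deriv z t) = (deriv B t + 2 * (B t)\<^sup>2) / 3"
    using z0[OF t] by (simp add: field_simps)
  have nn: "of_nat (n - 1) = (of_nat n - 1 :: complex)" using \<open>1 \<le> n\<close> by (simp add: of_nat_diff)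
  have "fps_nth (F t (n - 1)) 2 = deriv z t ^ (n - 1) * (deriv (deriv m) t / 2 + deriv m t * (of_nat n - 1) * B t
      + m t * ((of_nat n - 1) * ((deriv B t + 2 * (B t)\<^sup>2) / 3)  + (of_nat n - 1) * (of_nat n - 2) / 2 * (B t)\<^sup>2))"
  proof -
    let ?W = "fps_shift 1 (fps_expansion z t)"
    have "fps_nth (F t (n - 1)) 2 = m t * fps_nth (?W ^ (n - 1)) 2 + deriv m t * fps_nth (?W ^ (n - 1)) 1
        + deriv (deriv m) t / 2 * fps_nth (?W ^ (n - 1)) 0"
      using fps_expansion_nth_simps[of m t] unfolding F_def by (simp add: fps_mult_nth numeral_2_eq_2)
    then show ?thesis
      unfolding fps_power_nth_2[OF W[OF t]] fps_power_nth_1[OF W(1,2)[OF t]] fps_nth_power_0 W(1)[OF t] nn c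
      by (simp add: algebra_simps)
  qed
  then have "deriv (deriv m) t / 2 + deriv m t * (of_nat n - 1) * B t
      + m t * ((of_nat n - 1) * ((deriv B t + 2 * (B t)\<^sup>2) / 3)  + (of_nat n - 1) * (of_nat n - 2) / 2 * (B t)\<^sup>2) = 0"
    using F2[OF t] z0[OF t] by simp
  \<comment> \<open>After inserting m' = - n B m and its derivative, the coefficients of B^2 and B'
    in the relation are (n + 2) / 6 and - (n + 2) / 6 times m.\<close>
  moreover have "m t * (of_nat n + 2) * ((B t)\<^sup>2 - deriv B t) = 6 * (deriv (deriv m) t / 2 + deriv m t * (of_nat n - 1) * B t
      + m t * ((of_nat n - 1) * ((deriv B t + 2 * (B t)\<^sup>2) / 3)  + (of_nat n - 1) * (of_nat n - 2) / 2 * (B t)\<^sup>2))"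
    unfolding m'' m'[OF t] by (simp add: field_simps power2_eq_square)
  ultimately have "m t * (of_nat n + 2) * ((B t)\<^sup>2 - deriv B t) = 0"
    by (simp only: mult_zero_right)
  moreover have "of_nat n + 2 \<noteq> (0::complex)"
    by (metis of_nat_add of_nat_numeral of_nat_eq_0_iff add_is_0 zero_neq_numeral)
  ultimately show "deriv B t = (B t)\<^sup>2" using m0[OF t] by simp
qed

text \<open>Since B' = B^2, the function r = exp(- \<integral> B), a constant multiple of
  (z')^(-1/2), satisfies r'' = 0 and (z r)'' = 0; thus z is a Moebius transformation. Moreover m = C
  r^n, so m z^i = C r^(n-i) (z r)^i is a polynomial of degree at most n. The given equation and
  u^(n+1) = 0 therefore share n + 1 independent solutions, and their coefficients agree.\<close>

lemma lf_symmetric_power_trivial: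
  fixes m z :: "complex \<Rightarrow> complex"
  assumes "open S" "m holomorphic_on S" "z holomorphic_on S" "1 \<le> n"
    and m0: "\<And>t. t \<in> S \<Longrightarrow> m t \<noteq> 0" and z0: "\<And>t. t \<in> S \<Longrightarrow> deriv z t \<noteq> 0"
    and q0: "\<And>t. t \<in> S \<Longrightarrow> q n t = 0 \<and> q (n - 1) t = 0"
    and sol: "\<And>t i. t \<in> S \<Longrightarrow> i \<le> n \<Longrightarrow> lin_op n q (\<lambda>t. m t * z t ^ i) t = 0"
    and "t0 \<in> S"
  obtains e where "e > 0" "\<And>t i. t \<in> ball t0 e \<Longrightarrow> i \<le> n \<Longrightarrow> q i t = 0"
proof -
  obtain e where e: "e > 0" "ball t0 e \<subseteq> S" using \<open>open S\<close> \<open>t0 \<in> S\<close> openE by blast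
  let ?U = "ball t0 e"
  define B where "B = (\<lambda>t. deriv (deriv z) t / (2 * deriv z t))"
  note rel = lf_symmetric_power_relations[OF assms(1-4) m0 z0 q0 sol B_def]
  have hol: "m holomorphic_on ?U" "z holomorphic_on ?U"
    using assms e holomorphic_on_subset by blast+
  have holB: "B holomorphic_on ?U"
    unfolding B_def using hol z0 e by (auto intro!: holomorphic_intros)
  obtain P where P: "\<And>t. t \<in> ?U \<Longrightarrow> (P has_field_derivative - B t) (at t)"
    using holomorphic_convex_primitive'[of ?U "\<lambda>t. - B t"] holB
    by (metis at_within_open convex_ball holomorphic_on_minus open_ball)
  define r where "r = (\<lambda>t. exp (P t))"
  have dr: "(r has_field_derivative - (B t * r t)) (at t)" if "t \<in> ?U" for t
    unfolding r_def by (auto intro!: derivative_eq_intros P that)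
  have holr: "r holomorphic_on ?U"
    by (metis dr holomorphic_on_open open_ball)
  have dB: "(B has_field_derivative (B t)\<^sup>2) (at t)" if "t \<in> ?U" for t
    using rel(2)[of t] holB that e(2) holomorphic_derivI[of B ?U t] by auto
  have dm: "(m has_field_derivative - of_nat n * B t * m t) (at t)" if "t \<in> ?U" for t
    using rel(1)[of t] hol(1) that e(2) holomorphic_derivI[of m ?U t] by auto
  have dz: "(z has_field_derivative deriv z t) (at t)" if "t \<in> ?U" for t
    using hol(2) that holomorphic_derivI[of z ?U t] by auto
  have dz': "(deriv z has_field_derivative 2 * B t * deriv z t) (at t)" if "t \<in> ?U" for t
    using holomorphic_derivI[of "deriv z" ?U t] holomorphic_deriv[OF hol(2)] z0[of t] e that
    by (auto simp: B_def)
  have evU: "eventually (\<lambda>s. s \<in> ?U) (nhds t)" if "t \<in> ?U" for t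
    using that by (intro eventually_nhds_in_open) auto
  have r2: "deriv (deriv r) t = 0" if "t \<in> ?U" for t
  proof -
    have "deriv (deriv r) t = deriv (\<lambda>t. - B t * r t) t"
      using evU[OF that] by (intro deriv_cong_ev) (auto elim!: eventually_mono intro!: DERIV_imp_deriv dr)
    also have "\<dots> = 0"
      by (rule DERIV_imp_deriv)
        (auto intro!: derivative_eq_intros dr dB that simp: power2_eq_square algebra_simps)
    finally show ?thesis .
  qed
  have zr: "((\<lambda>t. z t * r t) has_field_derivative (deriv z t - z t * B t) * r t) (at t)" if "t \<in> ?U" for t
    by (auto intro!: derivative_eq_intros dr dz that simp: algebra_simps)
  have zr2: "deriv (deriv (\<lambda>t. z t * r t)) t = 0" if "t \<in> ?U" for t
  proof -
    have "deriv (deriv (\<lambda>t. z t * r t)) t = deriv (\<lambda>t. (deriv z t - z t * B t) * r t) t"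
      using evU[OF that] by (intro deriv_cong_ev) (auto elim!: eventually_mono intro!: DERIV_imp_deriv zr)
    also have "\<dots> = 0"
      by (rule DERIV_imp_deriv)
        (auto intro!: derivative_eq_intros dr dB dz dz' that simp: power2_eq_square algebra_simps)
    finally show ?thesis .
  qed
  have r0: "r t \<noteq> 0" for t by (simp add: r_def)
  \<comment> \<open>The logarithmic derivatives of m and r^n are both - n B.\<close>
  have "((\<lambda>t. m t / r t ^ n) has_field_derivative 0) (at t)" if "t \<in> ?U" for t
  proof -
    have "((\<lambda>t. m t / r t ^ n) has_field_derivative
       ((- of_nat n * B t * m t) * r t ^ n - m t * (of_nat n * r t ^ (n - 1) * (- B t * r t))) / (r t ^ n * r t ^ n)) (at t)"
      by (rule derivative_eq_intros dr dm that refl | simp add: r0)+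
    moreover have "r t ^ (n - 1) * r t = r t ^ n" using \<open>1 \<le> n\<close> by (metis Suc_diff_1 Suc_le_eq One_nat_def power_Suc2)
    then have "(- of_nat n * B t * m t) * r t ^ n - m t * (of_nat n * r t ^ (n - 1) * (- B t * r t)) = 0"
      by (simp add: algebra_simps)
    ultimately show ?thesis by (simp only: div_0)
  qed
  then obtain C where "\<And>t. t \<in> ?U \<Longrightarrow> m t / r t ^ n = C"
    using has_field_derivative_zero_constant[of ?U "\<lambda>t. m t / r t ^ n"]
    by (metis convex_ball has_field_derivative_at_within)
  then have mC: "m t = C * r t ^ n" if "t \<in> ?U" for t using that r0 by (simp add: field_simps)
  have an: "analytic_at m t" "analytic_at z t" "analytic_at r t" if "t \<in> ?U" for t
    using hol holr that by (auto simp: analytic_on_open holomorphic_on_imp_analytic_at)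
  have top: "fps_nth (fps_expansion (\<lambda>t. m t * z t ^ i) t) (n + 1) = 0" if "t \<in> ?U" "i \<le> n" for t i
  proof -
    have "fps_expansion (\<lambda>t. m t * z t ^ i) t = fps_expansion (\<lambda>t. C * (r t ^ (n - i) * (z t * r t) ^ i)) t"
    proof (rule fps_expansion_cong, rule eventually_mono[OF evU[OF that(1)]])
      fix s assume "s \<in> ?U"
      have "r s ^ n = r s ^ (n - i) * r s ^ i" using that(2) by (metis le_add_diff_inverse2 power_add)
      then show "m s * z s ^ i = C * (r s ^ (n - i) * (z s * r s) ^ i)"
        by (simp add: mC[OF \<open>s \<in> ?U\<close>] power_mult_distrib mult_ac)
    qed
    also have "\<dots> = fps_const C * (fps_expansion r t ^ (n - i) * fps_expansion (\<lambda>t. z t * r t) t ^ i)"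
    proof -
      have "analytic_at (\<lambda>t. r t ^ (n - i)) t" "analytic_at (\<lambda>t. z t * r t) t"
        "analytic_at (\<lambda>t. (z t * r t) ^ i) t" "analytic_at (\<lambda>t. r t ^ (n - i) * (z t * r t) ^ i) t"
        using an[OF that(1)] by (auto intro!: analytic_intros)
      then show ?thesis
        using an[OF that(1)] by (simp add: fps_expansion_cmult fps_expansion_mult[of "\<lambda>t. r t ^ (n - i)"] fps_expansion_power)
    qed
    also have "fps_nth \<dots> (n + 1) = 0"
    proof -
      have "fps_nth (fps_expansion r t) j = 0" "fps_nth (fps_expansion (\<lambda>t. z t * r t) t) j = 0" if "j > 1" for j
        using fps_expansion_second_deriv_zero[of _ ?U t j] holr hol r2 zr2 that \<open>t \<in> ?U\<close>
        by (auto intro!: holomorphic_intros)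
      then have "fps_nth (fps_expansion r t ^ (n - i) * fps_expansion (\<lambda>t. z t * r t) t ^ i) (n + 1) = 0"
        using \<open>i \<le> n\<close> by (intro fps_mult_degree[of "n - i" _ i] fps_power_degree) auto
      then show ?thesis by simp
    qed
    finally show ?thesis .
  qed
  \<comment> \<open>\<open>lin_op_translate\<close> for the zero coefficients, where the operator is
    just the derivative of order n + 1.\<close>
  have top': "fps_nth (fps_expansion (\<lambda>s. m s * (z s - z t) ^ i) t) (n + 1) = 0" if "t \<in> ?U" "i \<le> n" for t i
  proof -
    have "lin_op n (\<lambda>_ _. 0) (\<lambda>s. m s * (z s - z t) ^ i) t = 0"
      by (rule lin_op_translate) (use an[OF that(1)] top that in \<open>auto simp: lin_op_fps lin_op_fps_def\<close>)
    then show ?thesis by (simp add: lin_op_fps lin_op_fps_def del: fact_Suc)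
  qed
  \<comment> \<open>Descending induction on the index. In the equation for m (z - z(t))^(n-k), terms
    of index below n - k vanish by the order of the zero, those above by induction, and the top
    derivative by \<open>top'\<close>; the remaining term is q_(n-k) times a nonzero number.\<close>
  have "q (n - k) t = 0" if "t \<in> ?U" "k \<le> n" for t k
    using that(2)
  proof (induction k rule: less_induct)
    case (less k)
    let ?i = "n - k" and ?G = "\<lambda>k. fps_expansion m t * fps_shift 1 (fps_expansion z t) ^ k"
    have "lin_op n q (\<lambda>s. m s * (z s - z t) ^ ?i) t = 0"
      by (rule lin_op_translate) (use an[OF that(1)] sol that e in auto)
    then have "lin_op_fps n (\<lambda>i. q i t) (fps_X ^ ?i * ?G ?i) = 0"
      by (simp add: lin_op_fps fps_expansion_mult_power_vanish[OF an(1,2)[OF that(1)]])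
    moreover have "fps_nth (fps_X ^ ?i * ?G ?i) (n + 1) = 0"
      using top'[OF that(1), of ?i] fps_expansion_mult_power_vanish[OF an(1,2)[OF that(1)]] by simp
    ultimately have "(\<Sum>j\<le>n. q j t * (fact j * fps_nth (fps_X ^ ?i * ?G ?i) j)) = 0"
      by (simp only: lin_op_fps_def mult_zero_right add_0)
    also have "(\<Sum>j\<le>n. q j t * (fact j * fps_nth (fps_X ^ ?i * ?G ?i) j)) =
        (\<Sum>j\<in>{?i}. q j t * (fact j * fps_nth (fps_X ^ ?i * ?G ?i) j))"
    proof (rule sum.mono_neutral_right, goal_cases)
      case 3
      show ?case
      proof
        fix j assume "j \<in> {..n} - {?i}"
        then consider "j < ?i" | "j > ?i" "j \<le> n" by force
        then show "q j t * (fact j * fps_nth (fps_X ^ ?i * ?G ?i) j) = 0"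
        proof cases
          case 2
          then have "n - j < k" "n - (n - j) = j" using less.prems by auto
          then have "q j t = 0" using less.IH[of "n - j"] by auto
          then show ?thesis by simp
        qed (simp add: fps_X_power_mult_nth)
      qed
    qed auto
    finally have "q ?i t * fps_nth (?G ?i) 0 = 0" by (simp add: fps_X_power_mult_nth)
    moreover have "fps_nth (?G ?i) 0 \<noteq> 0"
      using m0[of t] z0[of t] that(1) e(2) by (auto simp: fps_nth_power_0 fps_expansion_nth_simps)
    ultimately show ?case by (metis mult_eq_0_iff)
  qed
  then have "q i t = 0" if "t \<in> ?U" "i \<le> n" for t i
    using that by (metis diff_diff_cancel diff_le_self)
  with e(1) show thesis using that by blast
qed

section \<open>Transformation into u^(n+1) = 0 and vanishing of the classical invariants\<close>

lemma holomorphic_divide_root: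
  assumes "f holomorphic_on S" "open S" "a \<in> S"
  obtains g where "g holomorphic_on S" "\<And>s. s \<in> S \<Longrightarrow> f s = f a + (s - a) * g s"
proof
  show "(\<lambda>z. if z = a then deriv f a else (f z - f a) / (z - a)) holomorphic_on S"
    using pole_lemma_open[OF assms(1,2)] .
qed auto

text \<open>Repeated division by s - a. In contrast to a local expansion, the last factor g is
  holomorphic on all of S.\<close>

lemma holomorphic_taylor_remainder:
  assumes "f holomorphic_on S" "open S" "a \<in> S"
  shows "\<exists>c g. g holomorphic_on S \<and> (\<forall>s\<in>S. f s = (\<Sum>i<k. c i * (s - a) ^ i) + (s - a) ^ k * g s)"
proof (induction k)
  case 0
  then show ?case using assms by (intro exI[of _ "\<lambda>_. 0"] exI[of _ f]) auto
next
  case (Suc k)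
  then obtain c g where cg: "g holomorphic_on S"
      "\<And>s. s \<in> S \<Longrightarrow> f s = (\<Sum>i<k. c i * (s - a) ^ i) + (s - a) ^ k * g s" by blast
  obtain h where h: "h holomorphic_on S" "\<And>s. s \<in> S \<Longrightarrow> g s = g a + (s - a) * h s"
    using holomorphic_divide_root[OF cg(1) assms(2,3)] by blast
  have "f s = (\<Sum>i<Suc k. (if i = k then g a else c i) * (s - a) ^ i) + (s - a) ^ Suc k * h s" if "s \<in> S" for s
    using cg(2)[OF that] h(2)[OF that] by (simp add: algebra_simps)
  then show ?case
    by (intro exI[of _ "\<lambda>i. if i = k then g a else c i"] exI[of _ h]) (use h(1) in blast)
qed

text \<open>The Taylor polynomial of u at \<open>lam t\<close> is turned into a combination of the
  given solutions. The remainder vanishes to order n + 1 at t, so only the top derivative sees it;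
  this is where (lam')^(n+1) comes from.\<close>

lemma lin_op_transform:
  assumes u: "open T" "lam t \<in> T" "g holomorphic_on T"
      "\<And>s. s \<in> T \<Longrightarrow> u s = (\<Sum>i\<le>n. c i * (s - lam t) ^ i) + (s - lam t) ^ (n + 1) * g s"
    and an: "analytic_at lam t" "analytic_at mu t" "mu t \<noteq> 0"
    and sol: "\<And>i. i \<le> n \<Longrightarrow> lin_op n p (\<lambda>s. lam s ^ i / mu s) t = 0"
  shows "lin_op n p (\<lambda>s. u (lam s) / mu s) t = fact (n + 1) * g (lam t) * deriv lam t ^ (n + 1) / mu t"
proof -
  define m where "m = (\<lambda>s. 1 / mu s)"
  have m: "analytic_at m t" unfolding m_def using an by (auto intro!: analytic_intros)
  have gl: "analytic_at (\<lambda>s. g (lam s)) t"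
  proof -
    have "g analytic_on T" using u by (simp add: analytic_on_open)
    then show ?thesis
      using analytic_on_compose_gen[OF an(1), of g T] u(2) by (simp add: o_def)
  qed
  have "lam \<midarrow>t\<rightarrow> lam t" using an(1) analytic_at_imp_isCont isContD by blast
  then have "eventually (\<lambda>s. lam s \<in> T) (nhds t)"
    using u(1,2) topological_tendstoD eventually_nhds_conv_at by blast
  then have "eventually (\<lambda>s. u (lam s) / mu s = (\<Sum>i\<le>n. c i * (m s * (lam s - lam t) ^ i))
      + (m s * g (lam s)) * (lam s - lam t) ^ (n + 1)) (nhds t)"
    by eventually_elim (simp add: u(4) m_def sum_divide_distrib add_divide_distrib mult_ac)
  then have "fps_expansion (\<lambda>s. u (lam s) / mu s) t = fps_expansion (\<lambda>s. (\<Sum>i\<le>n. c i * (m s * (lam s - lam t) ^ i))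
      + (m s * g (lam s)) * (lam s - lam t) ^ (n + 1)) t"
    by (rule fps_expansion_cong)
  also have "\<dots> = (\<Sum>i\<le>n. fps_const (c i) * fps_expansion (\<lambda>s. m s * (lam s - lam t) ^ i) t)
      + fps_expansion (\<lambda>s. (m s * g (lam s)) * (lam s - lam t) ^ (n + 1)) t"
  proof -
    have A: "analytic_at (\<lambda>s. m s * (lam s - lam t) ^ i) t" "analytic_at (\<lambda>s. c i * (m s * (lam s - lam t) ^ i)) t" for i
      by (intro analytic_intros an m)+
    have "analytic_at (\<lambda>s. (m s * g (lam s)) * (lam s - lam t) ^ (n + 1)) t"
      "analytic_at (\<lambda>s. \<Sum>i\<le>n. c i * (m s * (lam s - lam t) ^ i)) t"
      by (intro analytic_intros an m gl)+
    then show ?thesis by (simp add: fps_expansion_add fps_expansion_sum A fps_expansion_cmult)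
  qed
  finally have "lin_op n p (\<lambda>s. u (lam s) / mu s) t =
      (\<Sum>i\<le>n. c i * lin_op n p (\<lambda>s. m s * (lam s - lam t) ^ i) t)
      + lin_op n p (\<lambda>s. (m s * g (lam s)) * (lam s - lam t) ^ (n + 1)) t"
    by (simp add: lin_op_fps lin_op_fps_add lin_op_fps_sum lin_op_fps_cmult)
  also have "lin_op n p (\<lambda>s. m s * (lam s - lam t) ^ i) t = 0" if "i \<le> n" for i
    by (rule lin_op_translate) (use m an sol that in \<open>auto simp: m_def\<close>)
  then have "(\<Sum>i\<le>n. c i * lin_op n p (\<lambda>s. m s * (lam s - lam t) ^ i) t) = 0"
    by simp
  also have "lin_op n p (\<lambda>s. (m s * g (lam s)) * (lam s - lam t) ^ (n + 1)) t
      = fact (n + 1) * g (lam t) * deriv lam t ^ (n + 1) / mu t"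
  proof -
    have mg: "analytic_at (\<lambda>s. m s * g (lam s)) t" by (intro analytic_intros m gl)
    define G where "G = fps_expansion (\<lambda>s. m s * g (lam s)) t * fps_shift 1 (fps_expansion lam t) ^ (n + 1)"
    have "lin_op n p (\<lambda>s. (m s * g (lam s)) * (lam s - lam t) ^ (n + 1)) t = lin_op_fps n (\<lambda>i. p i t) (fps_X ^ (n + 1) * G)"
      unfolding lin_op_fps G_def by (subst fps_expansion_mult_power_vanish[OF mg an(1)]) simp
    also have "(\<Sum>i\<le>n. p i t * (fact i * fps_nth (fps_X ^ (n + 1) * G) i)) = 0"
      by (intro sum.neutral) (simp add: fps_X_power_mult_nth del: power_Suc)
    then have "lin_op_fps n (\<lambda>i. p i t) (fps_X ^ (n + 1) * G) = fact (n + 1) * fps_nth G 0"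
      unfolding lin_op_fps_def by (simp add: fps_X_power_mult_nth del: power_Suc fact_Suc)
    also have "fps_nth G 0 = g (lam t) / mu t * deriv lam t ^ (n + 1)"
      using fps_nth_power_0[of "fps_shift 1 (fps_expansion lam t)" "n + 1"]
      by (simp add: G_def fps_expansion_nth_simps m_def)
    finally show ?thesis by simp
  qed
  finally show ?thesis by simp
qed

lemma lin_op_0_power: "i \<le> n \<Longrightarrow> lin_op n (\<lambda>_ _. 0) (\<lambda>s. s ^ i) t = 0"
  using higher_deriv_power[of "n + 1" 0 i t] by (simp add: lin_op_def pochhammer_0_left del: funpow.simps)

text \<open>\<open>lin_op_transform\<close> is applied twice, to the given transformation and to the
  identity with zero coefficients. Both values are nonzero multiples of g at
  \<open>lam t\<close>.\<close>

lemma lin_op_transform_0_iff: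
  assumes "open T" "lam t \<in> T" "u holomorphic_on T"
    and an: "analytic_at lam t" "analytic_at mu t" "mu t \<noteq> 0" "deriv lam t \<noteq> 0"
    and sol: "\<And>i. i \<le> n \<Longrightarrow> lin_op n p (\<lambda>s. lam s ^ i / mu s) t = 0"
  shows "lin_op n p (\<lambda>s. u (lam s) / mu s) t = 0 \<longleftrightarrow> lin_op n (\<lambda>_ _. 0) u (lam t) = 0"
proof -
  obtain c g where cg: "g holomorphic_on T"
    "\<And>s. s \<in> T \<Longrightarrow> u s = (\<Sum>i\<le>n. c i * (s - lam t) ^ i) + (s - lam t) ^ (n + 1) * g s"
    using holomorphic_taylor_remainder[OF assms(3,1,2), of "n + 1"] by (auto simp: lessThan_Suc_atMost)
  have "lin_op n (\<lambda>_ _. 0) (\<lambda>s. u ((\<lambda>s. s) s) / (\<lambda>_. 1) s) (lam t)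
      = fact (n + 1) * g (lam t) * deriv (\<lambda>s. s) (lam t) ^ (n + 1) / (\<lambda>_. 1) (lam t)"
    by (rule lin_op_transform[where T = T and c = c])
      (use assms(1,2) cg lin_op_0_power in \<open>auto intro: analytic_intros\<close>)
  moreover have "lin_op n p (\<lambda>s. u (lam s) / mu s) t = fact (n + 1) * g (lam t) * deriv lam t ^ (n + 1) / mu t"
    by (rule lin_op_transform[where T = T and c = c]) (use assms cg in auto)
  ultimately show ?thesis using an by (simp del: fact_Suc)
qed

text \<open>The pair (\<open>lam\<close>, \<open>mu\<close>) itself leads to the Laguerre-Forsyth
  form with all coefficients zero, which gives the value 0. For uniqueness, any other form has the
  solutions m z^i, where z and m describe the passage between the two transformations, and
  \<open>lf_symmetric_power_trivial\<close> makes its coefficients vanish near the point.\<close>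

lemma wilczynski_eq_0:
  assumes I: "open I" "x \<in> I" and lam: "lam holomorphic_on I" "inj_on lam I"
    and mu: "mu holomorphic_on I" "\<And>t. t \<in> I \<Longrightarrow> mu t \<noteq> 0"
    and n: "1 \<le> n"
    and sol: "\<And>i t. i \<le> n \<Longrightarrow> t \<in> I \<Longrightarrow> lin_op n p (\<lambda>t. lam t ^ i / mu t) t = 0"
    and k: "3 \<le> k" "k \<le> n + 1"
  shows "wilczynski n k p x = 0"
  unfolding wilczynski_def
proof (rule the_equality)
  have reg: "deriv lam t \<noteq> 0" if "t \<in> I" for t
    using holomorphic_injective_imp_regular[OF lam(1) I(1) lam(2) that] .
  have an: "analytic_at lam t" "analytic_at mu t" if "t \<in> I" for t
    using I lam mu that by (auto simp: holomorphic_on_imp_analytic_at)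
  have "laguerre_forsyth n p x I lam mu (\<lambda>_ _. 0)"
    unfolding laguerre_forsyth_def
  proof (intro conjI allI impI ballI)
    fix J u assume J: "open J \<and> J \<subseteq> I \<and> u holomorphic_on lam ` J"
    then have "open (lam ` J)"
      using lam open_mapping_thm3 holomorphic_on_subset inj_on_subset by metis
    then have "lin_op n p (\<lambda>s. u (lam s) / mu s) t = 0 \<longleftrightarrow> lin_op n (\<lambda>_ _. 0) u (lam t) = 0" if "t \<in> J" for t
      using J that an reg mu sol by (intro lin_op_transform_0_iff[of "lam ` J"]) auto
    then show "solves_linear n p J (\<lambda>t. u (lam t) / mu t) \<longleftrightarrow> solves_linear n (\<lambda>_ _. 0) (lam ` J) u"
      by (auto simp: solves_linear_iff)
  qed (use I lam mu in auto)
  moreover have "theta_LF n k (\<lambda>_ _. 0) (lam x) = 0"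
    by (simp add: theta_LF_def)
  ultimately show "\<exists>I lam mu q. laguerre_forsyth n p x I lam mu q \<and> 0 = deriv lam x ^ k * theta_LF n k q (lam x)"
    by (metis mult_zero_right)
next
  fix w assume "\<exists>I lam mu q. laguerre_forsyth n p x I lam mu q \<and> w = deriv lam x ^ k * theta_LF n k q (lam x)"
  then obtain I' lam' mu' q where LF: "laguerre_forsyth n p x I' lam' mu' q"
    and w: "w = deriv lam' x ^ k * theta_LF n k q (lam' x)" by blast
  note L = LF[unfolded laguerre_forsyth_def]
  define J where "J = I \<inter> I'"
  define S where "S = lam' ` J"
  have J: "open J" "x \<in> J" "J \<subseteq> I" "J \<subseteq> I'" using I L by (auto simp: J_def)
  have lam'J: "lam' holomorphic_on J" "inj_on lam' J" "lam holomorphic_on J" "inj_on lam J"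
      "mu holomorphic_on J" "mu' holomorphic_on J"
    using L J lam mu holomorphic_on_subset inj_on_subset by metis+
  obtain g where g: "g holomorphic_on S" "\<And>z. z \<in> J \<Longrightarrow> g (lam' z) = z"
    using holomorphic_has_inverse[OF lam'J(1) J(1) lam'J(2)] unfolding S_def by metis
  have gS: "g ` S \<subseteq> J" using g(2) by (auto simp: S_def)
  have S: "open S" unfolding S_def using lam'J J open_mapping_thm3 by blast
  \<comment> \<open>z = lam o lam'^(-1), and m is the quotient of the two multipliers, so that m z^i
    corresponds to \<open>lam ^ i / mu\<close> under the primed transformation.\<close>
  define m z where "m = (\<lambda>s. mu' (g s) / mu (g s))" and "z = (\<lambda>s. lam (g s))"
  have hol: "m holomorphic_on S" "z holomorphic_on S"
    unfolding m_def z_def using lam'J gS g(1) mu(2) J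
    by (auto intro!: holomorphic_intros holomorphic_on_compose_gen[of g S _ J, unfolded o_def])
  have "inj_on z S"
    using lam'J g(2) by (auto simp: S_def z_def inj_on_def)
  then have regz: "deriv z s \<noteq> 0" if "s \<in> S" for s
    using holomorphic_injective_imp_regular[OF hol(2) S] that by blast
  have sq: "lin_op n q (\<lambda>s. m s * z s ^ i) s = 0" if "s \<in> S" "i \<le> n" for s i
  proof -
    have "solves_linear n p J (\<lambda>t. (\<lambda>s. m s * z s ^ i) (lam' t) / mu' t)"
      unfolding solves_linear_iff
    proof
      fix t assume t: "t \<in> J"
      have "eventually (\<lambda>t. (\<lambda>s. m s * z s ^ i) (lam' t) / mu' t = lam t ^ i / mu t) (nhds t)"
        using eventually_nhds_in_open[OF J(1) t]
        by eventually_elim (use g L J in \<open>auto simp: m_def z_def\<close>)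
      then show "lin_op n p (\<lambda>t. (\<lambda>s. m s * z s ^ i) (lam' t) / mu' t) t = 0"
        using lin_op_cong_ev[of "\<lambda>t. (\<lambda>s. m s * z s ^ i) (lam' t) / mu' t" "\<lambda>t. lam t ^ i / mu t" t n p]
          sol[OF that(2), of t] J(3) t by auto
    qed
    moreover have "(\<lambda>s. m s * z s ^ i) holomorphic_on lam' ` J"
      using hol unfolding S_def by (intro holomorphic_intros)
    moreover have "solves_linear n p J (\<lambda>t. u (lam' t) / mu' t) \<longleftrightarrow> solves_linear n q (lam' ` J) u"
      if "u holomorphic_on lam' ` J" for u using L J that by blast
    ultimately have "solves_linear n q S (\<lambda>s. m s * z s ^ i)"
      unfolding S_def by blast
    then show ?thesis
      using that by (auto simp: solves_linear_iff)
  qed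
  obtain e where e: "e > 0" "\<And>t i. t \<in> ball (lam' x) e \<Longrightarrow> i \<le> n \<Longrightarrow> q i t = 0"
  proof (rule lf_symmetric_power_trivial[of S m z n q "lam' x"])
    show "m t \<noteq> 0" if "t \<in> S" for t
    proof -
      have "g t \<in> I \<inter> I'" using that gS J by blast
      then show ?thesis using L mu(2) by (auto simp: m_def)
    qed
    show "q n t = 0 \<and> q (n - 1) t = 0" if "t \<in> S" for t
      using that L J by (auto simp: S_def)
    show "lam' x \<in> S" using J by (simp add: S_def)
  qed (use S hol n regz sq in auto)
  have "(deriv ^^ j) (q i) (lam' x) = 0" if "i \<le> n" for i j
  proof -
    have "eventually (\<lambda>s. s \<in> ball (lam' x) e) (nhds (lam' x))"
      using e(1) by (intro eventually_nhds_in_open) auto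
    then have "eventually (\<lambda>s. q i s = 0) (nhds (lam' x))"
      by (rule eventually_mono) (use e(2) that in blast)
    then have "(deriv ^^ j) (q i) (lam' x) = (deriv ^^ j) (\<lambda>_. 0) (lam' x)"
      by (intro higher_deriv_cong_ev) auto
    then show ?thesis by simp
  qed
  moreover have "n + j - k \<le> n" if "j \<in> {1..k - 2}" for j using that by auto
  ultimately show "w = 0" by (simp add: w theta_LF_def)
qed

section \<open>Holomorphic functions of two variables\<close>

text \<open>Joint continuity with holomorphy in each variable is equivalent to holomorphy in two
  variables and can be handled by one-variable theory.\<close>

definition holo2 :: "complex set \<Rightarrow> complex set \<Rightarrow> (complex \<Rightarrow> complex \<Rightarrow> complex) \<Rightarrow> bool" where
  "holo2 A B \<Phi> \<longleftrightarrow> continuous_on (A \<times> B) (\<lambda>(t, s). \<Phi> t s) \<and>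
     (\<forall>s\<in>B. (\<lambda>t. \<Phi> t s) holomorphic_on A) \<and> (\<forall>t\<in>A. \<Phi> t holomorphic_on B)"

definition d1 :: "(complex \<Rightarrow> complex \<Rightarrow> complex) \<Rightarrow> complex \<Rightarrow> complex \<Rightarrow> complex" where
  "d1 \<Phi> t s = deriv (\<lambda>t. \<Phi> t s) t"

definition d2 :: "(complex \<Rightarrow> complex \<Rightarrow> complex) \<Rightarrow> complex \<Rightarrow> complex \<Rightarrow> complex" where
  "d2 \<Phi> t s = deriv (\<Phi> t) s"

lemma holo2_swap: "holo2 A B \<Phi> \<Longrightarrow> holo2 B A (\<lambda>s t. \<Phi> t s)"
  unfolding holo2_def
  using continuous_on_compose2[of "A \<times> B" "\<lambda>(t, s). \<Phi> t s" "B \<times> A" prod.swap]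
  by (auto simp: case_prod_unfold continuous_on_swap image_subset_iff)

lemma holo2_subset: "holo2 A B \<Phi> \<Longrightarrow> A' \<subseteq> A \<Longrightarrow> B' \<subseteq> B \<Longrightarrow> holo2 A' B' \<Phi>"
  unfolding holo2_def by (meson Sigma_mono continuous_on_subset holomorphic_on_subset subsetD)

lemma holo2_divide:
  assumes "holo2 A B f" "holo2 A B g" "\<And>t s. t \<in> A \<Longrightarrow> s \<in> B \<Longrightarrow> g t s \<noteq> 0"
  shows "holo2 A B (\<lambda>t s. f t s / g t s)"
  using assms unfolding holo2_def
  by (auto intro!: holomorphic_intros continuous_intros simp: case_prod_unfold)

text \<open>Taylor's formula with the second derivative estimated by Cauchy's inequality. The bound
  depends on f only through M and r, which gives uniformity when f varies with a parameter.\<close>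

lemma difference_quotient_bound:
  fixes f :: "complex \<Rightarrow> complex"
  assumes "f holomorphic_on ball t R" "r < R" "0 < r" "\<And>w. w \<in> cball t r \<Longrightarrow> cmod (f w) \<le> M"
    and e: "e \<noteq> 0" "cmod e < r / 2"
  shows "cmod ((f (t + e) - f t) / e - deriv f t) \<le> (8 * M / r\<^sup>2) * cmod e"
proof -
  let ?S = "ball t (r / 2)"
  \<comment> \<open>Cauchy's inequality on a circle of radius r / 2 gives 2! M / (r / 2)^2 = 8 M /
    r^2.\<close>
  have bd: "cmod ((deriv ^^ 2) f w) \<le> 8 * M / r\<^sup>2" if "w \<in> ?S" for w
  proof -
    have sub: "cball w (r / 2) \<subseteq> cball t r"
    proof
      fix x assume "x \<in> cball w (r / 2)"
      then show "x \<in> cball t r" using that dist_triangle[of t x w] by auto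
    qed
    then have "cball w (r / 2) \<subseteq> ball t R" using \<open>r < R\<close> by force
    then have "f holomorphic_on cball w (r / 2)" using assms(1) holomorphic_on_subset by blast
    then have "cmod ((deriv ^^ 2) f w) \<le> fact 2 * M / (r / 2) ^ 2"
    proof (intro Cauchy_inequality)
      show "cmod (f x) \<le> M" if "cmod (w - x) = r / 2" for x
        using that sub assms(4) by (auto simp: dist_norm)
    qed (use \<open>0 < r\<close> in \<open>auto intro: holomorphic_on_subset holomorphic_on_imp_continuous_on\<close>)
    then show ?thesis by (simp add: power2_eq_square)
  qed
  have S: "?S \<subseteq> ball t R" using assms(2,3) by auto
  have "cmod ((deriv ^^ 0) f (t + e) - (\<Sum>i\<le>1. (deriv ^^ i) f t * ((t + e) - t) ^ i / fact i))
      \<le> (8 * M / r\<^sup>2) * cmod ((t + e) - t) ^ Suc 1 / fact 1"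
  proof (rule complex_Taylor[of ?S 1 "\<lambda>i. (deriv ^^ i) f"])
    show "((deriv ^^ i) f has_field_derivative (deriv ^^ Suc i) f x) (at x within ?S)" if "x \<in> ?S" for i x
      using has_field_derivative_higher_deriv[OF assms(1)] that S by (meson has_field_derivative_at_within open_ball subsetD)
    show "cmod ((deriv ^^ Suc 1) f x) \<le> 8 * M / r\<^sup>2" if "x \<in> ?S" for x
      using bd[OF that] by (simp add: numeral_2_eq_2)
  qed (use e \<open>0 < r\<close> in \<open>auto simp: dist_norm\<close>)
  then have "cmod (f (t + e) - f t - deriv f t * e) \<le> (8 * M / r\<^sup>2) * cmod e * cmod e"
    by (simp add: power2_eq_square diff_diff_eq)
  moreover have "(f (t + e) - f t) / e - deriv f t = (f (t + e) - f t - deriv f t * e) / e"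
    using e by (simp add: field_simps)
  ultimately show ?thesis
    using e by (simp add: norm_divide divide_le_eq)
qed

text \<open>Uniform convergence of difference quotients along one fixed null sequence: the limit
  \<open>d1\<close> then inherits joint continuity and holomorphy in s, and differentiation in s may
  be exchanged with it.\<close>

lemma holo2_difference_quotients:
  assumes H: "holo2 A B \<Phi>" and AB: "open A" "open B" "t0 \<in> A" "s0 \<in> B"
  obtains r \<epsilon> where "r > 0" "cball t0 (2 * r) \<subseteq> A" "cball s0 r \<subseteq> B" "\<And>k. \<epsilon> k \<noteq> 0" "\<epsilon> \<longlonglongrightarrow> 0"
    "\<And>k. cmod (\<epsilon> k) < r"
    "uniform_limit (ball t0 r \<times> cball s0 r)
       (\<lambda>k (t, s). (\<Phi> (t + \<epsilon> k) s - \<Phi> t s) / \<epsilon> k) (\<lambda>(t, s). d1 \<Phi> t s) sequentially"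
proof -
  obtain r1 where r1: "r1 > 0" "cball t0 r1 \<subseteq> A" using AB open_contains_cball by blast
  obtain r2 where r2: "r2 > 0" "cball s0 r2 \<subseteq> B" using AB open_contains_cball by blast
  define r where "r = min (r1 / 2) r2"
  have r: "r > 0" "cball t0 (2 * r) \<subseteq> A" "cball s0 r \<subseteq> B"
    using r1 r2 by (auto simp: r_def)
  \<comment> \<open>Increments of size at most r / 4 keep t + \<epsilon> k inside the ball of radius
    2 r around t0, on which \<Phi> will be bounded by compactness.\<close>
  define \<epsilon> where "\<epsilon> = (\<lambda>k::nat. complex_of_real (r / 4) * inverse (of_nat (Suc k)))"
  have e0: "\<epsilon> \<longlonglongrightarrow> 0"
    unfolding \<epsilon>_def by (intro tendsto_mult_right_zero LIMSEQ_Suc lim_inverse_n)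
  have en: "\<epsilon> k \<noteq> 0" "cmod (\<epsilon> k) < r / 2" for k
  proof -
    show "\<epsilon> k \<noteq> 0" using r by (simp add: \<epsilon>_def del: of_nat_Suc)
    have "inverse (real (Suc k)) \<le> 1" by (simp add: field_simps)
    then have "(r / 4) * inverse (real (Suc k)) \<le> r / 4" using r(1) by (simp add: mult_left_le)
    also have "\<dots> < r / 2" using r(1) by simp
    finally show "cmod (\<epsilon> k) < r / 2"
      using r(1) by (simp add: \<epsilon>_def norm_mult norm_inverse del: of_nat_Suc)
  qed
  have "compact ((\<lambda>(t, s). \<Phi> t s) ` (cball t0 (2 * r) \<times> cball s0 r))"
    using H r unfolding holo2_def
    by (intro compact_continuous_image compact_Times compact_cball) (auto intro: continuous_on_subset)
  then obtain M where "\<forall>x\<in>(\<lambda>(t, s). \<Phi> t s) ` (cball t0 (2 * r) \<times> cball s0 r). cmod x \<le> M"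
    using compact_imp_bounded bounded_iff by metis
  then have M: "cmod (\<Phi> t s) \<le> M" if "t \<in> cball t0 (2 * r)" "s \<in> cball s0 r" for t s
    using that by blast
  have est: "cmod ((\<Phi> (t + \<epsilon> k) s - \<Phi> t s) / \<epsilon> k - d1 \<Phi> t s) \<le> (8 * M / (r / 2)\<^sup>2) * cmod (\<epsilon> k)"
    if "t \<in> ball t0 r" "s \<in> cball s0 r" "cmod (\<epsilon> k) < r / 4" for t s k
    unfolding d1_def
  proof (rule difference_quotient_bound[where R = r])
    have sub: "ball t r \<subseteq> cball t0 (2 * r)"
    proof
      fix x assume "x \<in> ball t r"
      then show "x \<in> cball t0 (2 * r)" using that(1) dist_triangle[of t0 x t] by auto
    qed
    have "(\<lambda>t. \<Phi> t s) holomorphic_on A" using H that r unfolding holo2_def by blast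
    then show "(\<lambda>t. \<Phi> t s) holomorphic_on ball t r"
      using sub r by (meson holomorphic_on_subset subset_trans)
    show "cmod (\<Phi> w s) \<le> M" if "w \<in> cball t (r / 2)" for w
      using that sub r(1) \<open>s \<in> cball s0 r\<close> by (intro M) (auto simp: subset_iff)
  qed (use r en that in auto)
  have "uniform_limit (ball t0 r \<times> cball s0 r)
       (\<lambda>k (t, s). (\<Phi> (t + \<epsilon> k) s - \<Phi> t s) / \<epsilon> k) (\<lambda>(t, s). d1 \<Phi> t s) sequentially"
  proof (rule uniform_limitI)
    fix e :: real assume "e > 0"
    have "(\<lambda>k. (8 * M / (r / 2)\<^sup>2) * cmod (\<epsilon> k)) \<longlonglongrightarrow> 0"
      using tendsto_mult_right_zero[OF tendsto_norm_zero[OF e0]] by blast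
    then have "\<forall>\<^sub>F k in sequentially. (8 * M / (r / 2)\<^sup>2) * cmod (\<epsilon> k) < e"
      using \<open>e > 0\<close> by (rule order_tendstoD(2))
    moreover have "\<forall>\<^sub>F k in sequentially. cmod (\<epsilon> k) < r / 4"
      using tendsto_norm_zero[OF e0] r(1) by (intro order_tendstoD(2)) auto
    ultimately show "\<forall>\<^sub>F k in sequentially. \<forall>x\<in>ball t0 r \<times> cball s0 r.
        dist (case x of (t, s) \<Rightarrow> (\<Phi> (t + \<epsilon> k) s - \<Phi> t s) / \<epsilon> k) (case x of (t, s) \<Rightarrow> d1 \<Phi> t s) < e"
      by eventually_elim (use est in \<open>force simp: dist_norm\<close>)
  qed
  moreover have "cmod (\<epsilon> k) < r" for k using en(2)[of k] r(1) by simp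
  ultimately show thesis by (intro that[of r \<epsilon>] r en(1) e0)
qed

lemma holo2_d1:
  assumes H: "holo2 A B \<Phi>" and AB: "open A" "open B"
  shows "holo2 A B (d1 \<Phi>)"
proof -
  have 1: "(\<lambda>t. d1 \<Phi> t s) holomorphic_on A" if "s \<in> B" for s
    unfolding d1_def using H AB(1) that by (intro holomorphic_deriv) (auto simp: holo2_def)
  have loc: "isCont (\<lambda>(t, s). d1 \<Phi> t s) (t0, s0) \<and> d1 \<Phi> t0 field_differentiable at s0"
    if p: "t0 \<in> A" "s0 \<in> B" for t0 s0
  proof -
    obtain r \<epsilon> where r: "r > 0" "cball t0 (2 * r) \<subseteq> A" "cball s0 r \<subseteq> B" "\<And>k. \<epsilon> k \<noteq> 0" "\<epsilon> \<longlonglongrightarrow> 0"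
      "\<And>k. cmod (\<epsilon> k) < r"
      and ul: "uniform_limit (ball t0 r \<times> cball s0 r)
       (\<lambda>k (t, s). (\<Phi> (t + \<epsilon> k) s - \<Phi> t s) / \<epsilon> k) (\<lambda>(t, s). d1 \<Phi> t s) sequentially"
      by (rule holo2_difference_quotients[OF H AB p]) (rule that; assumption)
    have sub: "t + \<epsilon> k \<in> A" "t \<in> A" if "t \<in> ball t0 r" for t k
    proof -
      have "dist t0 (t + \<epsilon> k) \<le> dist t0 t + dist t (t + \<epsilon> k)" by (rule dist_triangle)
      then show "t + \<epsilon> k \<in> A" "t \<in> A" using that r(1,2) r(6)[of k] by (auto simp: dist_norm subset_iff)
    qed
    have cont: "continuous_on (A \<times> B) (\<lambda>(t, s). \<Phi> t s)" using H by (simp add: holo2_def)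
    have "continuous_on (ball t0 r \<times> cball s0 r) (\<lambda>(t, s). (\<Phi> (t + \<epsilon> k) s - \<Phi> t s) / \<epsilon> k)" for k
    proof -
      have "continuous_on (ball t0 r \<times> cball s0 r) (\<lambda>p. case (fst p + \<epsilon> k, snd p) of (t, s) \<Rightarrow> \<Phi> t s)"
        by (rule continuous_on_compose2[OF cont]) (use sub r in \<open>auto intro!: continuous_intros\<close>)
      moreover have "continuous_on (ball t0 r \<times> cball s0 r) (\<lambda>p. case p of (t, s) \<Rightarrow> \<Phi> t s)"
        by (rule continuous_on_subset[OF cont]) (use sub r in auto)
      ultimately show ?thesis using r(4) by (auto simp: case_prod_unfold intro!: continuous_intros)
    qed
    then have "continuous_on (ball t0 r \<times> cball s0 r) (\<lambda>(t, s). d1 \<Phi> t s)"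
      by (intro uniform_limit_theorem[OF _ ul]) auto
    then have "continuous_on (ball t0 r \<times> ball s0 r) (\<lambda>(t, s). d1 \<Phi> t s)"
      by (rule continuous_on_subset) auto
    then have "isCont (\<lambda>(t, s). d1 \<Phi> t s) (t0, s0)"
      using r(1) by (simp add: continuous_on_eq_continuous_at open_Times)
    moreover have "d1 \<Phi> t0 holomorphic_on ball s0 r"
    proof (rule holomorphic_uniform_sequence[where f = "\<lambda>k s. (\<Phi> (t0 + \<epsilon> k) s - \<Phi> t0 s) / \<epsilon> k"])
      fix k
      show "(\<lambda>s. (\<Phi> (t0 + \<epsilon> k) s - \<Phi> t0 s) / \<epsilon> k) holomorphic_on ball s0 r"
      proof -
        have "\<Phi> t holomorphic_on ball s0 r" if "t \<in> A" for t
          using H that r(3) unfolding holo2_def by (meson ball_subset_cball holomorphic_on_subset subset_trans)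
        then show ?thesis using sub[of t0] r by (auto intro!: holomorphic_intros)
      qed
    next
      fix x assume "x \<in> ball s0 r"
      then obtain d where d: "d > 0" "cball x d \<subseteq> ball s0 r" using open_contains_cball open_ball by blast
      have "uniform_limit (cball x d) (\<lambda>k s. (\<Phi> (t0 + \<epsilon> k) s - \<Phi> t0 s) / \<epsilon> k) (d1 \<Phi> t0) sequentially"
        using ul unfolding uniform_limit_iff
      proof (elim all_forward imp_forward, goal_cases)
        case (2 e)
        from 2(1) show ?case
          by eventually_elim (use d r(1) in \<open>force\<close>)
      qed auto
      then show "\<exists>d>0. cball x d \<subseteq> ball s0 r \<and>
          uniform_limit (cball x d) (\<lambda>k s. (\<Phi> (t0 + \<epsilon> k) s - \<Phi> t0 s) / \<epsilon> k) (d1 \<Phi> t0) sequentially"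
        using d by blast
    qed simp
    ultimately show ?thesis
      using r(1) by (simp add: holomorphic_on_imp_differentiable_at)
  qed
  have "continuous_on (A \<times> B) (\<lambda>(t, s). d1 \<Phi> t s)"
    using loc by (intro continuous_at_imp_continuous_on) auto
  moreover have "d1 \<Phi> t holomorphic_on B" if "t \<in> A" for t
    unfolding holomorphic_on_def using loc that by (blast intro: field_differentiable_at_within)
  ultimately show ?thesis using 1 by (simp add: holo2_def)
qed

lemma holo2_d2:
  assumes H: "holo2 A B \<Phi>" and AB: "open A" "open B"
  shows "holo2 A B (d2 \<Phi>)"
  using holo2_swap[OF holo2_d1[OF holo2_swap[OF H] AB(2,1)]]
  by (simp add: d1_def d2_def[abs_def])

text \<open>The s-derivative of a difference quotient in t is the difference quotient of
  \<open>d2\<close>, and derivatives of a uniformly convergent sequence of holomorphic functions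
  converge to the derivative of the limit.\<close>

lemma d1_d2_commute:
  assumes H: "holo2 A B \<Phi>" and AB: "open A" "open B" and p: "t0 \<in> A" "s0 \<in> B"
  shows "d1 (d2 \<Phi>) t0 s0 = d2 (d1 \<Phi>) t0 s0"
proof -
  obtain r \<epsilon> where r: "r > 0" "cball t0 (2 * r) \<subseteq> A" "cball s0 r \<subseteq> B" "\<And>k. \<epsilon> k \<noteq> 0" "\<epsilon> \<longlonglongrightarrow> 0"
      "\<And>k. cmod (\<epsilon> k) < r"
      and ul: "uniform_limit (ball t0 r \<times> cball s0 r)
       (\<lambda>k (t, s). (\<Phi> (t + \<epsilon> k) s - \<Phi> t s) / \<epsilon> k) (\<lambda>(t, s). d1 \<Phi> t s) sequentially"
    by (rule holo2_difference_quotients[OF H AB p]) (rule that; assumption)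
  define Q where "Q = (\<lambda>k s. (\<Phi> (t0 + \<epsilon> k) s - \<Phi> t0 s) / \<epsilon> k)"
  have tA: "t0 + \<epsilon> k \<in> A" for k using r(2) r(6)[of k] r(1) by (auto simp: subset_iff dist_norm)
  have hol: "\<Phi> t holomorphic_on ball s0 r" if "t \<in> A" for t
    using H that r(3) unfolding holo2_def by (meson ball_subset_cball holomorphic_on_subset subset_trans)
  have "uniform_limit (ball s0 r) Q (d1 \<Phi> t0) sequentially"
    using ul unfolding uniform_limit_iff
  proof (elim all_forward imp_forward, goal_cases)
    case (2 e)
    from 2(1) show ?case
      by eventually_elim (use r(1) in \<open>force simp: Q_def\<close>)
  qed auto
  then have "(\<lambda>k. (deriv ^^ 1) (Q k) s0) \<longlonglongrightarrow> (deriv ^^ 1) (d1 \<Phi> t0) s0"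
    by (rule higher_deriv_complex_uniform_limit)
       (use hol tA p r in \<open>auto simp: Q_def intro!: holomorphic_intros always_eventually\<close>)
  then have 1: "(\<lambda>k. deriv (Q k) s0) \<longlonglongrightarrow> d2 (d1 \<Phi>) t0 s0"
    by (simp add: d2_def)
  have "deriv (Q k) s0 = (d2 \<Phi> (t0 + \<epsilon> k) s0 - d2 \<Phi> t0 s0) / \<epsilon> k" for k
  proof -
    have "(\<Phi> t has_field_derivative d2 \<Phi> t s0) (at s0)" if "t \<in> A" for t
      unfolding d2_def using hol[OF that] r(1) by (intro holomorphic_derivI) auto
    from this[OF tA[of k]] this[OF p(1)] show ?thesis
      unfolding Q_def using r(4)[of k] by (intro DERIV_imp_deriv) (auto intro!: derivative_eq_intros)
  qed
  moreover have "(\<lambda>k. (d2 \<Phi> (t0 + \<epsilon> k) s0 - d2 \<Phi> t0 s0) / \<epsilon> k) \<longlonglongrightarrow> d1 (d2 \<Phi>) t0 s0"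
  proof -
    have "(\<lambda>t. d2 \<Phi> t s0) holomorphic_on A" using holo2_d2[OF H AB] p by (simp add: holo2_def)
    then have "((\<lambda>t. d2 \<Phi> t s0) has_field_derivative d1 (d2 \<Phi>) t0 s0) (at t0)"
      unfolding d1_def using AB p by (intro holomorphic_derivI) auto
    then have "((\<lambda>h. (d2 \<Phi> (t0 + h) s0 - d2 \<Phi> t0 s0) / h) \<longlongrightarrow> d1 (d2 \<Phi>) t0 s0) (at 0)"
      by (simp add: DERIV_def)
    moreover have "filterlim \<epsilon> (at 0) sequentially"
      using r(4,5) by (simp add: filterlim_at)
    ultimately show ?thesis using filterlim_compose by blast
  qed
  ultimately have "(\<lambda>k. deriv (Q k) s0) \<longlonglongrightarrow> d1 (d2 \<Phi>) t0 s0" by simp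
  then show ?thesis using 1 LIMSEQ_unique by blast
qed

lemma holo2_has_d1:
  assumes "holo2 A B \<Phi>" "open A" "t \<in> A" "s \<in> B"
  shows "((\<lambda>t. \<Phi> t s) has_field_derivative d1 \<Phi> t s) (at t)"
  unfolding d1_def using assms by (intro holomorphic_derivI[of _ A]) (auto simp: holo2_def)

lemma holo2_has_d2:
  assumes "holo2 A B \<Phi>" "open B" "t \<in> A" "s \<in> B"
  shows "(\<Phi> t has_field_derivative d2 \<Phi> t s) (at s)"
  unfolding d2_def using assms by (intro holomorphic_derivI[of _ B]) (auto simp: holo2_def)

section \<open>Variation of a family of solutions\<close>

lemma holo2_cong_d1:
  assumes "open A" "t \<in> A" "\<And>t. t \<in> A \<Longrightarrow> g t s = h t s"
  shows "d1 g t s = d1 h t s"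
  unfolding d1_def using eventually_nhds_in_open[OF assms(1,2)]
  by (intro deriv_cong_ev) (auto elim!: eventually_mono simp: assms(3))

lemma holo2_cong_d2:
  assumes "open B" "s \<in> B" "\<And>s. s \<in> B \<Longrightarrow> g t s = h t s"
  shows "d2 g t s = d2 h t s"
  unfolding d2_def using eventually_nhds_in_open[OF assms(1,2)]
  by (intro deriv_cong_ev) (auto elim!: eventually_mono simp: assms(3))

text \<open>The derivatives with respect to \<open>x\<close> and \<open>t\<close> in the coordinates \<open>(t, x)\<close>, where
  \<open>x = X t s\<close>, written in the coordinates \<open>(t, s)\<close>.\<close>

definition Dx :: "(complex \<Rightarrow> complex \<Rightarrow> complex) \<Rightarrow> (complex \<Rightarrow> complex \<Rightarrow> complex) \<Rightarrow> complex \<Rightarrow> complex \<Rightarrow> complex"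
  where "Dx X g t s = d2 g t s / d2 X t s"

definition Dt :: "(complex \<Rightarrow> complex \<Rightarrow> complex) \<Rightarrow> (complex \<Rightarrow> complex \<Rightarrow> complex) \<Rightarrow> complex \<Rightarrow> complex \<Rightarrow> complex"
  where "Dt X g t s = d1 g t s - d1 X t s / d2 X t s * d2 g t s"

context
  fixes A B :: "complex set" and X :: "complex \<Rightarrow> complex \<Rightarrow> complex"
  assumes AB: "open A" "open B" and X: "holo2 A B X"
    and reg: "\<And>t s. t \<in> A \<Longrightarrow> s \<in> B \<Longrightarrow> d2 X t s \<noteq> 0"
begin

lemma holo2_Dx: "holo2 A B g \<Longrightarrow> holo2 A B (Dx X g)"
  unfolding Dx_def[abs_def] using AB X reg by (intro holo2_divide holo2_d2) auto

lemma holo2_Dx_pow: "holo2 A B g \<Longrightarrow> holo2 A B ((Dx X ^^ k) g)"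
  by (induction k) (auto intro: holo2_Dx)

lemma Dx_cong:
  assumes "\<And>t s. t \<in> A \<Longrightarrow> s \<in> B \<Longrightarrow> g t s = h t s" "t \<in> A" "s \<in> B"
  shows "Dx X g t s = Dx X h t s"
  unfolding Dx_def using holo2_cong_d2[OF AB(2) assms(3), of g t h] assms by simp

text \<open>Both are coordinate derivations in the coordinates (t, x), so they have to commute; in
  the coordinates (t, s) this is the quotient rule together with the symmetry of mixed derivatives
  of X and g.\<close>

lemma Dt_Dx:
  assumes g: "holo2 A B g" and p: "t \<in> A" "s \<in> B"
  shows "Dt X (Dx X g) t s = Dx X (Dt X g) t s"
proof -
  note h2 = holo2_d1[OF _ AB] holo2_d2[OF _ AB]
  have a: "d1 (Dx X g) t s = (d1 (d2 g) t s * d2 X t s - d2 g t s * d1 (d2 X) t s) / (d2 X t s)\<^sup>2"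
    unfolding d1_def[of "Dx X g"] Dx_def using reg[OF p]
    by (intro DERIV_imp_deriv)
       (auto intro!: derivative_eq_intros holo2_has_d1[OF _ AB(1) p] h2 g X simp: power2_eq_square)
  have b: "d2 (Dx X g) t s = (d2 (d2 g) t s * d2 X t s - d2 g t s * d2 (d2 X) t s) / (d2 X t s)\<^sup>2"
    unfolding d2_def[of "Dx X g"] Dx_def using reg[OF p]
    by (intro DERIV_imp_deriv)
       (auto intro!: derivative_eq_intros holo2_has_d2[OF _ AB(2) p] h2 g X simp: power2_eq_square)
  have c: "d2 (Dt X g) t s = d2 (d1 g) t s - (((d2 (d1 X) t s * d2 X t s - d1 X t s * d2 (d2 X) t s) / (d2 X t s)\<^sup>2)
       * d2 g t s + d1 X t s / d2 X t s * d2 (d2 g) t s)"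
    unfolding d2_def[of "Dt X g"] Dt_def using reg[OF p]
    apply (intro DERIV_imp_deriv)
    apply (auto intro!: derivative_eq_intros holo2_has_d2[OF _ AB(2) p] h2 g X simp: power2_eq_square)
    apply (simp add: field_simps)
    done
  show ?thesis
    unfolding Dt_def[of X "Dx X g"] Dx_def[of X "Dt X g"] a b c d1_d2_commute[OF g AB p] d1_d2_commute[OF X AB p]
    using reg[OF p] by (simp add: field_simps power2_eq_square)
qed

lemma Dt_Dx_pow:
  assumes g: "holo2 A B g" and p: "t \<in> A" "s \<in> B"
  shows "Dt X ((Dx X ^^ k) g) t s = (Dx X ^^ k) (Dt X g) t s"
  using p
proof (induction k arbitrary: t s)
  case (Suc k)
  then show ?case
    using Dt_Dx[OF holo2_Dx_pow[OF g], of t s k] Dx_cong[of "Dt X ((Dx X ^^ k) g)" "(Dx X ^^ k) (Dt X g)" t s]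
    by simp
qed simp

end

section \<open>Jets as vectors and differentiation of the equation\<close>

lemma to_nat_on_bij: "bij_betw (to_nat_on (UNIV :: 'b::finite set)) UNIV {..<CARD('b)}"
  by (rule to_nat_on_finite) simp

lemma from_nat_into_to_nat_on_finite:
  "from_nat_into (UNIV :: 'b::finite set) (to_nat_on (UNIV :: 'b set) i) = i"
  by (simp add: countable_finite)

lemma to_nat_on_from_nat_into_finite:
  assumes "k < CARD('b)"
  shows "to_nat_on (UNIV :: 'b set) (from_nat_into (UNIV :: 'b::finite set) k) = k"
proof -
  have "k \<in> to_nat_on (UNIV :: 'b set) ` UNIV"
    using to_nat_on_bij[where 'b='b] assms by (simp add: bij_betw_def)
  then show ?thesis by (simp add: countable_finite to_nat_on_from_nat_into)
qed

lemma pack_eq_sum: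
  assumes "CARD('b::finite) = n + 1"
  shows "(pack y :: complex ^ 'b) = (\<Sum>i\<le>n. y i *\<^sub>C axis (from_nat_into UNIV i) 1)"
proof (rule vec_eq_iff[THEN iffD2], rule allI)
  fix b :: 'b
  let ?e = "to_nat_on (UNIV :: 'b set)"
  have b: "?e b \<le> n" using to_nat_on_bij[where 'b='b] assms unfolding bij_betw_def by (metis Suc_eq_plus1 UNIV_I imageI lessThan_iff less_Suc_eq_le)
  have "(\<Sum>i\<le>n. y i *\<^sub>C axis (from_nat_into UNIV i) 1) $ b = (\<Sum>i\<le>n. if i = ?e b then y i else 0)"
    unfolding sum_component
  proof (rule sum.cong)
    fix i assume "i \<in> {..n}"
    then have "from_nat_into (UNIV :: 'b set) i = b \<longleftrightarrow> i = ?e b"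
      using assms to_nat_on_from_nat_into_finite[of i, where 'b='b] from_nat_into_to_nat_on_finite[of b] by auto
    then show "(y i *\<^sub>C axis (from_nat_into UNIV i) 1) $ b = (if i = ?e b then y i else 0)"
      by (auto simp: scaleC_vec_def axis_def scaleC_complex_def)
  qed simp
  also have "\<dots> = (pack y :: complex ^ 'b) $ b" using b by (simp add: pack_def)
  finally show "(pack y :: complex ^ 'b) $ b = (\<Sum>i\<le>n. y i *\<^sub>C axis (from_nat_into UNIV i) 1) $ b" ..
qed

lemma scaleC_zero_right [simp]: "c *\<^sub>C (0 :: 'a::complex_normed) = 0"
  using scaleC_add_right[of c "0::'a" 0] by simp

lemma scaleC_one [simp]: "1 *\<^sub>C (v :: 'a::complex_normed) = v"
  using scaleC_of_real[of 1 v] by simp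

lemma scaleC_zero_left [simp]: "0 *\<^sub>C (v :: 'a::complex_normed) = 0"
  using scaleC_of_real[of 0 v] by simp

lemma bounded_linear_axis: "bounded_linear (axis i :: 'a::real_normed_vector \<Rightarrow> 'a ^ 'b::finite)"
proof (rule bounded_linear_intro[where K = 1])
  fix x y :: 'a and r :: real
  show "(axis i (x + y) :: 'a ^ 'b) = axis i x + axis i y" by (simp add: axis_def vec_eq_iff)
  show "(axis i (r *\<^sub>R x) :: 'a ^ 'b) = r *\<^sub>R axis i x" by (simp add: axis_def vec_eq_iff)
  have "(\<Sum>j\<in>UNIV. (norm ((axis i x :: 'a ^ 'b) $ j))\<^sup>2) = (\<Sum>j\<in>UNIV. if j = i then (norm x)\<^sup>2 else 0)"
    by (rule sum.cong) (auto simp: axis_def)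
  then show "norm (axis i x :: 'a ^ 'b) \<le> norm x * 1"
    by (simp add: norm_vec_def L2_set_def)
qed

lemma has_derivative_vec:
  fixes f :: "'b::finite \<Rightarrow> 'c::real_normed_vector \<Rightarrow> 'a::real_normed_vector"
  assumes "\<And>i. (f i has_derivative f' i) F"
  shows "((\<lambda>x. \<chi> i. f i x) has_derivative (\<lambda>h. \<chi> i. f' i h)) F"
proof -
  have "((\<lambda>x. \<Sum>i\<in>UNIV. axis i (f i x)) has_derivative (\<lambda>h. \<Sum>i\<in>UNIV. axis i (f' i h))) F"
    by (intro has_derivative_sum bounded_linear.has_derivative[OF bounded_linear_axis] assms)
  moreover have "(\<Sum>i\<in>UNIV. axis i (g i)) = (\<chi> i. g i)" for g :: "'b \<Rightarrow> 'a"
    by (simp add: vec_eq_iff sum_component axis_def)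
  ultimately show ?thesis by simp
qed

lemma has_derivative_pack:
  assumes "\<And>i. (y i has_field_derivative y' i) (at t)"
  shows "((\<lambda>t. pack (\<lambda>i. y i t) :: complex ^ 'b::finite) has_derivative (\<lambda>h. h *\<^sub>C pack y')) (at t)"
proof -
  have "((\<lambda>t. \<chi> i. y (to_nat_on (UNIV :: 'b set) i) t) has_derivative (\<lambda>h. \<chi> i. y' (to_nat_on (UNIV :: 'b set) i) * h)) (at t)"
    using assms by (intro has_derivative_vec) (simp add: has_field_derivative_def)
  then show ?thesis by (simp add: pack_def scaleC_vec_def scaleC_complex_def mult.commute)
qed

lemma has_field_derivative_comp_holo_on:
  assumes f: "(f has_derivative f') (at (x t, v t))" "\<And>c w. f' (c *\<^sub>C w) = c *\<^sub>C f' w"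
    and "(x has_field_derivative x') (at t)" "(v has_derivative (\<lambda>h. h *\<^sub>C v')) (at t)"
  shows "((\<lambda>t. f (x t, v t) :: complex) has_field_derivative f' (x', v')) (at t)"
proof -
  have "((\<lambda>t. (x t, v t)) has_derivative (\<lambda>h. (x' * h, h *\<^sub>C v'))) (at t)"
    using assms(3,4) by (intro has_derivative_Pair) (simp_all add: has_field_derivative_def)
  then have "((\<lambda>t. f (x t, v t)) has_derivative (\<lambda>h. f' (x' * h, h *\<^sub>C v'))) (at t)"
    using has_derivative_compose[of "\<lambda>t. (x t, v t)" _ t UNIV f f'] f(1) by blast
  also have "(\<lambda>h. f' (x' * h, h *\<^sub>C v')) = (*) (f' (x', v'))"
  proof
    fix h
    have "(x' * h, h *\<^sub>C v') = h *\<^sub>C (x', v')" by (simp add: scaleC_prod_def scaleC_complex_def)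
    then show "f' (x' * h, h *\<^sub>C v') = f' (x', v') * h" by (simp only: f(2)) (simp add: scaleC_complex_def)
  qed
  finally show ?thesis by (simp add: has_field_derivative_def)
qed

lemma partial_y_sum:
  assumes n: "CARD('b::finite) = n + 1"
    and f: "(f has_derivative f') (at q)" "\<And>c w. f' (c *\<^sub>C w) = c *\<^sub>C f' w"
  shows "f' (0, pack y :: complex ^ 'b) = (\<Sum>i\<le>n. partial_y f i q * y i)"
proof -
  interpret bounded_linear f' using f(1) by (rule has_derivative_bounded_linear)
  have "(0 :: complex, pack y :: complex ^ 'b) = (\<Sum>i\<le>n. y i *\<^sub>C (0, axis (from_nat_into UNIV i) 1))"
    unfolding pack_eq_sum[OF n] by (simp add: prod_eq_iff fst_sum snd_sum scaleC_prod_def)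
  then have "f' (0, pack y) = (\<Sum>i\<le>n. y i *\<^sub>C f' (0, axis (from_nat_into UNIV i) 1))"
    by (simp only: sum f(2))
  then show ?thesis
    by (simp add: scaleC_complex_def mult.commute partial_y_def frechet_derivative_at[OF f(1), symmetric])
qed

text \<open>The equation is differentiated in t and in s. In the combination d1 - (d1 X / d2 X) d2
  the x-component of the velocity of the jet cancels, so only the partial derivatives of f in the
  y_i remain. Finally \<open>Dt\<close> is moved past the powers of \<open>Dx\<close>.\<close>

lemma variation_solves_linearization:
  fixes f :: "complex \<times> (complex ^ 'b::finite) \<Rightarrow> complex"
  assumes n: "CARD('b) = n + 1" and AB: "open A" "open B" and X: "holo2 A B X" and Y: "holo2 A B Y"
    and reg: "\<And>t s. t \<in> A \<Longrightarrow> s \<in> B \<Longrightarrow> d2 X t s \<noteq> 0"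
    and J: "J = (\<lambda>t s. (X t s, pack (\<lambda>i. (Dx X ^^ i) Y t s)))"
    and f: "holo_on U f" and JU: "\<And>t s. t \<in> A \<Longrightarrow> s \<in> B \<Longrightarrow> J t s \<in> U"
    and ode: "\<And>t s. t \<in> A \<Longrightarrow> s \<in> B \<Longrightarrow> (Dx X ^^ (n + 1)) Y t s = f (J t s)"
    and p: "t \<in> A" "s \<in> B"
  shows "(Dx X ^^ (n + 1)) (Dt X Y) t s = (\<Sum>i\<le>n. partial_y f i (J t s) * (Dx X ^^ i) (Dt X Y) t s)"
proof -
  obtain f' where f': "(f has_derivative f') (at (J t s))" "\<And>c w. f' (c *\<^sub>C w) = c *\<^sub>C f' w"
    using f JU[OF p] unfolding holo_on_def by blast
  interpret bounded_linear f' using f'(1) by (rule has_derivative_bounded_linear)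
  define y where "y = (\<lambda>i. (Dx X ^^ i) Y)"
  have y: "holo2 A B (y i)" for i
    unfolding y_def using holo2_Dx_pow[OF AB X reg Y] by blast
  have f'y: "(f has_derivative f') (at (X t s, pack (\<lambda>i. y i t s)))"
    using f'(1) by (simp add: J y_def)
  have e1: "d1 (y (n + 1)) t s = f' (d1 X t s, pack (\<lambda>i. d1 (y i) t s))"
  proof -
    have "d1 (y (n + 1)) t s = d1 (\<lambda>t s. f (X t s, pack (\<lambda>i. y i t s))) t s"
      using ode p by (intro holo2_cong_d1[OF AB(1)]) (auto simp: y_def J)
    also have "\<dots> = f' (d1 X t s, pack (\<lambda>i. d1 (y i) t s))"
      unfolding d1_def[of "\<lambda>t s. f (X t s, pack (\<lambda>i. y i t s))"]
      by (rule DERIV_imp_deriv, rule has_field_derivative_comp_holo_on)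
         (use f'y f'(2) y X in \<open>auto intro!: has_derivative_pack holo2_has_d1[OF _ AB(1) p]\<close>)
    finally show ?thesis .
  qed
  have e2: "d2 (y (n + 1)) t s = f' (d2 X t s, pack (\<lambda>i. d2 (y i) t s))"
  proof -
    have "d2 (y (n + 1)) t s = d2 (\<lambda>t s. f (X t s, pack (\<lambda>i. y i t s))) t s"
      using ode p by (intro holo2_cong_d2[OF AB(2)]) (auto simp: y_def J)
    also have "\<dots> = f' (d2 X t s, pack (\<lambda>i. d2 (y i) t s))"
      unfolding d2_def[of "\<lambda>t s. f (X t s, pack (\<lambda>i. y i t s))"]
      by (rule DERIV_imp_deriv, rule has_field_derivative_comp_holo_on)
         (use f'y f'(2) y X in \<open>auto intro!: has_derivative_pack holo2_has_d2[OF _ AB(2) p]\<close>)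
    finally show ?thesis .
  qed
  let ?c = "d1 X t s / d2 X t s"
  have "Dt X (y (n + 1)) t s = f' (d1 X t s, pack (\<lambda>i. d1 (y i) t s)) - ?c *\<^sub>C f' (d2 X t s, pack (\<lambda>i. d2 (y i) t s))"
    unfolding Dt_def e1 e2 by (simp add: scaleC_complex_def)
  also have "\<dots> = f' ((d1 X t s, pack (\<lambda>i. d1 (y i) t s)) - ?c *\<^sub>C (d2 X t s, pack (\<lambda>i. d2 (y i) t s)))"
    by (simp only: diff f'(2))
  also have "(d1 X t s, pack (\<lambda>i. d1 (y i) t s)) - ?c *\<^sub>C (d2 X t s, pack (\<lambda>i. d2 (y i) t s)) =
      (0, pack (\<lambda>i. Dt X (y i) t s) :: complex ^ 'b)"
    using reg[OF p] by (simp add: scaleC_prod_def scaleC_complex_def scaleC_vec_def pack_def vec_eq_iff Dt_def)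
  also have "f' \<dots> = (\<Sum>i\<le>n. partial_y f i (J t s) * Dt X (y i) t s)"
    by (rule partial_y_sum[OF n f'])
  finally have E: "Dt X (y (n + 1)) t s = (\<Sum>i\<le>n. partial_y f i (J t s) * Dt X (y i) t s)" .
  have "Dt X (y k) t s = (Dx X ^^ k) (Dt X Y) t s" for k
    unfolding y_def by (rule Dt_Dx_pow[OF AB X reg Y p])
  then show ?thesis using E by (simp only:)
qed

section \<open>Uniqueness of solutions\<close>

text \<open>Along a parametrised graph \<open>Dx\<close> is d/dx, by the chain rule. This translates
  between derivatives computed in the parameter s of a curve and derivatives of the function whose
  graph it is.\<close>

lemma Dx_pow_graph:
  assumes B: "open B" "X t holomorphic_on B" "\<And>s. s \<in> B \<Longrightarrow> d2 X t s \<noteq> 0"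
    and Z: "open T" "Z holomorphic_on T" "\<And>s. s \<in> B \<Longrightarrow> X t s \<in> T"
    and g: "\<And>s. s \<in> B \<Longrightarrow> g t s = Z (X t s)" and s: "s \<in> B"
  shows "(Dx X ^^ k) g t s = (deriv ^^ k) Z (X t s)"
  using s
proof (induction k arbitrary: s)
  case (Suc k)
  have "d2 ((Dx X ^^ k) g) t s = d2 (\<lambda>t s. (deriv ^^ k) Z (X t s)) t s"
    by (rule holo2_cong_d2[OF B(1) Suc.prems]) (rule Suc.IH)
  also have "\<dots> = deriv ((deriv ^^ k) Z) (X t s) * d2 X t s"
    unfolding d2_def
  proof (rule DERIV_imp_deriv)
    have "((deriv ^^ k) Z has_field_derivative (deriv ^^ Suc k) Z (X t s)) (at (X t s))"
      using has_field_derivative_higher_deriv[OF Z(2,1) Z(3)] Suc.prems by blast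
    moreover have "(X t has_field_derivative deriv (X t) s) (at s)"
      using B Suc.prems by (simp add: holomorphic_derivI)
    ultimately show "((\<lambda>s. (deriv ^^ k) Z (X t s)) has_field_derivative
        deriv ((deriv ^^ k) Z) (X t s) * deriv (X t) s) (at s)"
      using DERIV_chain2 by auto
  qed
  finally show ?case
    using B(3)[OF Suc.prems] by (simp add: Dx_def[of X "(Dx X ^^ k) g"])
qed (use g in auto)

lemma bounded_linear_scaleC_left: "bounded_linear (\<lambda>h. h *\<^sub>C (w :: 'a::complex_normed))"
proof (rule bounded_linear_intro[where K = "norm w"])
  show "(r *\<^sub>R x) *\<^sub>C w = r *\<^sub>R x *\<^sub>C w" for r x
    by (simp add: scaleR_conv_of_real scaleC_scaleC[symmetric] scaleC_of_real)
qed (simp_all add: scaleC_add_left norm_scaleC)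

lemma has_field_derivative_along:
  fixes f :: "'a::complex_normed \<Rightarrow> complex"
  assumes "(f has_derivative f') (at (g t))" "\<And>c w. f' (c *\<^sub>C w) = c *\<^sub>C f' w"
    and "(g has_derivative (\<lambda>h. h *\<^sub>C v)) (at t)"
  shows "((\<lambda>t. f (g t)) has_field_derivative f' v) (at t)"
proof -
  have "((\<lambda>t. f (g t)) has_derivative (\<lambda>h. f' (h *\<^sub>C v))) (at t)"
    using has_derivative_compose[OF assms(3,1)] .
  moreover have "(\<lambda>h. f' (h *\<^sub>C v)) = (*) (f' v)"
    by (simp add: assms(2) scaleC_complex_def fun_eq_iff)
  ultimately show ?thesis by (simp add: has_field_derivative_def)
qed

lemma has_derivative_line: "((\<lambda>\<theta>. q + \<theta> *\<^sub>C w) has_derivative (\<lambda>h. h *\<^sub>C w)) (at \<theta>)"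
  by (auto intro!: derivative_eq_intros bounded_linear.has_derivative[OF bounded_linear_scaleC_left])

lemma holo_on_line:
  fixes f :: "'a::complex_normed \<Rightarrow> complex"
  assumes "holo_on U f" "\<And>\<theta>. \<theta> \<in> T \<Longrightarrow> q + \<theta> *\<^sub>C w \<in> U"
  shows "(\<lambda>\<theta>. f (q + \<theta> *\<^sub>C w)) holomorphic_on T"
proof -
  have "\<exists>D. ((\<lambda>\<theta>. f (q + \<theta> *\<^sub>C w)) has_field_derivative D) (at \<theta>)" if "\<theta> \<in> T" for \<theta>
    using assms(1) assms(2)[OF that] has_field_derivative_along[OF _ _ has_derivative_line[of q w]]
    unfolding holo_on_def by metis
  then show ?thesis
    unfolding holomorphic_on_def by (meson field_differentiable_at_within field_differentiable_def)
qed

text \<open>\<open>holo_on\<close> asserts no continuity of the derivative. The estimate is obtained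
  on the complex line through the two points, where f is an ordinary holomorphic function, from a
  local bound M for f and Cauchy's inequality.\<close>

lemma holo_on_lipschitz:
  fixes f :: "'a::complex_normed \<Rightarrow> complex"
  assumes "open U" "holo_on U f" "q \<in> U"
  obtains K \<rho> where "\<rho> > 0" "K \<ge> 0" "ball q \<rho> \<subseteq> U"
    "\<And>q1 q2. q1 \<in> ball q \<rho> \<Longrightarrow> q2 \<in> ball q \<rho> \<Longrightarrow> cmod (f q2 - f q1) \<le> K * norm (q2 - q1)"
proof -
  have "continuous (at q) f"
    using assms(2,3) unfolding holo_on_def using has_derivative_continuous by blast
  then have "\<forall>\<^sub>F p in nhds q. dist (f p) (f q) < 1"
    using tendstoD[of f "f q" "at q" 1] by (auto simp: isCont_def eventually_nhds_conv_at)
  then have "\<forall>\<^sub>F p in nhds q. dist (f p) (f q) < 1 \<and> p \<in> U"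
    using eventually_nhds_in_open[OF assms(1,3)] by eventually_elim auto
  then obtain R where R: "R > 0" "\<And>p. dist p q < R \<Longrightarrow> dist (f p) (f q) < 1 \<and> p \<in> U"
    unfolding eventually_nhds_metric by blast
  define M where "M = cmod (f q) + 1"
  have M: "cmod (f p) \<le> M" "p \<in> U" if "p \<in> ball q R" for p
  proof -
    show "p \<in> U" using R(2)[of p] that by (simp add: dist_commute)
    have "cmod (f p - f q) < 1" using R(2)[of p] that by (simp add: dist_commute dist_norm)
    then show "cmod (f p) \<le> M" unfolding M_def using norm_triangle_sub[of "f p" "f q"] by linarith
  qed
  \<comment> \<open>Discs of radius less than 2 \<rho> on the line, centred on the segment inside
    \<open>ball q \<rho>\<close>, stay in the ball of radius R = 3 \<rho> on which f is bounded by
    M.\<close>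
  define \<rho> where "\<rho> = R / 3"
  have \<rho>: "\<rho> > 0" "R = 3 * \<rho>" using R(1) by (auto simp: \<rho>_def)
  have M0: "M > 0" by (simp add: M_def add_nonneg_pos)
  have "cmod (f q2 - f q1) \<le> (M / \<rho>) * norm (q2 - q1)" if q12: "q1 \<in> ball q \<rho>" "q2 \<in> ball q \<rho>" for q1 q2
  proof (cases "q1 = q2")
    case False
    define w where "w = q2 - q1"
    have w: "norm w > 0" using False by (simp add: w_def)
    define \<phi> where "\<phi> = (\<lambda>\<theta>. f (q1 + \<theta> *\<^sub>C w))"
    define d where "d = \<rho> / norm w"
    have d: "d > 0" using \<rho> w by (simp add: d_def)
    have seg: "q1 + \<theta> *\<^sub>C w \<in> ball q \<rho>" if th: "\<theta> \<in> closed_segment 0 1" for \<theta>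
    proof -
      obtain u where u: "0 \<le> u" "u \<le> 1" "\<theta> = of_real u"
        using th unfolding closed_segment_def by (auto simp: scaleR_conv_of_real)
      have "q1 + \<theta> *\<^sub>C w = (1 - u) *\<^sub>R q1 + u *\<^sub>R q2"
        by (simp add: u(3) scaleC_of_real w_def algebra_simps)
      then show ?thesis using convexD_alt[OF convex_ball q12 u(1,2)] by simp
    qed
    have near: "q1 + \<theta>' *\<^sub>C w \<in> ball q R" if "\<theta> \<in> closed_segment 0 1" "\<theta>' \<in> ball \<theta> (2 * d)" for \<theta> \<theta>'
    proof -
      have "dist (q1 + \<theta> *\<^sub>C w) (q1 + \<theta>' *\<^sub>C w) = cmod (\<theta> - \<theta>') * norm w"
      proof -
        have "(\<theta> - \<theta>') *\<^sub>C w = \<theta> *\<^sub>C w - \<theta>' *\<^sub>C w"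
          by (metis scaleC_add_left add_diff_cancel_right' diff_add_cancel)
        then show ?thesis by (simp add: dist_norm norm_scaleC[symmetric])
      qed
      also have "\<dots> < 2 * d * norm w"
        using that(2) w by (auto simp: dist_norm intro!: mult_strict_right_mono)
      also have "2 * d * norm w = 2 * \<rho>" using w by (simp add: d_def)
      finally show ?thesis
        using seg[OF that(1)] dist_triangle[of q "q1 + \<theta>' *\<^sub>C w" "q1 + \<theta> *\<^sub>C w"] by (simp add: \<rho>(2))
    qed
    have hol: "\<phi> holomorphic_on ball \<theta> (2 * d)" if "\<theta> \<in> closed_segment 0 1" for \<theta>
      unfolding \<phi>_def using near[OF that] M(2) by (intro holo_on_line[OF assms(2)]) auto
    have D: "cmod (deriv \<phi> \<theta>) \<le> (M / \<rho>) * norm w" if th: "\<theta> \<in> closed_segment 0 1" for \<theta>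
    proof -
      have "cball \<theta> d \<subseteq> ball \<theta> (2 * d)" using d by auto
      then have "\<phi> holomorphic_on cball \<theta> d" using hol[OF th] holomorphic_on_subset by blast
      then have "cmod ((deriv ^^ 1) \<phi> \<theta>) \<le> fact 1 * M / d ^ 1"
      proof (intro Cauchy_inequality)
        show "cmod (\<phi> x) \<le> M" if "cmod (\<theta> - x) = d" for x
          using near[OF th, of x] that d M(1) by (auto simp: \<phi>_def dist_norm)
      qed (use d in \<open>auto intro: holomorphic_on_subset holomorphic_on_imp_continuous_on\<close>)
      then show ?thesis by (simp add: d_def)
    qed
    have "cmod (\<phi> 1 - \<phi> 0) \<le> (M / \<rho>) * norm w * cmod (1 - 0)"
    proof (rule field_differentiable_bound[of "closed_segment 0 1"])
      show "(\<phi> has_field_derivative deriv \<phi> z) (at z within closed_segment 0 1)" if "z \<in> closed_segment 0 1" for z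
        using d holomorphic_derivI[OF hol[OF that] open_ball, of z] by (auto intro: has_field_derivative_at_within)
      show "cmod (deriv \<phi> z) \<le> (M / \<rho>) * norm w" if "z \<in> closed_segment 0 1" for z
        using D[OF that] .
    qed (rule convex_closed_segment ends_in_segment)+
    then show ?thesis by (simp add: \<phi>_def w_def)
  qed (use M0 \<rho> in auto)
  then have lip: "\<And>q1 q2. q1 \<in> ball q \<rho> \<Longrightarrow> q2 \<in> ball q \<rho> \<Longrightarrow> cmod (f q2 - f q1) \<le> (M / \<rho>) * norm (q2 - q1)" .
  have "ball q \<rho> \<subseteq> U"
  proof
    fix p assume "p \<in> ball q \<rho>"
    then have "p \<in> ball q R" using \<rho> by simp
    then show "p \<in> U" by (rule M(2))
  qed
  moreover have "M / \<rho> \<ge> 0" using M0 \<rho>(1) by simp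
  ultimately show thesis using lip \<rho>(1) by - (rule that[of \<rho> "M / \<rho>"]; assumption)
qed

lemma norm_pack_le:
  assumes "CARD('b::finite) = n + 1"
  shows "norm (pack y :: complex ^ 'b) \<le> (\<Sum>i\<le>n. cmod (y i))"
  unfolding pack_eq_sum[OF assms]
  by (rule sum_norm_le) (simp add: norm_scaleC norm_axis_1)

text \<open>Let M be the maximum on a small disc of the sum of the moduli of the differences
  \<Delta> i, i \<le> n. They vanish at x0, and their derivatives are bounded by M for i < n and, by
  the Lipschitz estimate, by K M for i = n. The mean value inequality gives M \<le> r (n + K) M,
  hence M = 0.\<close>

lemma ode_unique:
  fixes f :: "complex \<times> (complex ^ 'b::finite) \<Rightarrow> complex"
  assumes n: "CARD('b) = n + 1" and U: "open U" "holo_on U f"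
    and I: "open I" "x0 \<in> I" and hol: "Y holomorphic_on I" "Z holomorphic_on I"
    and init: "\<And>i. i \<le> n \<Longrightarrow> (deriv ^^ i) Y x0 = (deriv ^^ i) Z x0"
    and q: "(x0, pack (\<lambda>i. (deriv ^^ i) Y x0)) \<in> U"
    and ode: "\<And>x. x \<in> I \<Longrightarrow> (deriv ^^ (n + 1)) Y x = f (x, pack (\<lambda>i. (deriv ^^ i) Y x))"
      "\<And>x. x \<in> I \<Longrightarrow> (deriv ^^ (n + 1)) Z x = f (x, pack (\<lambda>i. (deriv ^^ i) Z x))"
  obtains e where "e > 0" "ball x0 e \<subseteq> I" "\<And>x. x \<in> ball x0 e \<Longrightarrow> Y x = Z x"
proof -
  define JY :: "complex \<Rightarrow> complex \<times> (complex ^ 'b)" where "JY = (\<lambda>x. (x, pack (\<lambda>i. (deriv ^^ i) Y x)))"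
  define JZ :: "complex \<Rightarrow> complex \<times> (complex ^ 'b)" where "JZ = (\<lambda>x. (x, pack (\<lambda>i. (deriv ^^ i) Z x)))"
  have cont: "isCont JY x0" "isCont JZ x0"
    unfolding JY_def JZ_def
    by (intro continuous_Pair continuous_ident
        has_derivative_continuous[OF has_derivative_pack[OF has_field_derivative_higher_deriv[OF _ I]]] hol)+
  obtain K \<rho> where K: "\<rho> > 0" "K \<ge> 0" "ball (JY x0) \<rho> \<subseteq> U"
    "\<And>q1 q2. q1 \<in> ball (JY x0) \<rho> \<Longrightarrow> q2 \<in> ball (JY x0) \<rho> \<Longrightarrow> cmod (f q2 - f q1) \<le> K * norm (q2 - q1)"
    using holo_on_lipschitz[OF U, of "JY x0"] q unfolding JY_def by metis
  have "(pack (\<lambda>i. (deriv ^^ i) Y x0) :: complex ^ 'b) = pack (\<lambda>i. (deriv ^^ i) Z x0)"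
    unfolding pack_eq_sum[OF n] by (rule sum.cong) (simp_all add: init)
  then have JJ: "JZ x0 = JY x0" by (simp add: JY_def JZ_def)
  have "\<forall>\<^sub>F x in nhds x0. JY x \<in> ball (JY x0) \<rho> \<and> JZ x \<in> ball (JY x0) \<rho> \<and> x \<in> I"
  proof -
    have "\<forall>\<^sub>F x in nhds x0. JY x \<in> ball (JY x0) \<rho>" "\<forall>\<^sub>F x in nhds x0. JZ x \<in> ball (JZ x0) \<rho>"
      using cont K(1)
      by (auto simp: isCont_def eventually_nhds_conv_at centre_in_ball simp del: mem_ball
          intro!: topological_tendstoD[OF _ open_ball])
    then show ?thesis using eventually_nhds_in_open[OF I] unfolding JJ by eventually_elim auto
  qed
  then obtain r0 where r0: "r0 > 0"
    "\<And>x. dist x x0 < r0 \<Longrightarrow> JY x \<in> ball (JY x0) \<rho> \<and> JZ x \<in> ball (JY x0) \<rho> \<and> x \<in> I"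
    unfolding eventually_nhds_metric by blast
  \<comment> \<open>The second bound makes r (n + K) < 1, which is the contraction.\<close>
  define r where "r = min (r0 / 2) (1 / (2 * (n + K + 1)))"
  have r: "r > 0" "r < r0" "r * (n + K) < 1"
  proof -
    show "r > 0" "r < r0" using r0(1) K(2) by (auto simp: r_def)
    have "r * (n + K) \<le> 1 / (2 * (n + K + 1)) * (n + K)"
      using K(2) by (intro mult_right_mono) (auto simp: r_def)
    also have "\<dots> < 1" using K(2) by (simp add: field_simps)
    finally show "r * (n + K) < 1" .
  qed
  have sub: "cball x0 r \<subseteq> I" using r0(2) r(2) by (auto simp: dist_commute)
  define \<Delta> where "\<Delta> = (\<lambda>i x. (deriv ^^ i) Y x - (deriv ^^ i) Z x)"
  have d\<Delta>: "(\<Delta> i has_field_derivative \<Delta> (Suc i) x) (at x)" if "x \<in> cball x0 r" for i x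
    unfolding \<Delta>_def using that sub
    by (intro DERIV_diff has_field_derivative_higher_deriv[OF _ I(1)] hol) auto
  define g where "g = (\<lambda>x. \<Sum>i\<le>n. cmod (\<Delta> i x))"
  have "continuous_on (cball x0 r) (\<Delta> i)" for i
    using d\<Delta> by (meson DERIV_isCont continuous_at_imp_continuous_on)
  then have "continuous_on (cball x0 r) g"
    unfolding g_def by (auto intro!: continuous_intros)
  then obtain x1 where x1: "x1 \<in> cball x0 r" "\<And>x. x \<in> cball x0 r \<Longrightarrow> g x \<le> g x1"
    using continuous_attains_sup[of "cball x0 r" g] r(1) by auto
  define M where "M = g x1"
  have \<Delta>M: "cmod (\<Delta> i x) \<le> M" if "i \<le> n" "x \<in> cball x0 r" for i x
  proof -
    have "cmod (\<Delta> i x) \<le> g x" unfolding g_def using that(1) by (intro member_le_sum) auto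
    then show ?thesis using x1(2)[OF that(2)] by (simp add: M_def)
  qed
  have top: "cmod (\<Delta> (Suc n) x) \<le> K * M" if "x \<in> cball x0 r" for x
  proof -
    have xr: "dist x x0 < r0" using that r(2) by (simp add: dist_commute)
    have "\<Delta> (Suc n) x = f (JY x) - f (JZ x)"
      using ode that sub unfolding \<Delta>_def JY_def JZ_def by (auto simp: subset_iff simp del: funpow.simps)
    then have "cmod (\<Delta> (Suc n) x) \<le> K * norm (JY x - JZ x)" using K(4) r0(2)[OF xr] by metis
    also have "JY x - JZ x = (0, pack (\<lambda>i. \<Delta> i x))"
      by (simp add: JY_def JZ_def pack_def vec_eq_iff \<Delta>_def)
    also have "norm (0::complex, pack (\<lambda>i. \<Delta> i x) :: complex ^ 'b) \<le> g x"
      unfolding g_def norm_Pair using norm_pack_le[OF n, of "\<lambda>i. \<Delta> i x"] by simp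
    also have "g x \<le> M" using x1(2)[OF that] by (simp add: M_def)
    finally show ?thesis using K(2) by (simp add: mult_left_mono)
  qed
  have bd: "cmod (\<Delta> i x1) \<le> C * r" if "i \<le> n" "\<And>x. x \<in> cball x0 r \<Longrightarrow> cmod (\<Delta> (Suc i) x) \<le> C" for i C
  proof -
    have "cmod (\<Delta> i x1 - \<Delta> i x0) \<le> C * cmod (x1 - x0)"
      using x1(1) r(1) that(2) d\<Delta> by (intro field_differentiable_bound[of "cball x0 r"]) (auto intro: has_field_derivative_at_within)
    moreover have "\<Delta> i x0 = 0" using init[OF that(1)] by (simp add: \<Delta>_def)
    moreover have "0 \<le> C" using that(2)[OF x1(1)] norm_ge_zero order_trans by blast
    moreover have "cmod (x1 - x0) \<le> r" using x1(1) by (simp add: dist_norm norm_minus_commute)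
    ultimately show ?thesis by (metis (no_types, lifting) diff_zero mult_left_mono order_trans)
  qed
  have "M = (\<Sum>i<n. cmod (\<Delta> i x1)) + cmod (\<Delta> n x1)"
    by (simp add: M_def g_def lessThan_Suc_atMost[symmetric])
  also have "\<dots> \<le> (\<Sum>i<n. M * r) + K * M * r"
    by (intro add_mono sum_mono bd) (use \<Delta>M top in auto)
  finally have "M \<le> (r * (n + K)) * M" by (simp add: algebra_simps)
  moreover have "M \<ge> 0" by (simp add: M_def g_def sum_nonneg)
  ultimately have "M = 0" using r(3)
    by (metis mult_cancel_right1 mult_right_mono order_less_le_trans less_eq_real_def mult_less_cancel_right2 not_less)
  then have "Y x = Z x" if "x \<in> ball x0 r" for x
    using \<Delta>M[of 0 x] that by (simp add: \<Delta>_def)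
  moreover have "ball x0 r \<subseteq> I" using sub ball_subset_cball by blast
  ultimately show thesis using that r(1) by blast
qed

lemma pack_nth:
  assumes "i < CARD('b::finite)"
  shows "vec_nth (pack y :: complex ^ 'b) (from_nat_into UNIV i) = y i"
  using assms by (simp add: pack_def to_nat_on_from_nat_into_finite)

text \<open>\<open>solution_through\<close> is some solution with the prescribed n-jet, about which
  nothing else is known. By uniqueness it coincides with Z near x0, so the linearization defining
  \<open>W_fun\<close> is the one along Z there.\<close>

lemma W_fun_eq_0:
  fixes f :: "complex \<times> (complex ^ 'b::finite) \<Rightarrow> complex"
  assumes n: "CARD('b) = n + 1" "1 \<le> n" and k: "3 \<le> k" "k \<le> n + 1" and U: "open U" "holo_on U f"
    and I: "open I" "x0 \<in> I" and Z: "Z holomorphic_on I"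
    and J: "J = (\<lambda>x. (x, pack (\<lambda>i. (deriv ^^ i) Z x)))" "\<And>x. x \<in> I \<Longrightarrow> J x \<in> U"
    and ode: "\<And>x. x \<in> I \<Longrightarrow> (deriv ^^ (n + 1)) Z x = f (J x)"
    and lam: "lam holomorphic_on I" "inj_on lam I"
    and mu: "mu holomorphic_on I" "\<And>x. x \<in> I \<Longrightarrow> mu x \<noteq> 0"
    and lin: "\<And>i x. i \<le> n \<Longrightarrow> x \<in> I \<Longrightarrow> (deriv ^^ (n + 1)) (\<lambda>x. lam x ^ i / mu x) x =
        (\<Sum>j\<le>n. partial_y f j (J x) * (deriv ^^ j) (\<lambda>x. lam x ^ i / mu x) x)"
  shows "W_fun n k f (J x0) = 0"
proof -
  define Y where "Y = solution_through n f (J x0)"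
  have "\<exists>Y I. fst (J x0) \<in> I \<and> is_solution n f I Y \<and> pack (\<lambda>i. (deriv ^^ i) Y (fst (J x0))) = snd (J x0)"
    using I Z ode unfolding J(1) is_solution_def by (intro exI[of _ Z] exI[of _ I]) simp
  from someI_ex[OF this, folded solution_through_def, folded Y_def]
  obtain I' where "fst (J x0) \<in> I'" and sol: "is_solution n f I' Y"
    and "pack (\<lambda>i. (deriv ^^ i) Y (fst (J x0))) = snd (J x0)" by (elim exE conjE)
  then have I': "x0 \<in> I'" "is_solution n f I' Y"
    and init: "(pack (\<lambda>i. (deriv ^^ i) Y x0) :: complex ^ 'b) = pack (\<lambda>i. (deriv ^^ i) Z x0)"
    by (simp_all add: J(1))
  obtain e where e: "e > 0" "ball x0 e \<subseteq> I \<inter> I'" "\<And>x. x \<in> ball x0 e \<Longrightarrow> Z x = Y x"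
  proof (rule ode_unique[OF n(1) U, of "I \<inter> I'" x0 Z Y])
    show "(deriv ^^ i) Z x0 = (deriv ^^ i) Y x0" if "i \<le> n" for i
      using arg_cong[OF init, of "\<lambda>v. vec_nth v (from_nat_into UNIV i)"] that n(1) by (simp add: pack_nth)
    show "open (I \<inter> I')" "x0 \<in> I \<inter> I'" using I I' by (auto simp: is_solution_def)
    show "Z holomorphic_on I \<inter> I'" "Y holomorphic_on I \<inter> I'"
      using Z I'(2) by (auto simp: is_solution_def intro: holomorphic_on_subset[OF _ inf_le1] holomorphic_on_subset[OF _ inf_le2])
    show "(x0, pack (\<lambda>i. (deriv ^^ i) Z x0)) \<in> U" using J I by simp
    show "(deriv ^^ (n + 1)) Z x = f (x, pack (\<lambda>i. (deriv ^^ i) Z x))" if "x \<in> I \<inter> I'" for x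
      using ode[of x] that unfolding J(1) by simp
    show "(deriv ^^ (n + 1)) Y x = f (x, pack (\<lambda>i. (deriv ^^ i) Y x))" if "x \<in> I \<inter> I'" for x
      using I'(2) that unfolding is_solution_def by simp
  qed (rule that; assumption)
  have lin_p: "linearization f Y j x = - partial_y f j (J x)" if "x \<in> ball x0 e" for j x
  proof -
    have "eventually (\<lambda>x. Y x = Z x) (nhds x)"
      using eventually_nhds_in_open[OF open_ball that] by (rule eventually_mono) (use e(3) in auto)
    then have "(deriv ^^ i) Y x = (deriv ^^ i) Z x" for i
      by (intro higher_deriv_cong_ev) auto
    then show ?thesis by (simp add: linearization_def J(1))
  qed
  have "wilczynski n k (linearization f Y) x0 = 0"
  proof (rule wilczynski_eq_0[where I = "ball x0 e" and lam = lam and mu = mu])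
    show "lin_op n (linearization f Y) (\<lambda>x. lam x ^ i / mu x) x = 0" if "i \<le> n" "x \<in> ball x0 e" for i x
    proof -
      have "x \<in> I" using that(2) e(2) by blast
      from lin[OF that(1) this] show ?thesis
        by (simp add: lin_op_def lin_p[OF that(2)] sum_negf del: funpow.simps)
    qed
    show "lam holomorphic_on ball x0 e" "mu holomorphic_on ball x0 e" "inj_on lam (ball x0 e)"
      using lam mu(1) e(2) by (auto intro: holomorphic_on_subset inj_on_subset)
    show "mu x \<noteq> 0" if "x \<in> ball x0 e" for x using that mu(2) e(2) by blast
  qed (use n k e in auto)
  then show ?thesis by (simp add: W_fun_def Y_def J(1))
qed

section \<open>Holomorphic maps\<close>

lemma holo_on_subset: "holo_on U f \<Longrightarrow> W \<subseteq> U \<Longrightarrow> holo_on W f"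
  unfolding holo_on_def by blast

lemma holo_on_local:
  assumes "\<And>x. x \<in> U \<Longrightarrow> \<exists>W h. open W \<and> x \<in> W \<and> holo_on W h \<and> (\<forall>y\<in>W. h y = f y)"
  shows "holo_on U f"
  unfolding holo_on_def
proof
  fix x assume "x \<in> U"
  then obtain W h where W: "open W" "x \<in> W" "holo_on W h" "\<forall>y\<in>W. h y = f y" using assms by blast
  then obtain h' where h': "(h has_derivative h') (at x)" "\<forall>c v. h' (c *\<^sub>C v) = c *\<^sub>C h' v"
    unfolding holo_on_def by blast
  have "(f has_derivative h') (at x)"
    using has_derivative_transform_within_open[OF h'(1) W(1,2)] W(4) by auto
  then show "\<exists>f'. (f has_derivative f') (at x) \<and> (\<forall>c v. f' (c *\<^sub>C v) = c *\<^sub>C f' v)"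
    using h'(2) by blast
qed

lemma holo_on_cong:
  assumes "open U" "holo_on U h" "\<And>x. x \<in> U \<Longrightarrow> h x = f x"
  shows "holo_on U f"
  using assms by (intro holo_on_local) blast

lemma holo_on_compose:
  assumes "holo_on U f" "holo_on W g" "\<And>x. x \<in> U \<Longrightarrow> f x \<in> W"
  shows "holo_on U (\<lambda>x. g (f x))"
  unfolding holo_on_def
proof
  fix x assume x: "x \<in> U"
  obtain f' where f': "(f has_derivative f') (at x)" "\<forall>c v. f' (c *\<^sub>C v) = c *\<^sub>C f' v"
    using assms(1) x unfolding holo_on_def by blast
  obtain g' where g': "(g has_derivative g') (at (f x))" "\<forall>c v. g' (c *\<^sub>C v) = c *\<^sub>C g' v"
    using assms(2,3) x unfolding holo_on_def by blast
  show "\<exists>f'. ((\<lambda>x. g (f x)) has_derivative f') (at x) \<and> (\<forall>c v. f' (c *\<^sub>C v) = c *\<^sub>C f' v)"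
    using has_derivative_compose[OF f'(1) g'(1)] f'(2) g'(2) by (intro exI[of _ "\<lambda>v. g' (f' v)"]) auto
qed

lemma holo_on_Pair:
  assumes "holo_on U f" "holo_on U g"
  shows "holo_on U (\<lambda>x. (f x, g x))"
  unfolding holo_on_def
proof
  fix x assume x: "x \<in> U"
  obtain f' where f': "(f has_derivative f') (at x)" "\<forall>c v. f' (c *\<^sub>C v) = c *\<^sub>C f' v"
    using assms(1) x unfolding holo_on_def by blast
  obtain g' where g': "(g has_derivative g') (at x)" "\<forall>c v. g' (c *\<^sub>C v) = c *\<^sub>C g' v"
    using assms(2) x unfolding holo_on_def by blast
  show "\<exists>f'. ((\<lambda>x. (f x, g x)) has_derivative f') (at x) \<and> (\<forall>c v. f' (c *\<^sub>C v) = c *\<^sub>C f' v)"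
    using has_derivative_Pair[OF f'(1) g'(1)] f'(2) g'(2)
    by (intro exI[of _ "\<lambda>v. (f' v, g' v)"]) (auto simp: scaleC_prod_def)
qed

lemma holo_on_clinear:
  assumes "bounded_linear f" "\<And>c v. f (c *\<^sub>C v) = c *\<^sub>C f v"
  shows "holo_on U f"
  unfolding holo_on_def using bounded_linear_imp_has_derivative[OF assms(1)] assms(2) by blast

lemma holo_on_fst: "holo_on U f \<Longrightarrow> holo_on U (\<lambda>x. fst (f x))"
  by (rule holo_on_compose[where W = UNIV])
     (auto intro!: holo_on_clinear bounded_linear_fst simp: scaleC_prod_def)

lemma holo_on_snd: "holo_on U f \<Longrightarrow> holo_on U (\<lambda>x. snd (f x))"
  by (rule holo_on_compose[where W = UNIV])
     (auto intro!: holo_on_clinear bounded_linear_snd simp: scaleC_prod_def)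

lemma holo_on_continuous_on: "holo_on U f \<Longrightarrow> continuous_on U f"
  unfolding holo_on_def
  by (meson continuous_at_imp_continuous_on has_derivative_continuous)

lemma holo_on_holomorphic:
  assumes "holo_on U (f :: complex \<Rightarrow> complex)"
  shows "f holomorphic_on U"
  unfolding holomorphic_on_def
proof
  fix x assume "x \<in> U"
  then obtain f' where f': "(f has_derivative f') (at x)" "\<forall>c v. f' (c *\<^sub>C v) = c *\<^sub>C f' v"
    using assms unfolding holo_on_def by blast
  have "f' = (*) (f' 1)"
  proof
    fix h show "f' h = f' 1 * h" using f'(2)[rule_format, of h 1] by (simp add: scaleC_complex_def)
  qed
  then show "f field_differentiable at x within U"
    using f'(1) unfolding field_differentiable_def has_field_derivative_def
    by (metis has_derivative_at_withinI)
qed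

lemma holomorphic_holo_on:
  assumes "open U" "(f :: complex \<Rightarrow> complex) holomorphic_on U"
  shows "holo_on U f"
  unfolding holo_on_def
proof
  fix x assume "x \<in> U"
  then have "(f has_derivative (\<lambda>h. deriv f x * h)) (at x)"
    using assms holomorphic_derivI[of f U x] by (simp add: has_field_derivative_def)
  then show "\<exists>f'. (f has_derivative f') (at x) \<and> (\<forall>c v. f' (c *\<^sub>C v) = c *\<^sub>C f' v)"
    by (intro exI[of _ "\<lambda>h. deriv f x * h"]) (auto simp: scaleC_complex_def)
qed

text \<open>The pointwise form of \<open>holo_on\<close>, for chain rules at a single point of a
  chart.\<close>

definition cdiff :: "('a::complex_normed \<Rightarrow> 'b::complex_normed) \<Rightarrow> 'a \<Rightarrow> bool" where
  "cdiff f x \<longleftrightarrow> (\<exists>f'. (f has_derivative f') (at x) \<and> (\<forall>c v. f' (c *\<^sub>C v) = c *\<^sub>C f' v))"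

lemma holo_on_cdiff: "holo_on U f \<longleftrightarrow> (\<forall>x\<in>U. cdiff f x)"
  unfolding holo_on_def cdiff_def ..

lemma cdiffD:
  assumes "cdiff f x"
  shows "(f has_derivative frechet_derivative f (at x)) (at x)"
    "frechet_derivative f (at x) (c *\<^sub>C v) = c *\<^sub>C frechet_derivative f (at x) v"
    "frechet_derivative f (at x) (v + w) = frechet_derivative f (at x) v + frechet_derivative f (at x) w"
    "frechet_derivative f (at x) 0 = 0"
proof -
  obtain f' where f': "(f has_derivative f') (at x)" "\<forall>c v. f' (c *\<^sub>C v) = c *\<^sub>C f' v"
    using assms unfolding cdiff_def by blast
  have e: "f' = frechet_derivative f (at x)" by (rule frechet_derivative_at[OF f'(1)])
  interpret bounded_linear f' using f'(1) by (rule has_derivative_bounded_linear)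
  show "(f has_derivative frechet_derivative f (at x)) (at x)"
    "frechet_derivative f (at x) (c *\<^sub>C v) = c *\<^sub>C frechet_derivative f (at x) v"
    "frechet_derivative f (at x) (v + w) = frechet_derivative f (at x) v + frechet_derivative f (at x) w"
    "frechet_derivative f (at x) 0 = 0"
    unfolding e[symmetric] using f' add zero by auto
qed

text \<open>The composition is asked to agree with h only near x, because expressions with
  \<open>chart_inv\<close> can be factored through another chart only on the overlap.\<close>

lemma cdiff_compose_local:
  assumes "cdiff f x" "cdiff g (f x)" "open W" "x \<in> W" "\<And>y. y \<in> W \<Longrightarrow> h y = g (f y)"
  shows "cdiff h x"
    "frechet_derivative h (at x) v = frechet_derivative g (at (f x)) (frechet_derivative f (at x) v)"
proof -
  let ?h = "\<lambda>v. frechet_derivative g (at (f x)) (frechet_derivative f (at x) v)"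
  have "((\<lambda>y. g (f y)) has_derivative ?h) (at x)"
    using has_derivative_compose[OF cdiffD(1)[OF assms(1)] cdiffD(1)[OF assms(2)]] .
  then have h: "(h has_derivative ?h) (at x)"
    using has_derivative_transform_within_open[OF _ assms(3,4)] assms(5) by (metis (no_types, lifting))
  then show "cdiff h x"
    unfolding cdiff_def using cdiffD(2)[OF assms(1)] cdiffD(2)[OF assms(2)] by (intro exI[of _ ?h]) auto
  show "frechet_derivative h (at x) v = ?h v"
    unfolding frechet_derivative_at[OF h, symmetric] ..
qed

lemma cdiff_cong_local:
  assumes "cdiff f x" "open W" "x \<in> W" "\<And>y. y \<in> W \<Longrightarrow> h y = f y"
  shows "cdiff h x" "frechet_derivative h (at x) = frechet_derivative f (at x)"
proof -
  have h: "(h has_derivative frechet_derivative f (at x)) (at x)"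
    using has_derivative_transform_within_open[OF cdiffD(1)[OF assms(1)] assms(2,3)] assms(4) by auto
  then show "cdiff h x" unfolding cdiff_def using cdiffD(2)[OF assms(1)] by blast
  show "frechet_derivative h (at x) = frechet_derivative f (at x)"
    using frechet_derivative_at[OF h] by simp
qed

section \<open>Charts and tangent vectors\<close>

lemma chart_facts:
  assumes "is_chart c"
  shows "open (fst c)" "open (snd c ` fst c)" "continuous_on (fst c) (snd c)"
    "continuous_on (snd c ` fst c) (chart_inv c)"
    "\<And>p. p \<in> fst c \<Longrightarrow> chart_inv c (snd c p) = p"
    "\<And>x. x \<in> snd c ` fst c \<Longrightarrow> chart_inv c x \<in> fst c"
    "\<And>x. x \<in> snd c ` fst c \<Longrightarrow> snd c (chart_inv c x) = x"
  using assms unfolding is_chart_def homeomorphism_def by auto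

lemma chart_image_eq:
  assumes "is_chart c"
  shows "snd c ` (fst c \<inter> W) = snd c ` fst c \<inter> chart_inv c -` W"
  using chart_facts(5-7)[OF assms] by (auto simp: image_iff)

lemma open_chart_image:
  assumes "is_chart c" "open W"
  shows "open (snd c ` (fst c \<inter> W))"
  unfolding chart_image_eq[OF assms(1)]
  using continuous_open_preimage[OF chart_facts(4,2)[OF assms(1)] assms(2)] .

lemma complex_atlasD:
  assumes "complex_atlas A"
  shows "\<And>c. c \<in> A \<Longrightarrow> is_chart c" "\<And>p. \<exists>c\<in>A. p \<in> fst c" "A \<subseteq> max_atlas A"
    "\<And>d. d \<in> max_atlas A \<Longrightarrow> is_chart d"
  using assms unfolding complex_atlas_def max_atlas_def by auto

definition transition :: "('p, 'e::complex_normed) chart \<Rightarrow> ('p, 'e) chart \<Rightarrow> 'p \<Rightarrow> 'e \<Rightarrow> 'e" where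
  "transition c d p = frechet_derivative (snd d \<circ> chart_inv c) (at (snd c p))"

lemma cdiff_transition:
  assumes "compatible c d" "p \<in> fst c" "p \<in> fst d"
  shows "cdiff (snd d \<circ> chart_inv c) (snd c p)" "cdiff (snd c \<circ> chart_inv d) (snd d p)"
  using assms unfolding compatible_def holo_on_cdiff by blast+

text \<open>The cocycle condition of the tangent bundle. Only the pairs (c, d) and (d, e) are
  assumed compatible, so that charts of the maximal atlas may take part.\<close>

lemma transition_compose:
  fixes c d e :: "('p::topological_space, 'e::complex_normed) chart"
  assumes ch: "is_chart c" "is_chart d" and comp: "compatible c d" "compatible d e"
    and p: "p \<in> fst c" "p \<in> fst d" "p \<in> fst e"
  shows "transition d e p (transition c d p v) = transition c e p v"
proof -
  have "frechet_derivative (snd e \<circ> chart_inv c) (at (snd c p)) v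
      = frechet_derivative (snd e \<circ> chart_inv d) (at ((snd d \<circ> chart_inv c) (snd c p)))
          (frechet_derivative (snd d \<circ> chart_inv c) (at (snd c p)) v)"
  proof (rule cdiff_compose_local(2)[where W = "snd c ` (fst c \<inter> fst d)"])
    show "cdiff (snd e \<circ> chart_inv d) ((snd d \<circ> chart_inv c) (snd c p))"
      using cdiff_transition(1)[OF comp(2) p(2,3)] chart_facts(5)[OF ch(1) p(1)] by simp
    show "open (snd c ` (fst c \<inter> fst d))" using open_chart_image ch chart_facts(1) by blast
    show "(snd e \<circ> chart_inv c) y = (snd e \<circ> chart_inv d) ((snd d \<circ> chart_inv c) y)"
      if "y \<in> snd c ` (fst c \<inter> fst d)" for y
      using that chart_facts(5)[OF ch(1)] chart_facts(5)[OF ch(2)] by auto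
    show "cdiff (snd d \<circ> chart_inv c) (snd c p)" by (rule cdiff_transition(1)[OF comp(1) p(1,2)])
    show "snd c p \<in> snd c ` (fst c \<inter> fst d)" using p by blast
  qed
  then show ?thesis
    unfolding transition_def using chart_facts(5)[OF ch(1) p(1)] by simp
qed

lemma transition_self:
  fixes c :: "('p::topological_space, 'e::complex_normed) chart"
  assumes "is_chart c" "p \<in> fst c"
  shows "transition c c p v = v"
proof -
  have "cdiff (\<lambda>x. x) (snd c p)" unfolding cdiff_def by (intro exI[of _ "\<lambda>x. x"]) auto
  then have "frechet_derivative (snd c \<circ> chart_inv c) (at (snd c p)) = frechet_derivative (\<lambda>x. x) (at (snd c p))"
    using chart_facts[OF assms(1)] assms(2) by (intro cdiff_cong_local(2)[where W = "snd c ` fst c"]) auto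
  then show ?thesis
    by (metis frechet_derivative_at has_derivative_ident transition_def)
qed

text \<open>The tangent vector at \<open>p\<close> whose component in the chart \<open>d\<close> of the maximal atlas is \<open>v\<close>.\<close>

definition tlift :: "('p, 'e::complex_normed) chart set \<Rightarrow> ('p, 'e) chart \<Rightarrow> 'p \<Rightarrow> 'e \<Rightarrow> ('p, 'e) tvec" where
  "tlift A d p v = (\<lambda>c. if c \<in> A \<and> p \<in> fst c then transition d c p v else 0)"

context
  fixes A :: "('p::topological_space, 'e::complex_normed) chart set" and d :: "('p, 'e) chart" and p :: 'p
  assumes A: "complex_atlas A" and d: "d \<in> max_atlas A" and p: "p \<in> fst d"
begin

lemma max_atlas_compatible:
  shows "c \<in> A \<Longrightarrow> compatible d c" "c \<in> A \<Longrightarrow> compatible c d" "c \<in> A \<Longrightarrow> c' \<in> A \<Longrightarrow> compatible c c'"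
proof -
  show dc: "compatible d c" if "c \<in> A" for c using d that unfolding max_atlas_def by blast
  show "compatible c d" if "c \<in> A" using dc[OF that] by (simp add: compatible_def Int_commute)
  show "compatible c c'" if "c \<in> A" "c' \<in> A" using A that unfolding complex_atlas_def by blast
qed

lemma max_atlas_is_chart: "is_chart d" "c \<in> A \<Longrightarrow> is_chart c"
  using A d unfolding complex_atlas_def max_atlas_def by auto

lemma tlift_add: "tlift A d p (v + w) = (\<lambda>c. tlift A d p v c + tlift A d p w c)"
  using cdiffD(3)[OF cdiff_transition(1)[OF max_atlas_compatible(1) p]] by (auto simp: tlift_def transition_def fun_eq_iff)

lemma tlift_scaleC: "tlift A d p (k *\<^sub>C v) = (\<lambda>c. k *\<^sub>C tlift A d p v c)"
  using cdiffD(2)[OF cdiff_transition(1)[OF max_atlas_compatible(1) p]] by (auto simp: tlift_def transition_def fun_eq_iff)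

lemma tlift_tangent: "tlift A d p v \<in> tangent_space A p"
  unfolding tangent_space_def
proof (intro CollectI conjI ballI allI impI)
  fix c c' assume "c \<in> A" "c' \<in> A" "p \<in> fst c \<and> p \<in> fst c'"
  then show "tlift A d p v c' = frechet_derivative (snd c' \<circ> chart_inv c) (at (snd c p)) (tlift A d p v c)"
    using transition_compose[of d c c' p v] max_atlas_is_chart max_atlas_compatible p by (simp add: tlift_def transition_def)
qed (auto simp: tlift_def)

lemma tangent_eq_tlift:
  assumes "\<xi> \<in> tangent_space A p" "c \<in> A" "p \<in> fst c"
  shows "\<xi> = tlift A d p (transition c d p (\<xi> c))"
proof
  fix c'
  have "\<xi> c' = transition c c' p (\<xi> c)" if "c' \<in> A" "p \<in> fst c'"
    using assms that unfolding tangent_space_def transition_def by blast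
  moreover have "\<xi> c' = 0" if "\<not> (c' \<in> A \<and> p \<in> fst c')"
    using assms that unfolding tangent_space_def by blast
  ultimately show "\<xi> c' = tlift A d p (transition c d p (\<xi> c)) c'"
    using transition_compose[of c d c' p "\<xi> c"] max_atlas_is_chart max_atlas_compatible p assms(2,3) by (auto simp: tlift_def)
qed

lemma tlift_component:
  assumes "c \<in> A" "p \<in> fst c"
  shows "transition c d p (tlift A d p v c) = v"
  using transition_compose[of d c d p v] transition_self[of d p v] max_atlas_is_chart max_atlas_compatible p assms
  by (simp add: tlift_def)

lemma tlift_inject: "tlift A d p v = tlift A d p w \<longleftrightarrow> v = w"
proof
  assume eq: "tlift A d p v = tlift A d p w"
  obtain c where c: "c \<in> A" "p \<in> fst c" using complex_atlasD(2)[OF A] by blast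
  show "v = w" using tlift_component[OF c, of v] tlift_component[OF c, of w] unfolding eq by simp
qed simp

lemma tangent_tlift_ex:
  assumes "\<xi> \<in> tangent_space A p"
  shows "\<exists>v. \<xi> = tlift A d p v"
proof -
  obtain c where c: "c \<in> A" "p \<in> fst c" using complex_atlasD(2)[OF A] by blast
  show ?thesis using tangent_eq_tlift[OF assms c] by (rule exI)
qed

end

lemma tlift_self:
  assumes "complex_atlas A" "d \<in> A" "p \<in> fst d"
  shows "tlift A d p v d = v"
  using transition_self[of d p v] complex_atlasD(1)[OF assms(1,2)] assms(2,3) by (simp add: tlift_def)

text \<open>\<open>pushforward\<close> computes in a source chart picked by a choice operator and
  yields components in the charts of the atlas only. Here the source chart is arbitrary and the
  target chart may come from the maximal atlas.\<close>

lemma pushforward_eq_tlift: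
  fixes A :: "('p::topological_space, 'e::complex_normed) chart set"
    and B :: "('q::topological_space, 'f::complex_normed) chart set"
  assumes at: "complex_atlas A" "complex_atlas B" and c: "c \<in> A" "p \<in> fst c"
    and d: "d \<in> max_atlas B" "g p \<in> fst d"
    and V: "open V" "p \<in> V" "continuous_on V g" and g: "cdiff (snd d \<circ> g \<circ> chart_inv c) (snd c p)"
    and \<tau>: "\<tau> \<in> tangent_space A p"
  shows "pushforward A B g p \<tau> = tlift B d (g p) (frechet_derivative (snd d \<circ> g \<circ> chart_inv c) (at (snd c p)) (\<tau> c))"
proof
  fix e
  define c0 where "c0 = (SOME c. c \<in> A \<and> p \<in> fst c)"
  have "c0 \<in> A \<and> p \<in> fst c0" unfolding c0_def by (rule someI[of "\<lambda>c. c \<in> A \<and> p \<in> fst c" c]) (simp add: c)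
  then have c0: "c0 \<in> A" "p \<in> fst c0" by auto
  note ch = complex_atlasD(1)[OF at(1)] and dch = complex_atlasD(4)[OF at(2) d(1)]
  show "pushforward A B g p \<tau> e = tlift B d (g p) (frechet_derivative (snd d \<circ> g \<circ> chart_inv c) (at (snd c p)) (\<tau> c)) e"
  proof (cases "e \<in> B \<and> g p \<in> fst e")
    case True
    have tc: "compatible c0 c" using at(1) c c0 unfolding complex_atlas_def by blast
    have de: "compatible d e" using d(1) True unfolding max_atlas_def by blast
    have \<tau>c: "\<tau> c = frechet_derivative (snd c \<circ> chart_inv c0) (at (snd c0 p)) (\<tau> c0)"
      using \<tau> c c0 unfolding tangent_space_def by blast
    define W where "W = V \<inter> g -` fst d"
    have W: "open W" "p \<in> W"
      unfolding W_def using continuous_open_preimage[OF V(3,1) chart_facts(1)[OF dch]] V(2) d(2)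
      by (auto simp: vimage_def Int_def)
    let ?N = "snd c0 ` (fst c0 \<inter> (fst c \<inter> W))"
    have N: "open ?N" "snd c0 p \<in> ?N"
      using W c c0 chart_facts(1)[OF ch[OF c(1)]] by (auto intro!: open_chart_image ch)
    have inner: "cdiff (snd d \<circ> g \<circ> chart_inv c0) (snd c0 p)"
      "frechet_derivative (snd d \<circ> g \<circ> chart_inv c0) (at (snd c0 p)) v =
         frechet_derivative (snd d \<circ> g \<circ> chart_inv c) (at ((snd c \<circ> chart_inv c0) (snd c0 p)))
           (frechet_derivative (snd c \<circ> chart_inv c0) (at (snd c0 p)) v)" for v
    proof -
      have a: "cdiff (snd c \<circ> chart_inv c0) (snd c0 p)" using cdiff_transition(1)[OF tc c0(2) c(2)] .
      have b: "cdiff (snd d \<circ> g \<circ> chart_inv c) ((snd c \<circ> chart_inv c0) (snd c0 p))"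
        using g chart_facts(5)[OF ch[OF c0(1)] c0(2)] by simp
      have eq: "(snd d \<circ> g \<circ> chart_inv c0) y = (snd d \<circ> g \<circ> chart_inv c) ((snd c \<circ> chart_inv c0) y)"
        if "y \<in> ?N" for y
        using that chart_facts(5)[OF ch[OF c0(1)]] chart_facts(5)[OF ch[OF c(1)]] by auto
      show "cdiff (snd d \<circ> g \<circ> chart_inv c0) (snd c0 p)"
        by (rule cdiff_compose_local(1)[OF a b N eq])
      show "frechet_derivative (snd d \<circ> g \<circ> chart_inv c0) (at (snd c0 p)) v =
         frechet_derivative (snd d \<circ> g \<circ> chart_inv c) (at ((snd c \<circ> chart_inv c0) (snd c0 p)))
           (frechet_derivative (snd c \<circ> chart_inv c0) (at (snd c0 p)) v)"
        by (rule cdiff_compose_local(2)[OF a b N eq])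
    qed
    have "frechet_derivative (snd e \<circ> g \<circ> chart_inv c0) (at (snd c0 p)) v =
       frechet_derivative (snd e \<circ> chart_inv d) (at ((snd d \<circ> g \<circ> chart_inv c0) (snd c0 p)))
          (frechet_derivative (snd d \<circ> g \<circ> chart_inv c0) (at (snd c0 p)) v)" for v
    proof (rule cdiff_compose_local(2)[OF inner(1) _ N])
      show "cdiff (snd e \<circ> chart_inv d) ((snd d \<circ> g \<circ> chart_inv c0) (snd c0 p))"
        using cdiff_transition(1)[OF de d(2)] True chart_facts(5)[OF ch[OF c0(1)] c0(2)] by simp
      show "(snd e \<circ> g \<circ> chart_inv c0) y = (snd e \<circ> chart_inv d) ((snd d \<circ> g \<circ> chart_inv c0) y)" if "y \<in> ?N" for y
        using that chart_facts(5)[OF ch[OF c0(1)]] chart_facts(5)[OF dch] by (auto simp: W_def)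
    qed
    then show ?thesis
      using True \<tau>c inner(2)[of "\<tau> c0"] chart_facts(5)[OF ch[OF c0(1)] c0(2)]
      by (simp add: pushforward_def tlift_def transition_def c0_def[symmetric] Let_def)
  next
    case False
    then show ?thesis unfolding pushforward_def tlift_def Let_def by (simp only: if_False)
  qed
qed

section \<open>Derivatives along holomorphic vector fields\<close>

lemma bounded_bilinear_scaleC: "bounded_bilinear (\<lambda>c v. c *\<^sub>C (v :: 'a::complex_normed))"
proof
  show "(r *\<^sub>R c) *\<^sub>C v = r *\<^sub>R c *\<^sub>C v" for r c and v :: 'a
    by (simp add: scaleR_conv_of_real scaleC_scaleC[symmetric] scaleC_of_real)
  show "c *\<^sub>C (r *\<^sub>R v) = r *\<^sub>R c *\<^sub>C v" for r c and v :: 'a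
    by (simp add: scaleC_of_real[symmetric] scaleC_scaleC mult.commute)
  show "\<exists>K. \<forall>c (v :: 'a). norm (c *\<^sub>C v) \<le> norm c * norm v * K"
    by (intro exI[of _ 1]) (simp add: norm_scaleC)
qed (simp_all add: scaleC_add_left scaleC_add_right)

lemma bounded_linear_scaleC_right: "bounded_linear (\<lambda>v. c *\<^sub>C (v :: 'a::complex_normed))"
  by (rule bounded_bilinear.bounded_linear_right[OF bounded_bilinear_scaleC])

lemma holo_on_scaleC:
  assumes "holo_on U v"
  shows "holo_on U (\<lambda>x. c *\<^sub>C v x)"
  by (rule holo_on_compose[OF assms, where W = UNIV])
     (auto intro!: holo_on_clinear bounded_linear_scaleC_right simp: scaleC_scaleC mult.commute)

lemma holo_on_add:
  assumes "holo_on U f" "holo_on U g"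
  shows "holo_on U (\<lambda>x. f x + g x)"
  using holo_on_compose[OF holo_on_Pair[OF assms], where W = UNIV and g = "\<lambda>p. fst p + snd p"]
  by (simp add: holo_on_clinear bounded_linear_add bounded_linear_fst bounded_linear_snd
      scaleC_prod_def scaleC_add_right)

lemma holo_on_line': "holo_on UNIV (\<lambda>t. q + t *\<^sub>C w)"
  unfolding holo_on_def
  by (intro ballI exI[of _ "\<lambda>h. h *\<^sub>C w"]) (auto simp: has_derivative_line scaleC_scaleC scaleC_complex_def)

text \<open>The pairs (t, s) with \<gamma> s + t v s in U form an open set containing (0, s0), so a
  product of discs fits into it. This reduces statements about T to the two-variable theory.\<close>

lemma holo2_along:
  fixes T :: "'e::complex_normed \<Rightarrow> complex"
  assumes T: "open U" "holo_on U T" and S: "open S" "holo_on S \<gamma>" "holo_on S v" "s0 \<in> S" "\<gamma> s0 \<in> U"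
  obtains \<epsilon> r where "\<epsilon> > 0" "r > 0" "ball s0 r \<subseteq> S"
    "\<And>t s. t \<in> ball 0 \<epsilon> \<Longrightarrow> s \<in> ball s0 r \<Longrightarrow> \<gamma> s + t *\<^sub>C v s \<in> U"
    "holo2 (ball 0 \<epsilon>) (ball s0 r) (\<lambda>t s. T (\<gamma> s + t *\<^sub>C v s))"
proof -
  define \<kappa> where "\<kappa> = (\<lambda>p. \<gamma> (snd p) + fst p *\<^sub>C v (snd p))"
  have cont: "continuous_on (UNIV \<times> S) \<kappa>"
    unfolding \<kappa>_def
    by (intro continuous_on_add bounded_bilinear.continuous_on[OF bounded_bilinear_scaleC]
        continuous_on_compose2[OF holo_on_continuous_on[OF S(2)]] continuous_on_compose2[OF holo_on_continuous_on[OF S(3)]]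
        continuous_intros) auto
  have "open (\<kappa> -` U \<inter> (UNIV \<times> S))"
    using continuous_on_open_vimage[of "UNIV \<times> S" \<kappa>] cont T(1) S(1) by (auto simp: open_Times)
  moreover have "(0, s0) \<in> \<kappa> -` U \<inter> (UNIV \<times> S)" using S(4,5) by (simp add: \<kappa>_def)
  ultimately obtain A B where AB: "open A" "open B" "(0, s0) \<in> A \<times> B" "A \<times> B \<subseteq> \<kappa> -` U \<inter> (UNIV \<times> S)"
    by (rule open_prod_elim)
  obtain \<epsilon> where \<epsilon>: "\<epsilon> > 0" "ball 0 \<epsilon> \<subseteq> A" using AB openE[of A 0] by auto
  obtain r where r: "r > 0" "ball s0 r \<subseteq> B" using AB openE[of B s0] by auto
  have sub: "s \<in> S" "\<gamma> s + t *\<^sub>C v s \<in> U" if "t \<in> ball 0 \<epsilon>" "s \<in> ball s0 r" for t s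
  proof -
    have "(t, s) \<in> A \<times> B" using that \<epsilon> r by blast
    then have "(t, s) \<in> \<kappa> -` U \<inter> (UNIV \<times> S)" using AB(4) by blast
    then show "s \<in> S" "\<gamma> s + t *\<^sub>C v s \<in> U" by (auto simp: \<kappa>_def)
  qed
  have rS: "ball s0 r \<subseteq> S" using sub(1)[of 0] \<epsilon>(1) by auto
  have "holo2 (ball 0 \<epsilon>) (ball s0 r) (\<lambda>t s. T (\<gamma> s + t *\<^sub>C v s))"
    unfolding holo2_def
  proof (intro conjI ballI)
    have "continuous_on (ball 0 \<epsilon> \<times> ball s0 r) (\<lambda>p. T (\<kappa> p))"
      by (rule continuous_on_compose2[OF holo_on_continuous_on[OF T(2)] continuous_on_subset[OF cont]])
         (use sub rS in \<open>auto simp: \<kappa>_def\<close>)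
    then show "continuous_on (ball 0 \<epsilon> \<times> ball s0 r) (\<lambda>(t, s). T (\<gamma> s + t *\<^sub>C v s))"
      by (simp add: \<kappa>_def case_prod_unfold)
    show "(\<lambda>t. T (\<gamma> s + t *\<^sub>C v s)) holomorphic_on ball 0 \<epsilon>" if "s \<in> ball s0 r" for s
      using sub that by (intro holo_on_holomorphic holo_on_compose[OF holo_on_subset[OF holo_on_line'] T(2)]) auto
    show "(\<lambda>s. T (\<gamma> s + t *\<^sub>C v s)) holomorphic_on ball s0 r" if "t \<in> ball 0 \<epsilon>" for t
      using sub that rS
      by (intro holo_on_holomorphic holo_on_compose[OF _ T(2), of _ "\<lambda>s. \<gamma> s + t *\<^sub>C v s"] holo_on_add holo_on_scaleC)
         (auto intro: holo_on_subset S)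
  qed
  then show thesis using that \<epsilon>(1) r(1) rS sub(2) by blast
qed

lemma d1_along:
  fixes T :: "'e::complex_normed \<Rightarrow> complex"
  assumes "holo_on U T" "\<gamma> s \<in> U"
  shows "d1 (\<lambda>t s. T (\<gamma> s + t *\<^sub>C v s)) 0 s = frechet_derivative T (at (\<gamma> s)) (v s)"
  unfolding d1_def
proof (rule DERIV_imp_deriv)
  have c: "cdiff T (\<gamma> s + 0 *\<^sub>C v s)" using assms by (simp add: holo_on_cdiff)
  show "((\<lambda>t. T (\<gamma> s + t *\<^sub>C v s)) has_field_derivative frechet_derivative T (at (\<gamma> s)) (v s)) (at 0)"
    using has_field_derivative_along[OF cdiffD(1)[OF c] cdiffD(2)[OF c] has_derivative_line] by simp
qed

text \<open>That the derivative depends holomorphically on its point is not part of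
  \<open>holo_on\<close>. It follows because the derivative in the direction v s is the t-derivative
  at 0 of T (\<gamma> s + t v s), and \<open>d1\<close> preserves \<open>holo2\<close>.\<close>

lemma holomorphic_derivative_along:
  fixes T :: "'e::complex_normed \<Rightarrow> complex"
  assumes T: "open U" "holo_on U T" and S: "open S" "holo_on S \<gamma>" "holo_on S v" "\<And>s. s \<in> S \<Longrightarrow> \<gamma> s \<in> U"
  shows "(\<lambda>s. frechet_derivative T (at (\<gamma> s)) (v s)) holomorphic_on S"
proof -
  have "(\<lambda>s. frechet_derivative T (at (\<gamma> s)) (v s)) field_differentiable at s0" if s0: "s0 \<in> S" for s0
  proof -
    obtain \<epsilon> r where r: "\<epsilon> > 0" "r > 0" "ball s0 r \<subseteq> S"
      and H: "holo2 (ball 0 \<epsilon>) (ball s0 r) (\<lambda>t s. T (\<gamma> s + t *\<^sub>C v s))"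
      by (rule holo2_along[OF T S(1-3) s0 S(4)[OF s0]]) (rule that; assumption)
    have "d1 (\<lambda>t s. T (\<gamma> s + t *\<^sub>C v s)) 0 holomorphic_on ball s0 r"
      using holo2_d1[OF H] r(1) by (simp add: holo2_def)
    then have "(\<lambda>s. frechet_derivative T (at (\<gamma> s)) (v s)) holomorphic_on ball s0 r"
      by (rule holomorphic_transform) (use r(3) S(4) d1_along[OF T(2)] in blast)
    then show ?thesis using r(2) holomorphic_on_imp_differentiable_at by (metis centre_in_ball open_ball)
  qed
  then show ?thesis unfolding holomorphic_on_def by (blast intro: field_differentiable_at_within)
qed

lemma cdiff_fst:
  assumes "cdiff T x"
  shows "frechet_derivative (\<lambda>y. fst (T y)) (at x) v = fst (frechet_derivative T (at x) v)"
    "frechet_derivative (\<lambda>y. snd (T y)) (at x) v = snd (frechet_derivative T (at x) v)"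
  using frechet_derivative_at[OF has_derivative_fst[OF cdiffD(1)[OF assms]]]
    frechet_derivative_at[OF has_derivative_snd[OF cdiffD(1)[OF assms]]] by metis+

lemma holo_on_derivative_along:
  fixes T :: "'e::complex_normed \<Rightarrow> complex \<times> complex" and S :: "complex set"
  assumes T: "open U" "holo_on U T" and S: "open S" "holo_on S \<gamma>" "holo_on S v" "\<And>s. s \<in> S \<Longrightarrow> \<gamma> s \<in> U"
  shows "holo_on S (\<lambda>s. frechet_derivative T (at (\<gamma> s)) (v s))"
proof -
  have c: "cdiff T (\<gamma> s)" if "s \<in> S" for s using T(2) S(4)[OF that] by (simp add: holo_on_cdiff)
  have "(\<lambda>s. frechet_derivative (\<lambda>y. fst (T y)) (at (\<gamma> s)) (v s)) holomorphic_on S"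
    by (rule holomorphic_derivative_along[OF T(1) holo_on_fst[OF T(2)] S])
  moreover have "(\<lambda>s. frechet_derivative (\<lambda>y. snd (T y)) (at (\<gamma> s)) (v s)) holomorphic_on S"
    by (rule holomorphic_derivative_along[OF T(1) holo_on_snd[OF T(2)] S])
  ultimately have "holo_on S (\<lambda>s. (frechet_derivative (\<lambda>y. fst (T y)) (at (\<gamma> s)) (v s), frechet_derivative (\<lambda>y. snd (T y)) (at (\<gamma> s)) (v s)))"
    using S(1) by (intro holo_on_Pair holomorphic_holo_on)
  then show ?thesis
    by (rule holo_on_cong[OF S(1)]) (simp add: cdiff_fst[OF c])
qed

section \<open>The projective line\<close>

abbreviation "cp1_fin \<equiv> (range Fin, \<lambda>p. case p of Fin z \<Rightarrow> z | Infty \<Rightarrow> 0)"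
abbreviation "cp1_inf \<equiv> (- {Fin 0}, \<lambda>p. case p of Fin z \<Rightarrow> 1 / z | Infty \<Rightarrow> 0)"

lemma cp1_range: "range Fin = - {Infty}" "range Fin_inverse = - {Fin 0}"
proof -
  show "range Fin = - {Infty}" by (auto simp: image_iff) (metis cp1.exhaust)
  have "p \<in> range Fin_inverse" if "p \<noteq> Fin 0" for p
    using that by (cases p) (auto simp: Fin_inverse_def image_iff intro: exI[of _ "1 / z" for z])
  then show "range Fin_inverse = - {Fin 0}" by (auto simp: Fin_inverse_def)
qed

lemma cp1_chart_inv: "chart_inv cp1_fin s = Fin s" "chart_inv cp1_inf s = Fin_inverse s"
proof -
  have "inj_on (\<lambda>p. case p of Fin z \<Rightarrow> z | Infty \<Rightarrow> 0) (range Fin)" by (auto simp: inj_on_def)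
  then show "chart_inv cp1_fin s = Fin s"
    unfolding chart_inv_def by (intro inv_into_f_eq) auto
  have "inj_on (\<lambda>p. case p of Fin z \<Rightarrow> 1 / z | Infty \<Rightarrow> 0) (- {Fin 0})"
    by (auto simp: inj_on_def split: cp1.splits)
  then show "chart_inv cp1_inf s = Fin_inverse s"
    unfolding chart_inv_def by (intro inv_into_f_eq) (auto simp: Fin_inverse_def)
qed

lemma cp1_chart_inv': "c \<in> cp1_atlas \<Longrightarrow> chart_inv c s \<in> fst c" "c \<in> cp1_atlas \<Longrightarrow> snd c (chart_inv c s) = s"
  "c \<in> cp1_atlas \<Longrightarrow> z \<in> fst c \<Longrightarrow> chart_inv c (snd c z) = z" "c \<in> cp1_atlas \<Longrightarrow> snd c ` fst c = UNIV"
proof -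
  show a: "chart_inv c s \<in> fst c" "snd c (chart_inv c s) = s" if "c \<in> cp1_atlas" for s
    using that by (auto simp: cp1_atlas_def cp1_chart_inv Fin_inverse_def)
  show "chart_inv c (snd c z) = z" if "c \<in> cp1_atlas" "z \<in> fst c"
    using that by (auto simp: cp1_atlas_def cp1_chart_inv Fin_inverse_def split: cp1.splits)
  show "snd c ` fst c = UNIV" if "c \<in> cp1_atlas"
    using a[OF that] by (metis UNIV_eq_I image_eqI)
qed

text \<open>With c and c' the two affine charts in either order, the coordinates are reciprocal and
  the point missing from c is the origin of c'. This symmetry saves all later distinctions between
  the charts.\<close>

lemma cp1_other_chart:
  assumes "c \<in> cp1_atlas" "c' \<in> cp1_atlas" "c \<noteq> c'"
  shows "s \<noteq> 0 \<Longrightarrow> chart_inv c' s = chart_inv c (1 / s)" "fst c = - {chart_inv c' 0}"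
proof -
  consider "c = cp1_fin" "c' = cp1_inf" | "c = cp1_inf" "c' = cp1_fin"
    using assms unfolding cp1_atlas_def by blast
  then have "(s \<noteq> 0 \<longrightarrow> chart_inv c' s = chart_inv c (1 / s)) \<and> fst c = - {chart_inv c' 0}"
  proof cases
    case 1
    then show ?thesis by (simp only: cp1_chart_inv) (simp add: Fin_inverse_def cp1_range)
  next
    case 2
    then show ?thesis by (simp only: cp1_chart_inv) (simp add: Fin_inverse_def)
  qed
  then show "s \<noteq> 0 \<Longrightarrow> chart_inv c' s = chart_inv c (1 / s)" "fst c = - {chart_inv c' 0}" by blast+
qed

lemma cp1_eq_iff:
  assumes "c \<in> cp1_atlas" "c' \<in> cp1_atlas" "c \<noteq> c'"
  shows "chart_inv c' s' = chart_inv c s \<longleftrightarrow> s * s' = 1"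
proof (cases "s' = 0")
  case True
  then show ?thesis using cp1_other_chart(2)[OF assms] cp1_chart_inv'(1)[OF assms(1), of s] by auto
next
  case False
  then show ?thesis
    using cp1_other_chart(1)[OF assms False] cp1_chart_inv'(2)[OF assms(1)] by (metis nonzero_divide_eq_eq)
qed

lemma cp1_eq_iff_same: "c \<in> cp1_atlas \<Longrightarrow> chart_inv c s' = chart_inv c s \<longleftrightarrow> s' = s"
  using cp1_chart_inv'(2) by metis

lemma open_cp1_iff: "open W \<longleftrightarrow> (\<forall>c\<in>cp1_atlas. open (chart_inv c -` W))"
  by (simp add: open_cp1_def cp1_atlas_def cp1_chart_inv[abs_def] vimage_def)

lemma open_vimage_reciprocal: "open W \<Longrightarrow> open {s :: complex. s \<noteq> 0 \<and> 1 / s \<in> W}"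
proof -
  assume "open W"
  moreover have "continuous_on (- {0}) (\<lambda>s :: complex. 1 / s)" by (intro continuous_intros) auto
  ultimately have "open (- {0} \<inter> (\<lambda>s :: complex. 1 / s) -` W)"
    by (intro continuous_open_preimage) (auto simp: open_Compl)
  also have "- {0} \<inter> (\<lambda>s :: complex. 1 / s) -` W = {s. s \<noteq> 0 \<and> 1 / s \<in> W}" by auto
  finally show ?thesis .
qed

lemma cp1_continuous_chart_inv: "c \<in> cp1_atlas \<Longrightarrow> continuous_on UNIV (chart_inv c)"
  by (simp add: continuous_on_open_vimage open_cp1_iff)

lemma cp1_open_image:
  assumes c: "c \<in> cp1_atlas" and W: "open W"
  shows "open (chart_inv c ` W)"
  unfolding open_cp1_iff
proof
  fix c' assume c': "c' \<in> cp1_atlas"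
  show "open (chart_inv c' -` chart_inv c ` W)"
  proof (cases "c' = c")
    case True
    then have "chart_inv c' -` chart_inv c ` W = W" using cp1_eq_iff_same[OF c] by auto
    then show ?thesis using W by simp
  next
    case False
    then have "chart_inv c' s' \<in> chart_inv c ` W \<longleftrightarrow> s' \<noteq> 0 \<and> 1 / s' \<in> W" for s'
    proof -
      have "chart_inv c' s' \<in> chart_inv c ` W \<longleftrightarrow> (\<exists>s\<in>W. s * s' = 1)"
        using cp1_eq_iff[OF c c'] False by (simp add: image_iff)
      also have "\<dots> \<longleftrightarrow> s' \<noteq> 0 \<and> 1 / s' \<in> W"
      proof
        assume "\<exists>s\<in>W. s * s' = 1"
        then obtain s where s: "s \<in> W" "s * s' = 1" by blast
        then have "s' \<noteq> 0" by auto
        with s(2) have "s = 1 / s'" by (simp add: eq_divide_eq)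
        then show "s' \<noteq> 0 \<and> 1 / s' \<in> W" using s(1) \<open>s' \<noteq> 0\<close> by simp
      next
        assume "s' \<noteq> 0 \<and> 1 / s' \<in> W"
        then show "\<exists>s\<in>W. s * s' = 1" by (intro bexI[of _ "1 / s'"]) auto
      qed
      finally show ?thesis .
    qed
    then have "chart_inv c' -` chart_inv c ` W = {s'. s' \<noteq> 0 \<and> 1 / s' \<in> W}" by auto
    then show ?thesis using open_vimage_reciprocal[OF W] by simp
  qed
qed

lemma complex_atlas_cp1: "complex_atlas cp1_atlas"
  unfolding complex_atlas_def
proof (intro conjI ballI)
  fix c assume c: "c \<in> cp1_atlas"
  have im: "fst c = range (chart_inv c)" 
  proof
    show "fst c \<subseteq> range (chart_inv c)"
    proof
      fix z assume "z \<in> fst c"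
      then have "z = chart_inv c (snd c z)" using cp1_chart_inv'(3)[OF c] by simp
      then show "z \<in> range (chart_inv c)" by (rule range_eqI)
    qed
    show "range (chart_inv c) \<subseteq> fst c" using cp1_chart_inv'(1)[OF c] by blast
  qed
  have o: "open (fst c)" unfolding im by (rule cp1_open_image[OF c open_UNIV])
  have "continuous_on (fst c) (snd c)"
    unfolding continuous_on_open_vimage[OF o]
  proof (intro allI impI)
    fix W :: "complex set" assume "open W"
    have "snd c -` W \<inter> fst c = chart_inv c ` W" using cp1_chart_inv'[OF c] by (auto simp: image_iff) metis
    then show "open (snd c -` W \<inter> fst c)" using cp1_open_image[OF c \<open>open W\<close>] by simp
  qed
  then show "is_chart c"
    using o cp1_continuous_chart_inv[OF c] cp1_chart_inv'[OF c] im
    unfolding is_chart_def homeomorphism_def by auto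
next
  have *: "holo_on (snd c ` (fst c \<inter> fst c')) (snd c' \<circ> chart_inv c)" if cc: "c \<in> cp1_atlas" "c' \<in> cp1_atlas" for c c'
  proof (cases "c = c'")
    case True
    have "holo_on UNIV (snd c' \<circ> chart_inv c)"
      using cp1_chart_inv'(2)[OF cc(1)] True by (simp add: o_def holomorphic_holo_on)
    then show ?thesis by (rule holo_on_subset) simp
  next
    case False
    have "holo_on (- {0}) (snd c' \<circ> chart_inv c)"
    proof (rule holo_on_cong[of _ "\<lambda>s. 1 / s"])
      show "holo_on (- {0}) (\<lambda>s :: complex. 1 / s)"
        by (intro holomorphic_holo_on holomorphic_intros) auto
      show "1 / s = (snd c' \<circ> chart_inv c) s" if "s \<in> - {0}" for s
        using cp1_other_chart(1)[OF cc(2,1)] False that cp1_chart_inv'(2)[OF cc(2)] by auto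
    qed auto
    moreover have "snd c ` (fst c \<inter> fst c') \<subseteq> - {0}"
    proof
      fix s assume "s \<in> snd c ` (fst c \<inter> fst c')"
      then obtain z where z: "z \<in> fst c" "z \<in> fst c'" "s = snd c z" by auto
      then have "z = chart_inv c s" "z \<noteq> chart_inv c 0"
        using cp1_chart_inv'(3)[OF cc(1)] cp1_other_chart(2)[OF cc(2,1)] False by auto
      then show "s \<in> - {0}" by auto
    qed
    ultimately show ?thesis by (rule holo_on_subset)
  qed
  show "compatible c d" if "c \<in> cp1_atlas" "d \<in> cp1_atlas" for c d
    unfolding compatible_def using *[OF that] *[OF that(2,1)] by (simp add: Int_commute)
  show "(\<Union>c\<in>cp1_atlas. fst c) = (UNIV :: cp1 set)"
    using cp1_range by (auto simp: cp1_atlas_def)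
qed

text \<open>The closed unit discs of the two charts cover the line.\<close>

lemma compact_cp1: "compact (UNIV :: cp1 set)"
proof -
  have "z \<in> Fin ` cball 0 1 \<union> Fin_inverse ` cball 0 1" for z
  proof (cases z)
    case (Fin w)
    show ?thesis
    proof (cases "cmod w \<le> 1")
      case False
      then have "w \<noteq> 0" "z = Fin_inverse (1 / w)" "1 / w \<in> cball 0 1"
        by (auto simp: Fin Fin_inverse_def norm_divide divide_simps)
      then show ?thesis by blast
    qed (simp add: Fin)
  next
    case Infty
    then have "z = Fin_inverse 0" by (simp add: Fin_inverse_def)
    then show ?thesis by auto
  qed
  then have "UNIV = Fin ` cball 0 1 \<union> Fin_inverse ` cball 0 1" by blast
  moreover have "continuous_on UNIV Fin" "continuous_on UNIV Fin_inverse"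
    using cp1_continuous_chart_inv[of cp1_fin] cp1_continuous_chart_inv[of cp1_inf]
    by (simp_all add: cp1_atlas_def cp1_chart_inv[abs_def])
  then have "compact (Fin ` cball 0 1)" "compact (Fin_inverse ` cball 0 1)"
    by (auto intro!: compact_continuous_image intro: continuous_on_subset)
  ultimately show ?thesis by (metis compact_Un)
qed

lemma open_cp1_delete:
  shows "open (- {z :: cp1})"
proof -
  obtain c where c: "c \<in> cp1_atlas" "z \<in> fst c" using complex_atlasD(2)[OF complex_atlas_cp1] by blast
  define s where "s = snd c z"
  have z: "z = chart_inv c s" using cp1_chart_inv'(3)[OF c] by (simp add: s_def)
  show ?thesis unfolding open_cp1_iff
  proof
    fix c' assume c': "c' \<in> cp1_atlas"
    show "open (chart_inv c' -` (- {z}))"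
    proof (cases "c' = c")
      case True
      then have "chart_inv c' -` (- {z}) = - {s}" using cp1_eq_iff_same[OF c(1)] z by auto
      then show ?thesis by (simp add: open_Compl)
    next
      case False
      then have "chart_inv c' -` (- {z}) = {s'. s * s' \<noteq> 1}" using cp1_eq_iff[OF c(1) c'] z by auto
      moreover have "open {s'. s * s' \<noteq> 1}" by (intro open_Collect_neq continuous_intros)
      ultimately show ?thesis by simp
    qed
  qed
qed

text \<open>The rational function with a simple pole at the point of coordinate s and a zero at the
  point missing from c. At the pole itself division by zero gives 0, so that point is treated
  separately.\<close>

definition cp1_pole :: "(cp1, complex) chart \<Rightarrow> complex \<Rightarrow> cp1 \<Rightarrow> complex" where
  "cp1_pole c s z = (if z \<in> fst c then 1 / (snd c z - s) else 0)"

lemma cp1_pole_chart: "c \<in> cp1_atlas \<Longrightarrow> cp1_pole c s (chart_inv c s') = 1 / (s' - s)"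
  by (simp add: cp1_pole_def cp1_chart_inv')

text \<open>In the other affine coordinate the function is s' / (1 - s s'). Multiplying a section by
  it therefore creates no pole at the point missing from c.\<close>

lemma cp1_pole_holomorphic:
  assumes c: "c \<in> cp1_atlas" and c': "c' \<in> cp1_atlas"
  shows "(\<lambda>s'. cp1_pole c s (chart_inv c' s')) holomorphic_on {s'. chart_inv c' s' \<noteq> chart_inv c s}"
proof (cases "c' = c")
  case True
  show ?thesis
    unfolding True cp1_pole_chart[OF c] cp1_eq_iff_same[OF c] by (intro holomorphic_intros) auto
next
  case False
  have "cp1_pole c s (chart_inv c' s') = s' / (1 - s * s')" if "s * s' \<noteq> 1" for s'
  proof (cases "s' = 0")
    case True
    then show ?thesis using cp1_other_chart(2)[OF c c'] False by (simp add: cp1_pole_def)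
  next
    case nz: False
    then show ?thesis
      using cp1_other_chart(1)[OF c c' _ nz] False that by (simp add: cp1_pole_chart[OF c] field_simps)
  qed
  moreover have "(\<lambda>s'. s' / (1 - s * s')) holomorphic_on {s'. s * s' \<noteq> 1}"
    by (intro holomorphic_intros) auto
  ultimately have "(\<lambda>s'. cp1_pole c s (chart_inv c' s')) holomorphic_on {s'. s * s' \<noteq> 1}"
    by (auto intro: holomorphic_transform)
  then show ?thesis using cp1_eq_iff[OF c c'] False by simp
qed

section \<open>Families of rational curves in coordinates\<close>

text \<open>Pairing with a nonzero tangent vector u identifies the quotient of the plane by the line
  of u with the complex numbers; this is how normal classes become functions.\<close>

definition det2 :: "complex \<times> complex \<Rightarrow> complex \<times> complex \<Rightarrow> complex" where
  "det2 u v = fst u * snd v - snd u * fst v"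

lemma det2_eq_0_iff:
  assumes "u \<noteq> 0"
  shows "det2 u v = 0 \<longleftrightarrow> (\<exists>\<kappa>. v = \<kappa> *\<^sub>C u)"
proof
  assume 0: "det2 u v = 0"
  show "\<exists>\<kappa>. v = \<kappa> *\<^sub>C u"
  proof (cases "fst u = 0")
    case False
    then show ?thesis using 0
      by (intro exI[of _ "fst v / fst u"]) (auto simp: det2_def scaleC_prod_def scaleC_complex_def prod_eq_iff field_simps)
  next
    case True
    then have "snd u \<noteq> 0" using assms by (auto simp: prod_eq_iff)
    then show ?thesis using 0 True
      by (intro exI[of _ "snd v / snd u"]) (auto simp: det2_def scaleC_prod_def scaleC_complex_def prod_eq_iff field_simps)
  qed
qed (auto simp: det2_def scaleC_prod_def scaleC_complex_def)

lemma det2_add: "det2 u (v + w) = det2 u v + det2 u w"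
  by (simp add: det2_def algebra_simps)

lemma det2_diff: "det2 u (v - w) = det2 u v - det2 u w"
  by (simp add: det2_def algebra_simps)

lemma det2_scaleC: "det2 u (c *\<^sub>C v) = c * det2 u v"
  by (simp add: det2_def scaleC_prod_def scaleC_complex_def algebra_simps)

lemma det2_self [simp]: "det2 u u = 0"
  by (simp add: det2_def)

lemma holo_on_det2:
  assumes "holo_on (S :: complex set) u" "holo_on S v"
  shows "(\<lambda>s. det2 (u s) (v s)) holomorphic_on S"
  unfolding det2_def using assms
  by (intro holomorphic_intros holo_on_holomorphic holo_on_fst holo_on_snd)

text \<open>A family of embeddings near one parameter value a. Bijectivity of the Kodaira map is
  demanded at a alone; the curves for the other b in V serve as deformations of
  \<open>F a\<close>.\<close>

locale kodaira_family =
  fixes AS :: "('s::t2_space, complex \<times> complex) chart set"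
    and AB :: "('m::topological_space, complex ^ 'b::finite) chart set"
    and F :: "'m \<Rightarrow> cp1 \<Rightarrow> 's" and V :: "'m set" and a :: 'm and cb :: "('m, complex ^ 'b) chart"
  assumes AS: "complex_atlas AS" and AB: "complex_atlas AB"
    and V: "open V" "a \<in> V"
    and F: "holo_map_on (V \<times> UNIV) (prod_atlas AB cp1_atlas) AS (\<lambda>(b, z). F b z)"
    and emb: "\<And>b. b \<in> V \<Longrightarrow> cp1_embedding AS (F b)"
    and cb: "cb \<in> AB" "a \<in> fst cb"
    and bij: "bij_betw (kodaira_map AS AB F a) (tangent_space AB a) {\<nu>. normal_section AS (F a) UNIV \<nu>}"
begin

definition \<beta>0 where "\<beta>0 = snd cb a"

text \<open>In charts, \<open>Psi\<close> is the family as a function of the parameter and the coordinate \<open>s\<close> of the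
  curve. Along the curve \<open>F a\<close>, \<open>Gv\<close> is its velocity and \<open>vv w\<close> its variation in the
  direction \<open>w\<close>.\<close>

definition Psi :: "(cp1, complex) chart \<Rightarrow> ('s, complex \<times> complex) chart \<Rightarrow> (complex ^ 'b) \<times> complex \<Rightarrow> complex \<times> complex"
  where "Psi c d p = snd d (F (chart_inv cb (fst p)) (chart_inv c (snd p)))"

definition Om :: "(cp1, complex) chart \<Rightarrow> ('s, complex \<times> complex) chart \<Rightarrow> ((complex ^ 'b) \<times> complex) set"
  where "Om c d = {p. fst p \<in> snd cb ` fst cb \<and> chart_inv cb (fst p) \<in> V \<and> F (chart_inv cb (fst p)) (chart_inv c (snd p)) \<in> fst d}"

lemmas cbch = complex_atlasD(1)[OF AB cb(1)]

lemma base: "\<beta>0 \<in> snd cb ` fst cb" "chart_inv cb \<beta>0 = a"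
  using cb chart_facts(5)[OF cbch] by (auto simp: \<beta>0_def)

lemma open_param: "open {\<beta> \<in> snd cb ` fst cb. chart_inv cb \<beta> \<in> V}"
  using open_chart_image[OF cbch V(1)] unfolding chart_image_eq[OF cbch] by (simp add: Int_def vimage_def)

lemma continuous_F: "continuous_on (V \<times> UNIV) (\<lambda>(b, z). F b z)"
  using F by (simp add: holo_map_on_def)

lemma continuous_K:
  assumes "c \<in> cp1_atlas"
  shows "continuous_on ({\<beta> \<in> snd cb ` fst cb. chart_inv cb \<beta> \<in> V} \<times> UNIV)
    (\<lambda>p. F (chart_inv cb (fst p)) (chart_inv c (snd p)))"
proof -
  let ?P = "{\<beta> \<in> snd cb ` fst cb. chart_inv cb \<beta> \<in> V}"
  have "continuous_on (?P \<times> UNIV) (\<lambda>p. (chart_inv cb (fst p), chart_inv c (snd p)))"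
  proof (intro continuous_on_Pair)
    show "continuous_on (?P \<times> UNIV) (\<lambda>p. chart_inv cb (fst p))"
      by (rule continuous_on_compose2[OF chart_facts(4)[OF cbch]]) (auto intro: continuous_intros)
    show "continuous_on (?P \<times> UNIV) (\<lambda>p. chart_inv c (snd p))"
      by (rule continuous_on_compose2[OF cp1_continuous_chart_inv[OF assms]]) (auto intro: continuous_intros)
  qed
  then have "continuous_on (?P \<times> UNIV) (\<lambda>p. case (chart_inv cb (fst p), chart_inv c (snd p)) of (b, z) \<Rightarrow> F b z)"
    by (rule continuous_on_compose2[OF continuous_F]) auto
  then show ?thesis by simp
qed

lemma open_Om:
  assumes "c \<in> cp1_atlas" "is_chart d"
  shows "open (Om c d)"
proof -
  let ?P = "{\<beta> \<in> snd cb ` fst cb. chart_inv cb \<beta> \<in> V}"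
  have "open ((?P \<times> UNIV) \<inter> (\<lambda>p. F (chart_inv cb (fst p)) (chart_inv c (snd p))) -` fst d)"
    by (rule continuous_open_preimage[OF continuous_K[OF assms(1)] open_Times[OF open_param open_UNIV] chart_facts(1)[OF assms(2)]])
  also have "(?P \<times> UNIV) \<inter> (\<lambda>p. F (chart_inv cb (fst p)) (chart_inv c (snd p))) -` fst d = Om c d"
    by (auto simp: Om_def)
  finally show ?thesis .
qed

lemma Psi_holo_AS:
  assumes c: "c \<in> cp1_atlas" and d: "d \<in> AS"
  shows "holo_on (Om c d) (Psi c d)"
proof -
  let ?C = "(fst cb \<times> fst c, map_prod (snd cb) (snd c))"
  have inv: "chart_inv ?C p = (chart_inv cb (fst p), chart_inv c (snd p))" if "fst p \<in> snd cb ` fst cb" for p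
  proof -
    have "inj_on (snd cb) (fst cb)" "inj_on (snd c) (fst c)"
      using chart_facts(5)[OF cbch] cp1_chart_inv'(3)[OF c] by (metis inj_onI)+
    then have "inj_on (map_prod (snd cb) (snd c)) (fst cb \<times> fst c)" by (rule map_prod_inj_on)
    then show ?thesis
      unfolding chart_inv_def[of ?C]
      using chart_facts(6,7)[OF cbch that] cp1_chart_inv'(1,2)[OF c]
      by (intro inv_into_f_eq) (auto simp: prod_eq_iff)
  qed
  have "?C \<in> prod_atlas AB cp1_atlas" unfolding prod_atlas_def using cb(1) c by blast
  then have "holo_on (snd ?C ` (fst ?C \<inter> V \<times> UNIV \<inter> (\<lambda>(b, z). F b z) -` fst d)) (snd d \<circ> (\<lambda>(b, z). F b z) \<circ> chart_inv ?C)"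
    using F d unfolding holo_map_on_def by blast
  moreover have "Om c d \<subseteq> snd ?C ` (fst ?C \<inter> V \<times> UNIV \<inter> (\<lambda>(b, z). F b z) -` fst d)"
  proof
    fix p assume p: "p \<in> Om c d"
    let ?q = "(chart_inv cb (fst p), chart_inv c (snd p))"
    have "?q \<in> fst ?C \<inter> V \<times> UNIV \<inter> (\<lambda>(b, z). F b z) -` fst d"
      using p chart_facts(6)[OF cbch] cp1_chart_inv'(1)[OF c] by (auto simp: Om_def)
    moreover have "p = snd ?C ?q"
      using p chart_facts(7)[OF cbch] cp1_chart_inv'(2)[OF c] by (auto simp: Om_def prod_eq_iff)
    ultimately show "p \<in> snd ?C ` (fst ?C \<inter> V \<times> UNIV \<inter> (\<lambda>(b, z). F b z) -` fst d)" by (rule rev_image_eqI)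
  qed
  ultimately have "holo_on (Om c d) (snd d \<circ> (\<lambda>(b, z). F b z) \<circ> chart_inv ?C)" by (rule holo_on_subset)
  then show ?thesis
    by (rule holo_on_cong[OF open_Om[OF c complex_atlasD(1)[OF AS d]]]) (simp add: inv Om_def Psi_def)
qed

text \<open>\<open>holo_map_on\<close> refers to charts of the given atlas. The charts of the
  maximal atlas, in which the differential equation is written, are reached by a local holomorphic
  change of coordinates.\<close>

lemma Psi_holo:
  assumes c: "c \<in> cp1_atlas" and d: "d \<in> max_atlas AS"
  shows "holo_on (Om c d) (Psi c d)"
proof (rule holo_on_local)
  fix p assume p: "p \<in> Om c d"
  obtain e where e: "e \<in> AS" "F (chart_inv cb (fst p)) (chart_inv c (snd p)) \<in> fst e"
    using complex_atlasD(2)[OF AS] by blast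
  note che = complex_atlasD(1)[OF AS e(1)] and chd = complex_atlasD(4)[OF AS d]
  have "compatible d e" using d e unfolding max_atlas_def by blast
  then have T: "holo_on (snd e ` (fst d \<inter> fst e)) (snd d \<circ> chart_inv e)" by (simp add: compatible_def)
  let ?W = "Om c d \<inter> Om c e"
  have "holo_on ?W (\<lambda>p. (snd d \<circ> chart_inv e) (Psi c e p))"
    by (rule holo_on_compose[OF holo_on_subset[OF Psi_holo_AS[OF c e(1)]] T]) (auto simp: Om_def Psi_def)
  moreover have "open ?W" using open_Om[OF c] che chd by blast
  moreover have "p \<in> ?W" using p e(2) by (auto simp: Om_def)
  moreover have "\<forall>y\<in>?W. (snd d \<circ> chart_inv e) (Psi c e y) = Psi c d y"
    using chart_facts(5)[OF che] by (auto simp: Om_def Psi_def)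
  ultimately show "\<exists>W h. open W \<and> p \<in> W \<and> holo_on W h \<and> (\<forall>y\<in>W. h y = Psi c d y)" by blast
qed

definition Sset :: "(cp1, complex) chart \<Rightarrow> ('s, complex \<times> complex) chart \<Rightarrow> complex set"
  where "Sset c d = {s. F a (chart_inv c s) \<in> fst d}"

definition Gv :: "(cp1, complex) chart \<Rightarrow> ('s, complex \<times> complex) chart \<Rightarrow> complex \<Rightarrow> complex \<times> complex"
  where "Gv c d s = frechet_derivative (Psi c d) (at (\<beta>0, s)) (0, 1)"

definition vv :: "(cp1, complex) chart \<Rightarrow> ('s, complex \<times> complex) chart \<Rightarrow> complex ^ 'b \<Rightarrow> complex \<Rightarrow> complex \<times> complex"
  where "vv c d w s = frechet_derivative (Psi c d) (at (\<beta>0, s)) (w, 0)"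

lemma Sset_iff: "s \<in> Sset c d \<longleftrightarrow> (\<beta>0, s) \<in> Om c d"
  using base V by (auto simp: Sset_def Om_def)

lemma open_Sset:
  assumes "c \<in> cp1_atlas" "is_chart d"
  shows "open (Sset c d)"
proof -
  have "Sset c d = Pair \<beta>0 -` Om c d" by (auto simp: Sset_iff)
  then show ?thesis using open_Om[OF assms] by (auto intro!: open_vimage continuous_intros)
qed

lemma holo_on_const: "holo_on U (\<lambda>x. c)"
  unfolding holo_on_def by (intro ballI exI[of _ "\<lambda>x. 0"]) auto

lemma holo_on_ident: "holo_on U (\<lambda>x. x)"
  unfolding holo_on_def by (intro ballI exI[of _ "\<lambda>x. x"]) auto

lemma holo_Gv: assumes "c \<in> cp1_atlas" "d \<in> max_atlas AS" shows "holo_on (Sset c d) (Gv c d)"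
  unfolding Gv_def[abs_def] using assms complex_atlasD(4)[OF AS assms(2)] Sset_iff
  by (intro holo_on_derivative_along[OF open_Om Psi_holo] open_Sset holo_on_Pair holo_on_const holo_on_ident) auto

lemma holo_vv: assumes "c \<in> cp1_atlas" "d \<in> max_atlas AS" shows "holo_on (Sset c d) (vv c d w)"
  unfolding vv_def[abs_def] using assms complex_atlasD(4)[OF AS assms(2)] Sset_iff
  by (intro holo_on_derivative_along[OF open_Om Psi_holo] open_Sset holo_on_Pair holo_on_const holo_on_ident) auto

lemma cdiff_Psi:
  assumes "c \<in> cp1_atlas" "d \<in> max_atlas AS" "s \<in> Sset c d"
  shows "cdiff (Psi c d) (\<beta>0, s)"
  using Psi_holo[OF assms(1,2)] assms(3) by (simp add: holo_on_cdiff Sset_iff)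

lemma vv_linear:
  assumes "c \<in> cp1_atlas" "d \<in> max_atlas AS" "s \<in> Sset c d"
  shows "vv c d (w + w') s = vv c d w s + vv c d w' s" "vv c d (k *\<^sub>C w) s = k *\<^sub>C vv c d w s" "vv c d 0 s = 0"
proof -
  note D = cdiffD[OF cdiff_Psi[OF assms]]
  show "vv c d (w + w') s = vv c d w s + vv c d w' s" "vv c d (k *\<^sub>C w) s = k *\<^sub>C vv c d w s" "vv c d 0 s = 0"
    using D(3)[of "(w, 0)" "(w', 0)"] D(2)[of k "(w, 0)"] D(4)
    by (simp_all add: vv_def scaleC_prod_def zero_prod_def)
qed

text \<open>A vector field along \<open>F a\<close> representing the section of the normal bundle
  that the Kodaira map assigns to the direction w.\<close>

definition xi :: "complex ^ 'b \<Rightarrow> cp1 \<Rightarrow> ('s, complex \<times> complex) tvec"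
  where "xi w z = pushforward AB AS (\<lambda>b. F b z) a (tlift AB cb a w)"

lemmas cbmax = complex_atlasD(3)[OF AB, THEN subsetD, OF cb(1)]

lemma xi_eq:
  assumes c: "c \<in> cp1_atlas" and d: "d \<in> max_atlas AS" and s: "s \<in> Sset c d"
  shows "xi w (chart_inv c s) = tlift AS d (F a (chart_inv c s)) (vv c d w s)"
proof -
  let ?z = "chart_inv c s"
  let ?f = "snd d \<circ> (\<lambda>b. F b ?z) \<circ> chart_inv cb"
  let ?g = "\<lambda>\<beta>. (\<beta>, s)"
  have i: "(?g has_derivative (\<lambda>v. (v, 0))) (at \<beta>0)" by (auto intro!: derivative_eq_intros)
  have "cdiff ?g \<beta>0"
    unfolding cdiff_def using i by (intro exI[of _ "\<lambda>v. (v, 0)"]) (simp add: scaleC_prod_def)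
  then have i': "cdiff ?g \<beta>0" "frechet_derivative ?g (at \<beta>0) = (\<lambda>v. (v, 0))"
    using frechet_derivative_at[OF i] by simp_all
  have P: "cdiff (Psi c d) (?g \<beta>0)" using cdiff_Psi[OF c d s] .
  have e: "?f y = Psi c d (?g y)" if "y \<in> UNIV" for y by (simp add: Psi_def)
  have f: "cdiff ?f \<beta>0" by (rule cdiff_compose_local(1)[OF i'(1) P open_UNIV UNIV_I e])
  have f': "frechet_derivative ?f (at \<beta>0) v = frechet_derivative (Psi c d) (at (\<beta>0, s)) (v, 0)" for v
    using cdiff_compose_local(2)[OF i'(1) P open_UNIV UNIV_I e, of v] i'(2) by (simp add: o_def)
  have "pushforward AB AS (\<lambda>b. F b ?z) a (tlift AB cb a w) =
      tlift AS d (F a ?z) (frechet_derivative ?f (at (snd cb a)) (tlift AB cb a w cb))"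
  proof (rule pushforward_eq_tlift[OF AB AS cb d _ V])
    show "continuous_on V (\<lambda>b. F b ?z)"
    proof -
      have "continuous_on V (\<lambda>b. (b, ?z))" by (intro continuous_intros)
      then have "continuous_on V (\<lambda>b. case (b, ?z) of (b, z) \<Rightarrow> F b z)"
        by (rule continuous_on_compose2[OF continuous_F]) auto
      then show ?thesis by simp
    qed
    show "F a ?z \<in> fst d" using s by (simp add: Sset_def)
    show "cdiff ?f (snd cb a)" using f by (simp add: \<beta>0_def)
    show "tlift AB cb a w \<in> tangent_space AB a" by (rule tlift_tangent[OF AB cbmax cb(2)])
  qed
  then show ?thesis using f' by (simp add: xi_def vv_def \<beta>0_def tlift_self[OF AB cb])
qed

lemma pushforward_curve:
  assumes c: "c \<in> cp1_atlas" and d: "d \<in> max_atlas AS" and s: "s \<in> Sset c d"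
    and \<zeta>: "\<zeta> \<in> tangent_space cp1_atlas (chart_inv c s)"
  shows "pushforward cp1_atlas AS (F a) (chart_inv c s) \<zeta> = tlift AS d (F a (chart_inv c s)) (\<zeta> c *\<^sub>C Gv c d s)"
proof -
  let ?z = "chart_inv c s"
  let ?f = "snd d \<circ> F a \<circ> chart_inv c"
  let ?g = "\<lambda>s. (\<beta>0, s)"
  have i: "(?g has_derivative (\<lambda>v. (0, v))) (at s)" by (auto intro!: derivative_eq_intros)
  have "cdiff ?g s"
    unfolding cdiff_def using i by (intro exI[of _ "\<lambda>v. (0, v)"]) (simp add: scaleC_prod_def)
  then have i': "cdiff ?g s" "frechet_derivative ?g (at s) = (\<lambda>v. (0, v))"
    using frechet_derivative_at[OF i] by simp_all
  have P: "cdiff (Psi c d) (?g s)" using cdiff_Psi[OF c d s] .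
  have e: "?f y = Psi c d (?g y)" if "y \<in> UNIV" for y by (simp add: Psi_def base(2))
  have f: "cdiff ?f s" by (rule cdiff_compose_local(1)[OF i'(1) P open_UNIV UNIV_I e])
  have f': "frechet_derivative ?f (at s) v = v *\<^sub>C Gv c d s" for v
  proof -
    have "frechet_derivative ?f (at s) v = frechet_derivative (Psi c d) (at (\<beta>0, s)) (v *\<^sub>C (0, 1))"
      using cdiff_compose_local(2)[OF i'(1) P open_UNIV UNIV_I e, of v] i'(2)
      by (simp add: scaleC_prod_def scaleC_complex_def o_def)
    then show ?thesis by (simp only: cdiffD(2)[OF P] Gv_def)
  qed
  have sz: "snd c ?z = s" using cp1_chart_inv'(2)[OF c] .
  have "pushforward cp1_atlas AS (F a) ?z \<zeta> = tlift AS d (F a ?z) (frechet_derivative ?f (at (snd c ?z)) (\<zeta> c))"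
  proof (rule pushforward_eq_tlift[OF complex_atlas_cp1 AS c _ d])
    show "?z \<in> fst c" using cp1_chart_inv'(1)[OF c] .
    show "F a ?z \<in> fst d" using s by (simp add: Sset_def)
    show "continuous_on UNIV (F a)" using emb[OF V(2)] by (simp add: cp1_embedding_def holo_map_on_def)
    show "cdiff ?f (snd c ?z)" using f sz by simp
  qed (use \<zeta> in auto)
  then show ?thesis using f' sz by simp
qed

lemma curve_tangent_ex:
  assumes c: "c \<in> cp1_atlas"
  obtains \<zeta> where "\<zeta> \<in> tangent_space cp1_atlas (chart_inv c s)" "\<zeta> c = \<kappa>"
proof
  have "c \<in> max_atlas cp1_atlas" "chart_inv c s \<in> fst c"
    using c cp1_chart_inv'(1)[OF c] complex_atlasD(3)[OF complex_atlas_cp1] by auto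
  then show "tlift cp1_atlas c (chart_inv c s) \<kappa> \<in> tangent_space cp1_atlas (chart_inv c s)"
    by (rule tlift_tangent[OF complex_atlas_cp1])
  show "tlift cp1_atlas c (chart_inv c s) \<kappa> c = \<kappa>"
    using tlift_self[OF complex_atlas_cp1 c cp1_chart_inv'(1)[OF c]] .
qed

lemma normal_class_eq:
  assumes c: "c \<in> cp1_atlas" and d: "d \<in> max_atlas AS" and s: "s \<in> Sset c d"
  shows "normal_class AS (F a) (chart_inv c s) (tlift AS d (F a (chart_inv c s)) v) =
    {tlift AS d (F a (chart_inv c s)) (v + \<kappa> *\<^sub>C Gv c d s) | \<kappa>. True}" (is "?L = ?R")
proof -
  let ?z = "chart_inv c s" let ?t = "tlift AS d (F a ?z)"
  have p: "F a ?z \<in> fst d" using s by (simp add: Sset_def)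
  have eq: "(\<lambda>e. ?t v e + pushforward cp1_atlas AS (F a) ?z \<zeta> e) = ?t (v + \<zeta> c *\<^sub>C Gv c d s)"
    if "\<zeta> \<in> tangent_space cp1_atlas ?z" for \<zeta>
    unfolding pushforward_curve[OF c d s that] tlift_add[OF AS d p] ..
  show ?thesis
  proof (intro equalityI subsetI)
    fix x assume "x \<in> ?L"
    then obtain \<zeta> where \<zeta>: "\<zeta> \<in> tangent_space cp1_atlas ?z" "x = (\<lambda>e. ?t v e + pushforward cp1_atlas AS (F a) ?z \<zeta> e)"
      unfolding normal_class_def by blast
    then show "x \<in> ?R" unfolding eq[OF \<zeta>(1)] by blast
  next
    fix x assume "x \<in> ?R"
    then obtain \<kappa> where \<kappa>: "x = ?t (v + \<kappa> *\<^sub>C Gv c d s)" by blast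
    obtain \<zeta> where \<zeta>: "\<zeta> \<in> tangent_space cp1_atlas ?z" "\<zeta> c = \<kappa>" by (rule curve_tangent_ex[OF c])
    have "x = (\<lambda>e. ?t v e + pushforward cp1_atlas AS (F a) ?z \<zeta> e)" unfolding eq[OF \<zeta>(1)] \<zeta>(2) \<kappa> ..
    then show "x \<in> ?L" unfolding normal_class_def using \<zeta>(1) by blast
  qed
qed

text \<open>Otherwise tangent vectors of the projective line with components 0 and 1 would have the
  same image, against the immersion property.\<close>

lemma Gv_nonzero:
  assumes c: "c \<in> cp1_atlas" and d: "d \<in> max_atlas AS" and s: "s \<in> Sset c d"
  shows "Gv c d s \<noteq> 0"
proof
  assume 0: "Gv c d s = 0"
  let ?z = "chart_inv c s"
  obtain \<zeta> \<zeta>' where \<zeta>: "\<zeta> \<in> tangent_space cp1_atlas ?z" "\<zeta> c = 0"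
    "\<zeta>' \<in> tangent_space cp1_atlas ?z" "\<zeta>' c = 1"
    by (metis curve_tangent_ex[OF c])
  have "inj_on (pushforward cp1_atlas AS (F a) ?z) (tangent_space cp1_atlas ?z)"
    using emb[OF V(2)] by (simp add: cp1_embedding_def)
  moreover have "pushforward cp1_atlas AS (F a) ?z \<zeta> = pushforward cp1_atlas AS (F a) ?z \<zeta>'"
    unfolding pushforward_curve[OF c d s \<zeta>(1)] pushforward_curve[OF c d s \<zeta>(3)] 0 by simp
  ultimately have "\<zeta> = \<zeta>'" using \<zeta> by (meson inj_onD)
  then show False using \<zeta> by simp
qed

text \<open>Two representatives differ by a multiple of the nonzero velocity \<open>Gv\<close>
  exactly when \<open>det2 (Gv c d s)\<close> annihilates their difference.\<close>

lemma normal_class_eq_iff: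
  assumes c: "c \<in> cp1_atlas" and d: "d \<in> max_atlas AS" and s: "s \<in> Sset c d"
  shows "normal_class AS (F a) (chart_inv c s) (tlift AS d (F a (chart_inv c s)) v) =
      normal_class AS (F a) (chart_inv c s) (tlift AS d (F a (chart_inv c s)) w)
    \<longleftrightarrow> det2 (Gv c d s) v = det2 (Gv c d s) w" (is "?L = ?R \<longleftrightarrow> _")
proof
  have p: "F a (chart_inv c s) \<in> fst d" using s by (simp add: Sset_def)
  note N = normal_class_eq[OF c d s]
  assume "?L = ?R"
  moreover have "tlift AS d (F a (chart_inv c s)) v \<in> ?L"
    unfolding N by (rule CollectI, rule exI[of _ 0]) simp
  ultimately obtain \<kappa> where "tlift AS d (F a (chart_inv c s)) v = tlift AS d (F a (chart_inv c s)) (w + \<kappa> *\<^sub>C Gv c d s)"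
    unfolding N by blast
  then have "v = w + \<kappa> *\<^sub>C Gv c d s" using tlift_inject[OF AS d p] by blast
  then show "det2 (Gv c d s) v = det2 (Gv c d s) w" by (simp add: det2_add det2_scaleC)
next
  note N = normal_class_eq[OF c d s]
  assume "det2 (Gv c d s) v = det2 (Gv c d s) w"
  then have "det2 (Gv c d s) (v - w) = 0" by (simp add: det2_diff)
  then obtain \<kappa> where "v - w = \<kappa> *\<^sub>C Gv c d s" using det2_eq_0_iff[OF Gv_nonzero[OF c d s]] by blast
  then have v: "v = w + \<kappa> *\<^sub>C Gv c d s" by (metis add.commute diff_add_cancel)
  have 1: "v + k *\<^sub>C Gv c d s = w + (\<kappa> + k) *\<^sub>C Gv c d s" for k by (simp add: v scaleC_add_left add.assoc)
  have 2: "w + k *\<^sub>C Gv c d s = v + (k - \<kappa>) *\<^sub>C Gv c d s" for k using 1[of "k - \<kappa>"] by simp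
  show "?L = ?R" unfolding N using 1 2 by (metis (no_types, lifting))
qed

end

section \<open>Normal sections\<close>

text \<open>A square matrix whose row k has been replaced by zero has no right inverse, hence no
  left inverse, hence a nontrivial kernel.\<close>

lemma underdetermined_system:
  fixes M :: "'c::finite \<Rightarrow> 'c \<Rightarrow> complex"
  obtains v :: "complex ^ 'c" where "v \<noteq> 0" "\<And>r. r \<noteq> k \<Longrightarrow> (\<Sum>j\<in>UNIV. M r j * vec_nth v j) = 0"
proof -
  define A :: "complex ^ 'c ^ 'c" where "A = (\<chi> r j. if r = k then 0 else M r j)"
  have "\<not> (\<forall>x. A *v x = 0 \<longrightarrow> x = 0)"
  proof
    assume "\<forall>x. A *v x = 0 \<longrightarrow> x = 0"
    then obtain B where "B ** A = mat 1" using matrix_left_invertible_ker[of A] by blast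
    then have "A ** B = mat 1" using matrix_left_right_inverse by blast
    then have "vec_nth (vec_nth (A ** B) k) k = 1" by (simp add: mat_def)
    then show False by (simp add: matrix_matrix_mult_def A_def)
  qed
  then obtain v where v: "A *v v = 0" "v \<noteq> 0" by blast
  have "(\<Sum>j\<in>UNIV. M r j * vec_nth v j) = 0" if "r \<noteq> k" for r
    using arg_cong[OF v(1), of "\<lambda>x. vec_nth x r"] that by (simp add: A_def matrix_vector_mult_def)
  with v(2) show thesis using that by blast
qed

lemma sum_UNIV_enum:
  "(\<Sum>b\<in>(UNIV :: 'b::finite set). g (to_nat_on (UNIV :: 'b set) b)) = (\<Sum>i<CARD('b). g i)"
  using sum.reindex_bij_betw[OF to_nat_on_bij[where 'b='b], of g] .

lemma vec_eq_sum_axis: "(v :: complex ^ 'b::finite) = (\<Sum>b\<in>UNIV. vec_nth v b *\<^sub>C axis b 1)"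
  by (simp add: vec_eq_iff sum_component scaleC_vec_def scaleC_complex_def axis_def if_distrib cong: if_cong)

text \<open>n conditions on n + 1 unknowns. Rows are indexed by the coordinate type itself, so the
  row belonging to the number n is the one left free.\<close>

lemma common_kernel_vector:
  fixes \<phi> :: "nat \<Rightarrow> complex ^ 'b::finite \<Rightarrow> complex"
  assumes "CARD('b) = n + 1"
    and add: "\<And>i v w. i < n \<Longrightarrow> \<phi> i (v + w) = \<phi> i v + \<phi> i w"
    and scale: "\<And>i c v. i < n \<Longrightarrow> \<phi> i (c *\<^sub>C v) = c * \<phi> i v"
  obtains w where "w \<noteq> 0" "\<And>i. i < n \<Longrightarrow> \<phi> i w = 0"
proof -
  let ?e = "from_nat_into (UNIV :: 'b set)" and ?t = "to_nat_on (UNIV :: 'b set)"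
  obtain v :: "complex ^ 'b" where v: "v \<noteq> 0"
    "\<And>r. r \<noteq> ?e n \<Longrightarrow> (\<Sum>j\<in>UNIV. \<phi> (?t r) (axis j 1) * vec_nth v j) = 0"
    by (rule underdetermined_system[where M = "\<lambda>r j. \<phi> (?t r) (axis j 1)" and k = "?e n"]) (rule that; assumption)
  have "\<phi> i v = 0" if "i < n" for i
  proof -
    have "\<phi> i (\<Sum>b\<in>S. vec_nth v b *\<^sub>C axis b 1) = (\<Sum>b\<in>S. \<phi> i (axis b 1) * vec_nth v b)" if "finite S" for S :: "'b set"
      using that
    proof (induction S rule: finite_induct)
      case empty
      have "\<phi> i 0 = 0" using scale[OF \<open>i < n\<close>, of 0 0] by simp
      then show ?case by simp
    next
      case (insert x S)
      then show ?case using add[OF \<open>i < n\<close>] scale[OF \<open>i < n\<close>] by simp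
    qed
    from this[OF finite_class.finite_UNIV] have "\<phi> i v = (\<Sum>b\<in>UNIV. \<phi> i (axis b 1) * vec_nth v b)"
      by (simp only: vec_eq_sum_axis[of v, symmetric])
    moreover have t: "?t (?e i) = i" "?t (?e n) = n"
      using that assms(1) by (auto intro!: to_nat_on_from_nat_into_finite)
    then have "?e i \<noteq> ?e n" using that by (metis less_irrefl)
    ultimately show ?thesis using v(2)[of "?e i"] t(1) by simp
  qed
  with v(1) show thesis using that by blast
qed

text \<open>One vector more than the dimension. The type \<open>'b option\<close> has one more
  element than \<open>'b\<close>, which makes the system square; its row \<open>None\<close> is the
  free one.\<close>

lemma linear_dependence_relation:
  fixes W :: "nat \<Rightarrow> complex ^ 'b::finite"
  obtains c where "\<exists>i\<le>CARD('b). c i \<noteq> 0" "(\<Sum>i\<le>CARD('b). c i *\<^sub>C W i) = 0"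
proof -
  let ?N = "CARD('b)"
  let ?eb = "from_nat_into (UNIV :: 'b set)" and ?t = "to_nat_on (UNIV :: 'b option set)"
  have N: "CARD('b option) = ?N + 1" by simp
  define M :: "'b option \<Rightarrow> 'b option \<Rightarrow> complex" where
    "M = (\<lambda>r j. case r of None \<Rightarrow> 0 | Some b \<Rightarrow> vec_nth (W (?t j)) b)"
  obtain v :: "complex ^ ('b option)" where v: "v \<noteq> 0"
    "\<And>r. r \<noteq> None \<Longrightarrow> (\<Sum>j\<in>UNIV. M r j * vec_nth v j) = 0"
    by (rule underdetermined_system[where M = M and k = None]) (rule that; assumption)
  define c where "c = (\<lambda>i. vec_nth v (from_nat_into (UNIV :: 'b option set) i))"
  have ct: "c (?t j) = vec_nth v j" for j
    by (simp add: c_def from_nat_into_to_nat_on_finite)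
  obtain j where "vec_nth v j \<noteq> 0" using v(1) by (auto simp: vec_eq_iff)
  then have "c (?t j) \<noteq> 0" by (simp add: ct)
  moreover have "?t j < ?N + 1"
    using to_nat_on_bij[where 'b="'b option"] unfolding N bij_betw_def by blast
  then have "?t j \<le> ?N" by simp
  ultimately have 1: "\<exists>i\<le>?N. c i \<noteq> 0" by blast
  have "(\<Sum>i\<le>?N. c i * vec_nth (W i) b) = 0" for b
  proof -
    have "0 = (\<Sum>j\<in>UNIV. vec_nth (W (?t j)) b * c (?t j))"
      using v(2)[of "Some b"] by (simp add: M_def ct)
    also have "\<dots> = (\<Sum>i<CARD('b option). vec_nth (W i) b * c i)"
      by (rule sum_UNIV_enum)
    finally show ?thesis unfolding N by (simp add: lessThan_Suc_atMost mult.commute)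
  qed
  then have "(\<Sum>i\<le>?N. c i *\<^sub>C W i) = 0"
    by (simp add: vec_eq_iff sum_component scaleC_vec_def scaleC_complex_def)
  with 1 show thesis using that by blast
qed

text \<open>One factor is divided out at a time: the n-th Taylor coefficient of f at a equals g a,
  so its vanishing permits the next division.\<close>

lemma holomorphic_vanishing_order:
  assumes f: "f holomorphic_on S" and S: "open S" "a \<in> S"
    and 0: "\<And>i. i < n \<Longrightarrow> (deriv ^^ i) f a = 0"
  shows "\<exists>g. g holomorphic_on S \<and> (\<forall>s\<in>S. f s = (s - a) ^ n * g s)"
  using 0
proof (induction n)
  case 0
  then show ?case using f by auto
next
  case (Suc n)
  then obtain g where g: "g holomorphic_on S" "\<And>s. s \<in> S \<Longrightarrow> f s = (s - a) ^ n * g s"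
    by (metis less_Suc_eq)
  have an: "g analytic_on {a}" using g(1) S by (auto simp: holomorphic_on_imp_analytic_at)
  have "fps_expansion f a = fps_expansion (\<lambda>s. g s * ((\<lambda>s. s) s - (\<lambda>s. s) a) ^ n) a"
    using eventually_nhds_in_open[OF S] by (intro fps_expansion_cong) (auto elim!: eventually_mono simp: g(2))
  also have "\<dots> = fps_X ^ n * (fps_expansion g a * fps_shift 1 (fps_expansion (\<lambda>s. s) a) ^ n)"
    by (rule fps_expansion_mult_power_vanish[OF an]) (rule analytic_intros)
  finally have "fps_nth (fps_expansion f a) n = g a"
    by (simp add: fps_X_power_mult_nth fps_nth_power_0 fps_expansion_nth_simps)
  moreover have "fps_nth (fps_expansion f a) n = 0"
    using Suc.prems[of n] by (simp add: fps_expansion_def)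
  ultimately have ga: "g a = 0" by simp
  obtain h where "h holomorphic_on S" "\<And>s. s \<in> S \<Longrightarrow> g s = g a + (s - a) * h s"
    using holomorphic_divide_root[OF g(1) S] by blast
  then show ?case using g(2) ga by (intro exI[of _ h]) (auto simp: mult_ac)
qed

text \<open>The set of points in S where the two functions differ is open and finite, hence
  empty.\<close>

lemma eq_on_open_off_finite:
  fixes f g :: "complex \<Rightarrow> complex"
  assumes "open S" "continuous_on S f" "continuous_on S g" "finite E" "\<And>s. s \<in> S - E \<Longrightarrow> f s = g s" "s \<in> S"
  shows "f s = g s"
proof (rule ccontr)
  assume "f s \<noteq> g s"
  have "open (S \<inter> (\<lambda>s. f s - g s) -` (- {0}))"
    using assms(1-3) by (intro continuous_open_preimage continuous_intros) (auto simp: open_Compl)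
  moreover have "finite (S \<inter> (\<lambda>s. f s - g s) -` (- {0}))"
    using assms(4) by (rule finite_subset[rotated]) (use assms(5) in auto)
  moreover have "s \<in> S \<inter> (\<lambda>s. f s - g s) -` (- {0})" using assms(6) \<open>f s \<noteq> g s\<close> by auto
  ultimately show False using finite_imp_not_open by blast
qed

section \<open>Sections of the normal bundle as functions, and their division by a
  coordinate\<close>

context kodaira_family
begin

text \<open>The normal section of w in the trivialisation given by pairing with the velocity of the
  curve. The trivialisation depends on c and d, but linear relations between sections at a point of
  the curve can be read off in any of them.\<close>

definition eta :: "(cp1, complex) chart \<Rightarrow> ('s, complex \<times> complex) chart \<Rightarrow> complex ^ 'b \<Rightarrow> complex \<Rightarrow> complex"
  where "eta c d w s = det2 (Gv c d s) (vv c d w s)"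

lemma eta_holomorphic: "c \<in> cp1_atlas \<Longrightarrow> d \<in> max_atlas AS \<Longrightarrow> eta c d w holomorphic_on Sset c d"
  unfolding eta_def[abs_def] by (intro holo_on_det2 holo_Gv holo_vv)

lemma eta_linear:
  assumes "c \<in> cp1_atlas" "d \<in> max_atlas AS" "s \<in> Sset c d"
  shows "eta c d (w + w') s = eta c d w s + eta c d w' s" "eta c d (k *\<^sub>C w) s = k * eta c d w s" "eta c d 0 s = 0"
  using vv_linear[OF assms] by (auto simp: eta_def det2_add det2_scaleC) (simp add: det2_def)

lemma eta_sum:
  assumes "c \<in> cp1_atlas" "d \<in> max_atlas AS" "s \<in> Sset c d"
  shows "eta c d (\<Sum>i\<in>I. k i *\<^sub>C w i) s = (\<Sum>i\<in>I. k i * eta c d (w i) s)"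
  by (induction I rule: infinite_finite_induct) (simp_all add: eta_linear[OF assms])

lemma cp1_cover:
  obtains c d s where "c \<in> cp1_atlas" "d \<in> AS" "s \<in> Sset c d" "z = chart_inv c s"
proof -
  obtain c where c: "c \<in> cp1_atlas" "z \<in> fst c" using complex_atlasD(2)[OF complex_atlas_cp1] by blast
  obtain d where d: "d \<in> AS" "F a z \<in> fst d" using complex_atlasD(2)[OF AS] by blast
  have z: "z = chart_inv c (snd c z)" using cp1_chart_inv'(3)[OF c] by simp
  then have "snd c z \<in> Sset c d" using d(2) by (simp add: Sset_def)
  then show thesis using that c(1) d(1) z by blast
qed

text \<open>By continuity the normal section vanishes everywhere; then injectivity of the Kodaira map applies.\<close>

lemma eta_zero_imp_zero:
  assumes E: "finite E"
    and 0: "\<And>c d s. c \<in> cp1_atlas \<Longrightarrow> d \<in> max_atlas AS \<Longrightarrow> s \<in> Sset c d \<Longrightarrow> chart_inv c s \<notin> E \<Longrightarrow> eta c d w s = 0"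
  shows "w = 0"
proof -
  note lift = tlift_tangent[OF AB cbmax cb(2)]
  have "normal_class AS (F a) z (xi w z) = normal_class AS (F a) z (xi 0 z)" for z
  proof -
    obtain c d s where cds: "c \<in> cp1_atlas" "d \<in> AS" "s \<in> Sset c d" "z = chart_inv c s" by (rule cp1_cover)
    have d: "d \<in> max_atlas AS" using complex_atlasD(3)[OF AS] cds(2) by blast
    have "inj (chart_inv c)" using cp1_eq_iff_same[OF cds(1)] by (simp add: inj_def)
    then have fin: "finite (chart_inv c -` E)" using E by (simp add: finite_vimageI)
    have "eta c d w s = 0"
    proof (rule eq_on_open_off_finite[OF open_Sset[OF cds(1) complex_atlasD(4)[OF AS d]]
          holomorphic_on_imp_continuous_on[OF eta_holomorphic[OF cds(1) d]] continuous_on_const fin _ cds(3)])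
      show "eta c d w s = 0" if "s \<in> Sset c d - chart_inv c -` E" for s
        using 0[OF cds(1) d, of s] that by simp
    qed
    then show ?thesis
      unfolding cds(4) xi_eq[OF cds(1) d cds(3)] normal_class_eq_iff[OF cds(1) d cds(3)]
      using eta_linear(3)[OF cds(1) d cds(3)] by (simp add: eta_def)
  qed
  then have "kodaira_map AS AB F a (tlift AB cb a w) = kodaira_map AS AB F a (tlift AB cb a 0)"
    by (simp add: kodaira_map_def xi_def fun_eq_iff)
  from inj_onD[OF bij_betw_imp_inj_on[OF bij] this lift lift]
  have "tlift AB cb a w = tlift AB cb a 0" .
  then show ?thesis by (simp add: tlift_inject[OF AB cbmax cb(2)])
qed

lemma image_Sset:
  assumes "c \<in> cp1_atlas"
  shows "snd c ` (fst c \<inter> W \<inter> F a -` fst d) = {s. chart_inv c s \<in> W \<and> s \<in> Sset c d}"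
proof (intro equalityI subsetI)
  fix s assume "s \<in> snd c ` (fst c \<inter> W \<inter> F a -` fst d)"
  then show "s \<in> {s. chart_inv c s \<in> W \<and> s \<in> Sset c d}"
    using cp1_chart_inv'(3)[OF assms] by (auto simp: Sset_def)
next
  fix s assume "s \<in> {s. chart_inv c s \<in> W \<and> s \<in> Sset c d}"
  then have "chart_inv c s \<in> fst c \<inter> W \<inter> F a -` fst d" "s = snd c (chart_inv c s)"
    using cp1_chart_inv'(1,2)[OF assms] by (auto simp: Sset_def)
  then show "s \<in> snd c ` (fst c \<inter> W \<inter> F a -` fst d)" by (rule rev_image_eqI)
qed

lemma open_image_Sset:
  assumes c: "c \<in> cp1_atlas" and d: "d \<in> max_atlas AS" and W: "open W"
  shows "open {s. chart_inv c s \<in> W \<and> s \<in> Sset c d}"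
proof -
  have "open (chart_inv c -` W \<inter> Sset c d)"
    using W c open_Sset[OF c complex_atlasD(4)[OF AS d]] by (auto simp: open_cp1_iff)
  moreover have "chart_inv c -` W \<inter> Sset c d = {s. chart_inv c s \<in> W \<and> s \<in> Sset c d}" by auto
  ultimately show ?thesis by simp
qed

lemma AS_max: "d \<in> AS \<Longrightarrow> d \<in> max_atlas AS"
  using complex_atlasD(3)[OF AS] by blast

text \<open>Represents the product of a section with a rational function r away from the poles of
  r.\<close>

lemma field_scaled_xi:
  assumes W: "open W" and r: "\<And>c. c \<in> cp1_atlas \<Longrightarrow> (\<lambda>s. r (chart_inv c s)) holomorphic_on {s. chart_inv c s \<in> W}"
  shows "holo_field_along AS (F a) W (\<lambda>z e. r z *\<^sub>C xi w z e)"
  unfolding holo_field_along_def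
proof (intro conjI ballI)
  fix z assume "z \<in> W"
  obtain c d s where cds: "c \<in> cp1_atlas" "d \<in> AS" "s \<in> Sset c d" "z = chart_inv c s" by (rule cp1_cover)
  have p: "F a z \<in> fst d" using cds by (simp add: Sset_def)
  show "(\<lambda>e. r z *\<^sub>C xi w z e) \<in> tangent_space AS (F a z)"
    using tlift_tangent[OF AS AS_max[OF cds(2)] p, of "r z *\<^sub>C vv c d w s"]
    unfolding tlift_scaleC[OF AS AS_max[OF cds(2)] p] xi_eq[OF cds(1) AS_max[OF cds(2)] cds(3), folded cds(4)] .
next
  fix c d assume c: "c \<in> cp1_atlas" and d: "d \<in> AS"
  note dm = AS_max[OF d]
  let ?S = "{s. chart_inv c s \<in> W \<and> s \<in> Sset c d}"
  have v: "holo_on ?S (vv c d w)" using holo_vv[OF c dm] by (rule holo_on_subset) auto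
  have "(\<lambda>s. r (chart_inv c s)) holomorphic_on ?S" using r[OF c] by (rule holomorphic_on_subset) auto
  then have "holo_on ?S (\<lambda>s. (r (chart_inv c s) * fst (vv c d w s), r (chart_inv c s) * snd (vv c d w s)))"
    using v by (intro holo_on_Pair holomorphic_holo_on open_image_Sset[OF c dm W] holomorphic_on_mult
        holo_on_holomorphic[OF holo_on_fst] holo_on_holomorphic[OF holo_on_snd])
  then have "holo_on ?S (\<lambda>s. r (chart_inv c s) *\<^sub>C xi w (chart_inv c s) d)"
  proof (rule holo_on_cong[OF open_image_Sset[OF c dm W]])
    fix s assume s: "s \<in> ?S"
    then have "F a (chart_inv c s) \<in> fst d" "s \<in> Sset c d" by (auto simp: Sset_def)
    then have "xi w (chart_inv c s) d = vv c d w s"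
      using xi_eq[OF c dm] tlift_self[OF AS d] by simp
    then show "(r (chart_inv c s) * fst (vv c d w s), r (chart_inv c s) * snd (vv c d w s)) = r (chart_inv c s) *\<^sub>C xi w (chart_inv c s) d"
      by (simp add: scaleC_prod_def scaleC_complex_def)
  qed
  then show "holo_on (snd c ` (fst c \<inter> W \<inter> F a -` fst d)) (\<lambda>t. r (chart_inv c t) *\<^sub>C xi w (chart_inv c t) d)"
    unfolding image_Sset[OF c] .
qed

text \<open>Provides the quotient section near the pole, where it is known only through components
  in one chart d. Holomorphy in every other chart comes from differentiating the change of
  coordinates along the curve.\<close>

lemma field_tlift:
  assumes c: "c \<in> cp1_atlas" and d: "d \<in> max_atlas AS" and D: "open D" "D \<subseteq> Sset c d" and k: "holo_on D k"
  shows "holo_field_along AS (F a) (chart_inv c ` D) (\<lambda>z. tlift AS d (F a z) (k (snd c z)))"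
  unfolding holo_field_along_def
proof (intro conjI ballI)
  fix z assume "z \<in> chart_inv c ` D"
  then have "F a z \<in> fst d" using D(2) by (auto simp: Sset_def)
  then show "tlift AS d (F a z) (k (snd c z)) \<in> tangent_space AS (F a z)" by (rule tlift_tangent[OF AS d])
next
  fix c' e assume c': "c' \<in> cp1_atlas" and e: "e \<in> AS"
  let ?W = "chart_inv c ` D"
  let ?S = "{s. chart_inv c' s \<in> ?W \<and> s \<in> Sset c' e}"
  define \<sigma> where "\<sigma> = (\<lambda>s. snd c (chart_inv c' s))"
  have W: "open ?W" by (rule cp1_open_image[OF c D(1)])
  have oS: "open ?S" by (rule open_image_Sset[OF c' AS_max[OF e] W])
  have \<sigma>D: "\<sigma> s \<in> D" "chart_inv c (\<sigma> s) = chart_inv c' s" if "s \<in> ?S" for s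
    using that cp1_chart_inv'(2)[OF c] by (auto simp: \<sigma>_def)
  have "compatible c' c" using complex_atlas_cp1 c c' unfolding complex_atlas_def by blast
  then have "holo_on (snd c' ` (fst c' \<inter> fst c)) (snd c \<circ> chart_inv c')" by (simp add: compatible_def)
  moreover have "?S \<subseteq> snd c' ` (fst c' \<inter> fst c)"
  proof
    fix s assume "s \<in> ?S"
    then have "chart_inv c' s \<in> fst c' \<inter> fst c" "s = snd c' (chart_inv c' s)"
      using cp1_chart_inv'(1,2)[OF c'] cp1_chart_inv'(1)[OF c] by auto
    then show "s \<in> snd c' ` (fst c' \<inter> fst c)" by (rule rev_image_eqI)
  qed
  ultimately have \<sigma>: "holo_on ?S \<sigma>" unfolding \<sigma>_def o_def by (rule holo_on_subset)
  have comp: "compatible d e" using d e unfolding max_atlas_def by blast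
  note chd = complex_atlasD(4)[OF AS d] and che = complex_atlasD(1)[OF AS e]
  have T: "open (snd d ` (fst d \<inter> fst e))" "holo_on (snd d ` (fst d \<inter> fst e)) (snd e \<circ> chart_inv d)"
    using comp open_chart_image[OF chd chart_facts(1)[OF che]] by (auto simp: compatible_def)
  define \<gamma> where "\<gamma> = (\<lambda>s. Psi c d (\<beta>0, \<sigma> s))"
  have \<gamma>: "\<gamma> s = snd d (F a (chart_inv c' s))" if "s \<in> ?S" for s
    using \<sigma>D[OF that] by (simp add: \<gamma>_def Psi_def base(2))
  have "holo_on ?S \<gamma>"
    unfolding \<gamma>_def
  proof (rule holo_on_compose[OF holo_on_Pair[OF holo_on_const \<sigma>] Psi_holo[OF c d]])
    show "(\<beta>0, \<sigma> s) \<in> Om c d" if "s \<in> ?S" for s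
      unfolding Sset_iff[symmetric] using \<sigma>D(1)[OF that] D(2) by blast
  qed
  moreover have "holo_on ?S (\<lambda>s. k (\<sigma> s))"
    by (rule holo_on_compose[OF \<sigma> k]) (rule \<sigma>D)
  moreover have pd: "F a (chart_inv c' s) \<in> fst d \<inter> fst e" if "s \<in> ?S" for s
    using \<sigma>D[OF that] D(2) that by (auto simp: Sset_def)
  ultimately have "holo_on ?S (\<lambda>s. frechet_derivative (snd e \<circ> chart_inv d) (at (\<gamma> s)) (k (\<sigma> s)))"
    using \<gamma> by (intro holo_on_derivative_along[OF T oS]) auto
  then have "holo_on ?S (\<lambda>s. tlift AS d (F a (chart_inv c' s)) (k (snd c (chart_inv c' s))) e)"
  proof (rule holo_on_cong[OF oS])
    fix s assume s: "s \<in> ?S"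
    then show "frechet_derivative (snd e \<circ> chart_inv d) (at (\<gamma> s)) (k (\<sigma> s)) =
        tlift AS d (F a (chart_inv c' s)) (k (snd c (chart_inv c' s))) e"
      using \<gamma>[OF s] pd[OF s] e by (simp add: tlift_def transition_def \<sigma>_def)
  qed
  then show "holo_on (snd c' ` (fst c' \<inter> ?W \<inter> F a -` fst e)) (\<lambda>t. tlift AS d (F a (chart_inv c' t)) (k (snd c (chart_inv c' t))) e)"
    unfolding image_Sset[OF c'] .
qed

text \<open>The quotient of the normal section given by \<open>w\<close> by the local coordinate extends to a global
  normal section, which comes from some \<open>w'\<close> by surjectivity of the Kodaira map.\<close>

lemma divide_normal_section:
  assumes c: "c \<in> cp1_atlas" and d: "d \<in> max_atlas AS" and s0: "s0 \<in> Sset c d"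
    and G0: "fst (Gv c d s0) \<noteq> 0" and w0: "eta c d w s0 = 0"
  obtains w' where "\<And>c' e s. c' \<in> cp1_atlas \<Longrightarrow> e \<in> max_atlas AS \<Longrightarrow> s \<in> Sset c' e \<Longrightarrow>
      chart_inv c' s \<noteq> chart_inv c s0 \<Longrightarrow> eta c' e w' s = cp1_pole c s0 (chart_inv c' s) * eta c' e w s"
proof -
  let ?z = "chart_inv c s0" and ?R = "cp1_pole c s0" and ?NC = "normal_class AS (F a)"
  define D where "D = {s \<in> Sset c d. fst (Gv c d s) \<noteq> 0}"
  note oS = open_Sset[OF c complex_atlasD(4)[OF AS d]]
  have G: "(\<lambda>s. fst (Gv c d s)) holomorphic_on Sset c d"
    by (rule holo_on_holomorphic[OF holo_on_fst[OF holo_Gv[OF c d]]])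
  have D: "open D" "D \<subseteq> Sset c d" "s0 \<in> D"
  proof -
    have "open (Sset c d \<inter> (\<lambda>s. fst (Gv c d s)) -` (- {0}))"
      using holomorphic_on_imp_continuous_on[OF G] oS by (intro continuous_open_preimage) (auto simp: open_Compl)
    moreover have "Sset c d \<inter> (\<lambda>s. fst (Gv c d s)) -` (- {0}) = D" by (auto simp: D_def)
    ultimately show "open D" by simp
  qed (use s0 G0 in \<open>auto simp: D_def\<close>)
  define h where "h = (\<lambda>s. eta c d w s / fst (Gv c d s))"
  have "h holomorphic_on D"
    unfolding h_def using G eta_holomorphic[OF c d] D(2)
    by (intro holomorphic_on_divide) (auto intro: holomorphic_on_subset simp: D_def)
  then obtain k where k: "k holomorphic_on D" "\<And>s. s \<in> D \<Longrightarrow> h s = h s0 + (s - s0) * k s"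
    using holomorphic_divide_root D(1,3) by blast
  have hk: "h s = (s - s0) * k s" if "s \<in> D" for s using k(2)[OF that] w0 by (simp add: h_def)
  \<comment> \<open>A vertical representative: \<open>det2 (Gv c d s) (0, k s)\<close> is
    \<open>fst (Gv c d s)\<close> times k s, which explains the denominator in h.\<close>
  define K where "K = (\<lambda>s. (0 :: complex, k s))"
  have K: "holo_on D K" unfolding K_def by (intro holo_on_Pair holo_on_const holomorphic_holo_on D(1) k(1))
  \<comment> \<open>At the point s0 the scaled field is meaningless, and K supplies the value. The
    fact \<open>near\<close> below shows that K describes \<nu> on all of D, so the two pieces are
    glued holomorphically.\<close>
  define \<nu> where "\<nu> = (\<lambda>z. if z = ?z then ?NC z (tlift AS d (F a z) (K s0)) else ?NC z (\<lambda>e. ?R z *\<^sub>C xi w z e))"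
  have scaled: "(\<lambda>e. ?R (chart_inv c' s) *\<^sub>C xi w (chart_inv c' s) e) =
      tlift AS e' (F a (chart_inv c' s)) (?R (chart_inv c' s) *\<^sub>C vv c' e' w s)"
    if "c' \<in> cp1_atlas" "e' \<in> max_atlas AS" "s \<in> Sset c' e'" for c' e' s
  proof -
    have "F a (chart_inv c' s) \<in> fst e'" using that by (simp add: Sset_def)
    then show ?thesis unfolding xi_eq[OF that] by (rule tlift_scaleC[OF AS that(2), symmetric])
  qed
  have near: "\<nu> (chart_inv c s) = ?NC (chart_inv c s) (tlift AS d (F a (chart_inv c s)) (K s))" if s: "s \<in> D" for s
  proof (cases "s = s0")
    case False
    then have "chart_inv c s \<noteq> ?z" using cp1_eq_iff_same[OF c] by simp
    moreover have sS: "s \<in> Sset c d" using s D(2) by blast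
    have "eta c d w s = (s - s0) * k s * fst (Gv c d s)"
      using hk[OF s] s by (simp add: h_def D_def field_simps)
    then have "det2 (Gv c d s) (?R (chart_inv c s) *\<^sub>C vv c d w s) = det2 (Gv c d s) (K s)"
      using False by (simp add: cp1_pole_chart[OF c] det2_scaleC eta_def[symmetric]) (simp add: det2_def K_def)
    ultimately show ?thesis
      unfolding \<nu>_def scaled[OF c d sS] by (simp add: normal_class_eq_iff[OF c d sS])
  qed (simp add: \<nu>_def)
  have "normal_section AS (F a) UNIV \<nu>"
    unfolding normal_section_def
  proof
    fix z0
    show "\<exists>W' \<xi>. open W' \<and> z0 \<in> W' \<and> W' \<subseteq> UNIV \<and> holo_field_along AS (F a) W' \<xi> \<and>
        (\<forall>z\<in>W'. \<nu> z = ?NC z (\<xi> z))"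
    proof (cases "z0 = ?z")
      case True
      have "\<forall>z\<in>chart_inv c ` D. \<nu> z = ?NC z (tlift AS d (F a z) (K (snd c z)))"
        using near cp1_chart_inv'(2)[OF c] by auto
      then show ?thesis
        using field_tlift[OF c d D(1,2) K] cp1_open_image[OF c D(1)] D(3) True by blast
    next
      case False
      have "holo_field_along AS (F a) (- {?z}) (\<lambda>z e. ?R z *\<^sub>C xi w z e)"
        using cp1_pole_holomorphic[OF c] by (intro field_scaled_xi open_cp1_delete) simp
      moreover have "\<forall>z\<in>- {?z}. \<nu> z = ?NC z (\<lambda>e. ?R z *\<^sub>C xi w z e)" by (simp add: \<nu>_def)
      ultimately show ?thesis using open_cp1_delete False by blast
    qed
  qed
  then obtain \<tau> where \<tau>: "\<tau> \<in> tangent_space AB a" "kodaira_map AS AB F a \<tau> = \<nu>"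
    using bij unfolding bij_betw_def by (metis (mono_tags, lifting) imageE mem_Collect_eq)
  obtain w' where w': "\<tau> = tlift AB cb a w'" using tangent_tlift_ex[OF AB cbmax cb(2) \<tau>(1)] by blast
  show thesis
  proof (rule that)
    fix c' e s assume A: "c' \<in> cp1_atlas" "e \<in> max_atlas AS" "s \<in> Sset c' e" "chart_inv c' s \<noteq> ?z"
    have "?NC (chart_inv c' s) (xi w' (chart_inv c' s)) = \<nu> (chart_inv c' s)"
      using \<tau>(2) by (auto simp: w' kodaira_map_def xi_def)
    also have "\<dots> = ?NC (chart_inv c' s) (\<lambda>e. ?R (chart_inv c' s) *\<^sub>C xi w (chart_inv c' s) e)"
      using A(4) by (simp add: \<nu>_def)
    also have "\<dots> = ?NC (chart_inv c' s) (tlift AS e (F a (chart_inv c' s)) (?R (chart_inv c' s) *\<^sub>C vv c' e w s))"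
      unfolding scaled[OF A(1-3)] ..
    finally show "eta c' e w' s = ?R (chart_inv c' s) * eta c' e w s"
      unfolding xi_eq[OF A(1-3)] normal_class_eq_iff[OF A(1-3)]
      by (simp add: eta_def det2_scaleC)
  qed
qed

end

lemma cp1_second_chart:
  assumes "c \<in> cp1_atlas"
  shows "\<exists>c'\<in>cp1_atlas. c' \<noteq> c"
proof -
  have "Fin 0 \<in> fst cp1_fin" "Fin 0 \<notin> fst cp1_inf" by simp_all
  then have "cp1_fin \<noteq> cp1_inf" by metis
  moreover have "cp1_fin \<in> cp1_atlas" "cp1_inf \<in> cp1_atlas" unfolding cp1_atlas_def by blast+
  ultimately show ?thesis by metis
qed

context kodaira_family
begin

text \<open>With the denominator, the normal displacement is measured along the lines x = const:
  this is the variation of y at fixed x, hence the function that enters the linearization.\<close>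

definition hh :: "(cp1, complex) chart \<Rightarrow> ('s, complex \<times> complex) chart \<Rightarrow> complex ^ 'b \<Rightarrow> complex \<Rightarrow> complex"
  where "hh c d w s = eta c d w s / fst (Gv c d s)"

text \<open>All normal bundles in the family are \<open>\<O>(n)\<close>, in the following concrete form. A nonzero
  section vanishing to order \<open>n\<close> at a given point exists since there are \<open>n + 1\<close> parameters. It
  may be divided by the powers \<open>(s - s0) ^ i\<close>, \<open>i \<le> n\<close>; if the order of vanishing were larger
  then one more division would give \<open>n + 2\<close> independent sections.\<close>

lemma normal_sections_powers:
  assumes c: "c \<in> cp1_atlas" and d: "d \<in> max_atlas AS" and s0: "s0 \<in> Sset c d"
    and G0: "fst (Gv c d s0) \<noteq> 0" and n: "CARD('b) = n + 1"
  obtains W e r where "r > 0" "ball s0 r \<subseteq> Sset c d" "\<And>s. s \<in> ball s0 r \<Longrightarrow> fst (Gv c d s) \<noteq> 0"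
    "e holomorphic_on ball s0 r" "\<And>s. s \<in> ball s0 r \<Longrightarrow> e s \<noteq> 0"
    "\<And>i s. i \<le> n \<Longrightarrow> s \<in> ball s0 r \<Longrightarrow> hh c d (W i) s = (s - s0) ^ i * e s"
proof -
  let ?z = "chart_inv c s0" and ?R = "cp1_pole c s0"
  define D where "D = {s \<in> Sset c d. fst (Gv c d s) \<noteq> 0}"
  note oS = open_Sset[OF c complex_atlasD(4)[OF AS d]]
  have G: "(\<lambda>s. fst (Gv c d s)) holomorphic_on Sset c d"
    by (rule holo_on_holomorphic[OF holo_on_fst[OF holo_Gv[OF c d]]])
  have D: "open D" "D \<subseteq> Sset c d" "s0 \<in> D"
  proof -
    have "open (Sset c d \<inter> (\<lambda>s. fst (Gv c d s)) -` (- {0}))"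
      using holomorphic_on_imp_continuous_on[OF G] oS by (intro continuous_open_preimage) (auto simp: open_Compl)
    moreover have "Sset c d \<inter> (\<lambda>s. fst (Gv c d s)) -` (- {0}) = D" by (auto simp: D_def)
    ultimately show "open D" by simp
  qed (use s0 G0 in \<open>auto simp: D_def\<close>)
  have hol: "hh c d w holomorphic_on D" for w
    unfolding hh_def[abs_def] using G eta_holomorphic[OF c d] D(2)
    by (intro holomorphic_on_divide) (auto intro: holomorphic_on_subset simp: D_def)
  have evD: "eventually (\<lambda>s. s \<in> D) (nhds s0)" using eventually_nhds_in_open[OF D(1,3)] .
  have add: "(deriv ^^ i) (hh c d (v + w)) s0 = (deriv ^^ i) (hh c d v) s0 + (deriv ^^ i) (hh c d w) s0" for i v w
  proof -
    have "(deriv ^^ i) (hh c d (v + w)) s0 = (deriv ^^ i) (\<lambda>s. hh c d v s + hh c d w s) s0"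
      using evD by (intro higher_deriv_cong_ev)
        (auto elim!: eventually_mono simp: D_def hh_def eta_linear(1)[OF c d] add_divide_distrib)
    then show ?thesis using higher_deriv_add[OF hol hol D(1,3)] by simp
  qed
  have scale: "(deriv ^^ i) (hh c d (k *\<^sub>C v)) s0 = k * (deriv ^^ i) (hh c d v) s0" for i k v
  proof -
    have "(deriv ^^ i) (hh c d (k *\<^sub>C v)) s0 = (deriv ^^ i) (\<lambda>s. k * hh c d v s) s0"
      using evD by (intro higher_deriv_cong_ev)
        (auto elim!: eventually_mono simp: D_def hh_def eta_linear(2)[OF c d])
    then show ?thesis using higher_deriv_cmult[OF hol D(3,1)] by simp
  qed
  obtain w where w: "w \<noteq> 0" "\<And>i. i < n \<Longrightarrow> (deriv ^^ i) (hh c d w) s0 = 0"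
    by (rule common_kernel_vector[of n "\<lambda>i w. (deriv ^^ i) (hh c d w) s0", OF n add scale]) (rule that; assumption)
  obtain g where g: "g holomorphic_on D" "\<And>s. s \<in> D \<Longrightarrow> hh c d w s = (s - s0) ^ n * g s"
    using holomorphic_vanishing_order[OF hol D(1,3) w(2)] by blast
  \<comment> \<open>\<open>quot i w'\<close> says that the section of w' is that of w divided by the
    i-th power of s - s0, on the whole curve and in all charts, with the point s0 left out.\<close>
  define quot where "quot = (\<lambda>i w'. \<forall>c'\<in>cp1_atlas. \<forall>e\<in>max_atlas AS. \<forall>s\<in>Sset c' e.
      chart_inv c' s \<noteq> ?z \<longrightarrow> eta c' e w' s = ?R (chart_inv c' s) ^ i * eta c' e w s)"
  have near: "hh c d w' s = (s - s0) ^ (n - i) * g s" if "quot i w'" "i \<le> n" "s \<in> D" for i w' s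
  proof (rule eq_on_open_off_finite[OF D(1) _ _ _ _ that(3)])
    show "continuous_on D (hh c d w')" using hol by (rule holomorphic_on_imp_continuous_on)
    show "continuous_on D (\<lambda>s. (s - s0) ^ (n - i) * g s)"
      using g(1) by (intro continuous_intros holomorphic_on_imp_continuous_on)
    show "hh c d w' s = (s - s0) ^ (n - i) * g s" if s: "s \<in> D - {s0}" for s
    proof -
      have "chart_inv c s \<noteq> ?z" using s cp1_eq_iff_same[OF c] by simp
      then have "eta c d w' s = (1 / (s - s0)) ^ i * eta c d w s"
        using \<open>quot i w'\<close> c d s D(2) unfolding quot_def by (metis DiffD1 cp1_pole_chart subsetD)
      then have "hh c d w' s = (1 / (s - s0)) ^ i * hh c d w s" by (simp add: hh_def)
      also have "\<dots> = (1 / (s - s0)) ^ i * ((s - s0) ^ (n - i) * (s - s0) ^ i) * g s"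
        using g(2)[of s] s \<open>i \<le> n\<close> by (simp add: power_add[symmetric])
      also have "\<dots> = (s - s0) ^ (n - i) * g s"
        using s by (simp add: power_divide)
      finally show ?thesis .
    qed
  qed simp
  \<comment> \<open>The last condition holds for i < n because of the power of zero, and for i = n
    only if g vanishes at s0; that case is needed for the contradiction below.\<close>
  have step: "\<exists>w''. quot (Suc i) w''" if "quot i w'" "i \<le> n" "(s0 - s0) ^ (n - i) * g s0 = 0" for i w'
  proof -
    have "hh c d w' s0 = 0" using near[OF that(1,2) D(3)] that(3) by simp
    then have "eta c d w' s0 = 0" using G0 by (simp add: hh_def)
    then obtain w'' where w'': "\<And>c' e s. c' \<in> cp1_atlas \<Longrightarrow> e \<in> max_atlas AS \<Longrightarrow> s \<in> Sset c' e \<Longrightarrow>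
      chart_inv c' s \<noteq> ?z \<Longrightarrow> eta c' e w'' s = ?R (chart_inv c' s) * eta c' e w' s"
      by (rule divide_normal_section[OF c d s0 G0]) (rule that; assumption)
    have "quot (Suc i) w''"
      unfolding quot_def using w'' that(1)[unfolded quot_def] by simp
    then show ?thesis ..
  qed
  have ex: "\<exists>w'. quot i w'" if "i \<le> n" for i
    using that
  proof (induction i)
    case 0
    have "quot 0 w" by (simp add: quot_def)
    then show ?case ..
  next
    case (Suc i)
    then obtain w' where "quot i w'" by auto
    then show ?case using step[of i w'] Suc.prems by simp
  qed
  have g0: "g s0 \<noteq> 0"
  proof
    assume "g s0 = 0"
    obtain w1 where w1: "quot n w1" using ex[of n] by blast
    have "(s0 - s0) ^ (n - n) * g s0 = 0" using \<open>g s0 = 0\<close> by simp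
    then have last: "\<exists>w'. quot (Suc n) w'" using step[OF w1] by blast
    have ex': "\<exists>w'. quot i w'" if "i \<le> n + 1" for i
    proof (cases "i = Suc n")
      case True
      then show ?thesis using last by simp
    next
      case False
      then show ?thesis using that by (intro ex) simp
    qed
    define Q where "Q = (\<lambda>i. SOME w'. quot i w')"
    have Q: "quot i (Q i)" if "i \<le> n + 1" for i
      unfolding Q_def using ex'[OF that] by (rule someI_ex)
    obtain k where k: "\<exists>i\<le>n + 1. k i \<noteq> 0" "(\<Sum>i\<le>n + 1. k i *\<^sub>C Q i) = 0"
      using linear_dependence_relation[of Q] unfolding n by blast
    \<comment> \<open>A linear relation between the sections of Q 0, ..., Q (n + 1) says that P
      evaluated at the pole function annihilates the section of w. Off finitely many points this
      forces that section to vanish.\<close>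
    define P where "P = (\<Sum>i\<le>n + 1. monom (k i) i)"
    have coeffP: "coeff P i = (if i \<le> n + 1 then k i else 0)" for i
      by (simp add: P_def coeff_sum)
    have "P \<noteq> 0" using k(1) coeffP by (metis coeff_0)
    then have fin: "finite {x. poly P x = 0}" by (rule poly_roots_finite)
    have polyP: "poly P x = (\<Sum>i\<le>n + 1. k i * x ^ i)" for x
      by (simp add: P_def poly_sum poly_monom)
    define E where "E = insert ?z {z. z \<noteq> ?z \<and> poly P (?R z) = 0}"
    \<comment> \<open>The pole function takes no value twice, 0 being taken only at the point
      missing from c. Hence the roots of P account for finitely many points of the curve.\<close>
    have "inj_on ?R (- {?z})"
    proof (rule inj_onI)
      fix x y assume xy: "x \<in> - {?z}" "y \<in> - {?z}" "?R x = ?R y"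
      obtain c' where c': "c' \<in> cp1_atlas" "c' \<noteq> c" using cp1_second_chart[OF c] by blast
      have *: "(\<exists>s. s \<noteq> s0 \<and> u = chart_inv c s \<and> ?R u = 1 / (s - s0)) \<or> (u = chart_inv c' 0 \<and> ?R u = 0)"
        if "u \<noteq> ?z" for u
      proof (cases "u \<in> fst c")
        case True
        then have u: "u = chart_inv c (snd c u)" using cp1_chart_inv'(3)[OF c] by simp
        then have "snd c u \<noteq> s0" using that by auto
        then show ?thesis using u cp1_pole_chart[OF c, of s0 "snd c u"] by metis
      next
        case False
        then show ?thesis using cp1_other_chart(2)[OF c c'(1)] c'(2) by (auto simp: cp1_pole_def)
      qed
      have x: "x \<noteq> ?z" and y: "y \<noteq> ?z" using xy by auto
      show "x = y"
        using *[OF x] *[OF y] xy(3) by auto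
    qed
    then have "finite (?R -` {x. poly P x = 0} \<inter> - {?z})"
      by (rule finite_vimage_IntI[OF fin])
    then have "finite E"
      unfolding E_def by (rule finite_insert[THEN iffD2, OF finite_subset[rotated]]) auto
    moreover have "eta c' e w s = 0" if A: "c' \<in> cp1_atlas" "e \<in> max_atlas AS" "s \<in> Sset c' e" "chart_inv c' s \<notin> E" for c' e s
    proof -
      have nz: "chart_inv c' s \<noteq> ?z" "poly P (?R (chart_inv c' s)) \<noteq> 0" using A(4) by (auto simp: E_def)
      have "0 = eta c' e (\<Sum>i\<le>n + 1. k i *\<^sub>C Q i) s" using k(2) eta_linear(3)[OF A(1-3)] by simp
      also have "\<dots> = (\<Sum>i\<le>n + 1. k i * eta c' e (Q i) s)" by (rule eta_sum[OF A(1-3)])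
      also have "\<dots> = (\<Sum>i\<le>n + 1. k i * ?R (chart_inv c' s) ^ i * eta c' e w s)"
        using Q A(1-3) nz(1) unfolding quot_def by (intro sum.cong) auto
      also have "\<dots> = poly P (?R (chart_inv c' s)) * eta c' e w s"
        unfolding polyP sum_distrib_right ..
      finally show ?thesis using nz(2) by simp
    qed
    ultimately have "w = 0" by (rule eta_zero_imp_zero)
    with w(1) show False by simp
  qed
  have "continuous_on D g" using g(1) by (rule holomorphic_on_imp_continuous_on)
  then have "open (D \<inter> g -` (- {0}))" using D(1) by (intro continuous_open_preimage) (auto simp: open_Compl)
  moreover have "s0 \<in> D \<inter> g -` (- {0})" using D(3) g0 by simp
  ultimately obtain r where r: "r > 0" "ball s0 r \<subseteq> D \<inter> g -` (- {0})" using openE by blast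
  define Q where "Q = (\<lambda>i. SOME w'. quot i w')"
  have Q: "quot i (Q i)" if "i \<le> n" for i
    unfolding Q_def using ex[OF that] by (rule someI_ex)
  show thesis
  \<comment> \<open>The numbering is reversed: dividing w by the power n - i leaves a zero of order
    i.\<close>
  proof (rule that[of r g "\<lambda>i. Q (n - i)"])
    show "ball s0 r \<subseteq> Sset c d" using r(2) D(2) by blast
    show "fst (Gv c d s) \<noteq> 0" "g s \<noteq> 0" if "s \<in> ball s0 r" for s using that r(2) by (auto simp: D_def)
    show "g holomorphic_on ball s0 r" using g(1) r(2) holomorphic_on_subset by blast
    show "hh c d (Q (n - i)) s = (s - s0) ^ i * g s" if "i \<le> n" "s \<in> ball s0 r" for i s
    proof -
      have "s \<in> D" using that(2) r(2) by blast
      then show ?thesis using near[OF Q[of "n - i"], of s] that(1) by simp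
    qed
  qed (rule r(1))
qed

end

section \<open>Jets of the curves\<close>

context kodaira_family
begin

text \<open>With \<open>YY\<close>, the coordinates of the one-parameter subfamily with parameter
  value \<beta>0 + t w, written as base point plus t times a fixed direction so that
  \<open>holo2_along\<close> applies.\<close>

definition XX :: "(cp1, complex) chart \<Rightarrow> ('s, complex \<times> complex) chart \<Rightarrow> complex ^ 'b \<Rightarrow> complex \<Rightarrow> complex \<Rightarrow> complex"
  where "XX c d w t s = fst (Psi c d ((\<beta>0, s) + t *\<^sub>C (w, 0)))"

definition YY :: "(cp1, complex) chart \<Rightarrow> ('s, complex \<times> complex) chart \<Rightarrow> complex ^ 'b \<Rightarrow> complex \<Rightarrow> complex \<Rightarrow> complex"
  where "YY c d w t s = snd (Psi c d ((\<beta>0, s) + t *\<^sub>C (w, 0)))"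

definition bb :: "complex ^ 'b \<Rightarrow> complex \<Rightarrow> 'm"
  where "bb w t = chart_inv cb (\<beta>0 + t *\<^sub>C w)"

lemma XX_YY_chart:
  "(XX c d w t s, YY c d w t s) = snd d (F (bb w t) (chart_inv c s))"
  by (simp add: XX_def YY_def bb_def Psi_def scaleC_prod_def)

lemma XX_YY_Om:
  "(\<beta>0, s) + t *\<^sub>C (w, 0) \<in> Om c d \<longleftrightarrow>
     \<beta>0 + t *\<^sub>C w \<in> snd cb ` fst cb \<and> bb w t \<in> V \<and> F (bb w t) (chart_inv c s) \<in> fst d"
  by (simp add: Om_def bb_def scaleC_prod_def)

lemma bb_0 [simp]: "bb w 0 = a"
  by (simp add: bb_def base(2))

lemma XX_0: "XX c d w 0 s = fst (Psi c d (\<beta>0, s))" "YY c d w 0 s = snd (Psi c d (\<beta>0, s))"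
  by (simp_all add: XX_def YY_def)

lemma graph_function_eq:
  assumes c: "c \<in> cp1_atlas" and b: "b \<in> V" and L: "L b = range (F b)"
    and gr: "graph_at d (L b) (F b (chart_inv c s0)) Z"
  obtains B T where "open B" "s0 \<in> B" "open T" "Z holomorphic_on T"
    "\<And>s. s \<in> B \<Longrightarrow> F b (chart_inv c s) \<in> fst d \<and> fst (snd d (F b (chart_inv c s))) \<in> T \<and>
       snd (snd d (F b (chart_inv c s))) = Z (fst (snd d (F b (chart_inv c s))))"
proof -
  obtain N I where NI: "open N" "F b (chart_inv c s0) \<in> N" "N \<subseteq> fst d" "open I" "Z holomorphic_on I"
    "snd d ` (L b \<inter> N) = (\<lambda>x. (x, Z x)) ` I"
    using gr unfolding graph_at_def by blast
  have "continuous_on UNIV (F b)" using emb[OF b] by (simp add: cp1_embedding_def holo_map_on_def)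
  then have "continuous_on UNIV (\<lambda>s. F b (chart_inv c s))"
    by (rule continuous_on_compose2[OF _ cp1_continuous_chart_inv[OF c]]) simp
  then have "open ((\<lambda>s. F b (chart_inv c s)) -` N)"
    using NI(1) continuous_on_open_vimage[of UNIV "\<lambda>s. F b (chart_inv c s)"] by auto
  moreover have "F b (chart_inv c s) \<in> fst d \<and> fst (snd d (F b (chart_inv c s))) \<in> I \<and>
      snd (snd d (F b (chart_inv c s))) = Z (fst (snd d (F b (chart_inv c s))))"
    if "s \<in> (\<lambda>s. F b (chart_inv c s)) -` N" for s
  proof -
    have "F b (chart_inv c s) \<in> L b \<inter> N" using that L by simp
    then have "snd d (F b (chart_inv c s)) \<in> (\<lambda>x. (x, Z x)) ` I" unfolding NI(6)[symmetric] by (rule imageI)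
    then show ?thesis using NI(3) that by auto
  qed
  ultimately show thesis using NI(2,4,5) by (intro that[of "(\<lambda>s. F b (chart_inv c s)) -` N" I]) auto
qed

text \<open>The embedded curve meets a small neighbourhood of a point in one branch only, since the rest
  of the curve is compact.\<close>

lemma graph_at_exists:
  assumes c: "c \<in> cp1_atlas" and b: "b \<in> V" and L: "L b = range (F b)" and d: "is_chart d"
    and B: "open B" "s0 \<in> B" "\<And>s. s \<in> B \<Longrightarrow> F b (chart_inv c s) \<in> fst d"
    and X: "X holomorphic_on B" "deriv X s0 \<noteq> 0" and Y: "Y holomorphic_on B"
    and XY: "\<And>s. s \<in> B \<Longrightarrow> (X s, Y s) = snd d (F b (chart_inv c s))"
  shows "\<exists>Z. graph_at d (L b) (F b (chart_inv c s0)) Z"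
proof -
  obtain r where r: "r > 0" "ball s0 r \<subseteq> B" "inj_on X (ball s0 r)"
    using has_complex_derivative_locally_injective[OF X(1) B(2,1) X(2)] by blast
  let ?D = "ball s0 r"
  have XD: "X holomorphic_on ?D" "Y holomorphic_on ?D" using X(1) Y r(2) holomorphic_on_subset by blast+
  obtain g where g: "g holomorphic_on X ` ?D" "\<And>z. z \<in> ?D \<Longrightarrow> g (X z) = z"
    using holomorphic_has_inverse[OF XD(1) open_ball r(3)] by metis
  have I: "open (X ` ?D)" using open_mapping_thm3[OF XD(1) open_ball r(3)] .
  let ?Z = "\<lambda>x. Y (g x)"
  have Z: "?Z holomorphic_on X ` ?D"
  proof -
    have "g ` X ` ?D \<subseteq> ?D" using g(2) by (auto simp del: mem_ball)
    then show ?thesis using holomorphic_on_compose_gen[OF g(1) XD(2)] by (simp add: o_def)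
  qed
  have cont: "continuous_on UNIV (F b)" and inj: "inj (F b)"
    using emb[OF b] by (auto simp: cp1_embedding_def holo_map_on_def)
  let ?K = "F b ` (- (chart_inv c ` ?D))"
  have "compact (- (chart_inv c ` ?D))"
    using compact_Int_closed[OF compact_cp1, of "- (chart_inv c ` ?D)"] cp1_open_image[OF c open_ball, of s0 r]
    by (simp add: closed_Compl)
  then have "closed ?K"
    by (intro compact_imp_closed compact_continuous_image continuous_on_subset[OF cont]) auto
  then have "open (fst d - ?K)" using chart_facts(1)[OF d] by (rule open_Diff[rotated])
  moreover have "F b (chart_inv c s0) \<in> fst d - ?K"
    using B(2,3) r(1) inj by (auto simp: inj_eq)
  moreover have "snd d ` (L b \<inter> (fst d - ?K)) = (\<lambda>x. (x, ?Z x)) ` (X ` ?D)"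
  proof -
    have "L b \<inter> (fst d - ?K) = (\<lambda>s. F b (chart_inv c s)) ` ?D"
    proof (intro equalityI subsetI)
      fix p assume p: "p \<in> L b \<inter> (fst d - ?K)"
      then obtain z where "p = F b z" using L by blast
      then show "p \<in> (\<lambda>s. F b (chart_inv c s)) ` ?D" using p by auto
    next
      fix p assume "p \<in> (\<lambda>s. F b (chart_inv c s)) ` ?D"
      then obtain s where s: "s \<in> ?D" "p = F b (chart_inv c s)" by blast
      have "p \<notin> ?K" using s inj by (auto simp: inj_eq)
      moreover have "p \<in> fst d" using s B(3) r(2) by blast
      ultimately show "p \<in> L b \<inter> (fst d - ?K)" using s(2) L by blast
    qed
    moreover have "snd d (F b (chart_inv c s)) = (X s, ?Z (X s))" if "s \<in> ?D" for s
      using XY[of s] g(2)[OF that] that r(2) by auto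
    ultimately show ?thesis by (auto simp: image_image)
  qed
  moreover have "F b (chart_inv c s0) \<in> L b" using L by blast
  ultimately show ?thesis unfolding graph_at_def using I Z
    by (intro exI[of _ ?Z] exI[of _ "fst d - ?K"] exI[of _ "X ` ?D"]) auto
qed

text \<open>Whichever function Z the choice in \<open>curve_jet\<close> returns, the parametrised
  curve lies on its graph near s0, so by \<open>Dx_pow_graph\<close> its derivatives are computed
  from the parametrisation.\<close>

lemma curve_jet_eq:
  assumes c: "c \<in> cp1_atlas" and d: "d \<in> max_atlas AS" and L: "L (bb w t) = range (F (bb w t))"
    and B: "open B" "s0 \<in> B" "\<And>s. s \<in> B \<Longrightarrow> (\<beta>0, s) + t *\<^sub>C (w, 0) \<in> Om c d"
    and X: "XX c d w t holomorphic_on B" "\<And>s. s \<in> B \<Longrightarrow> d2 (XX c d w) t s \<noteq> 0"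
    and Y: "YY c d w t holomorphic_on B"
  shows "curve_jet AS k (L (bb w t)) (F (bb w t) (chart_inv c s0)) d =
    Some (XX c d w t s0, \<lambda>i. if i \<le> k then (Dx (XX c d w) ^^ i) (YY c d w) t s0 else 0)"
proof -
  let ?b = "bb w t" let ?p = "F ?b (chart_inv c s0)"
  have b: "?b \<in> V" and Bd: "\<And>s. s \<in> B \<Longrightarrow> F ?b (chart_inv c s) \<in> fst d"
    using B(2,3) XX_YY_Om by blast+
  have ex: "\<exists>Z. graph_at d (L ?b) ?p Z"
    using X(2)[OF B(2)] XX_YY_chart
    by (intro graph_at_exists[where L = L and B = B and X = "XX c d w t" and Y = "YY c d w t"] c b L B(1,2) Bd X(1) Y complex_atlasD(4)[OF AS d])
       (simp_all add: d2_def)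
  define Z where "Z = (SOME Z. graph_at d (L ?b) ?p Z)"
  have Z: "graph_at d (L ?b) ?p Z" unfolding Z_def using ex by (rule someI_ex)
  obtain B' T where B': "open B'" "s0 \<in> B'" "open T" "Z holomorphic_on T"
    "\<And>s. s \<in> B' \<Longrightarrow> F ?b (chart_inv c s) \<in> fst d \<and> fst (snd d (F ?b (chart_inv c s))) \<in> T \<and>
       snd (snd d (F ?b (chart_inv c s))) = Z (fst (snd d (F ?b (chart_inv c s))))"
    by (rule graph_function_eq[where L = L, OF c b L Z]) (rule that; assumption)
  have XY: "fst (snd d (F ?b (chart_inv c s))) = XX c d w t s" "snd (snd d (F ?b (chart_inv c s))) = YY c d w t s" for s
    using XX_YY_chart[of c d w t s] by (metis fst_conv snd_conv)+
  have "(Dx (XX c d w) ^^ i) (YY c d w) t s0 = (deriv ^^ i) Z (XX c d w t s0)" for i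
  proof (rule Dx_pow_graph[where B = "B \<inter> B'" and T = T])
    show "open (B \<inter> B')" using B(1) B'(1) by blast
    show "XX c d w t holomorphic_on B \<inter> B'" using X(1) by (rule holomorphic_on_subset) simp
    show "XX c d w t s \<in> T" "YY c d w t s = Z (XX c d w t s)" if "s \<in> B \<inter> B'" for s
      using B'(5)[of s] that unfolding XY by auto
  qed (use B B' X in auto)
  then show ?thesis
    unfolding curve_jet_def using d ex by (simp add: Let_def Z_def[symmetric] XY cong: if_cong)
qed

lemma cdiff_Psi_components:
  assumes c: "c \<in> cp1_atlas" and d: "d \<in> max_atlas AS" and s: "s \<in> Sset c d"
  shows "d2 (XX c d w) 0 s = fst (Gv c d s)" "d2 (YY c d w) 0 s = snd (Gv c d s)"
    "d1 (XX c d w) 0 s = fst (vv c d w s)" "d1 (YY c d w) 0 s = snd (vv c d w s)"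
proof -
  note P = cdiff_Psi[OF c d s]
  have g: "((\<lambda>s. (\<beta>0, s)) has_derivative (\<lambda>h. h *\<^sub>C (0, 1))) (at s)"
    by (auto simp: scaleC_prod_def scaleC_complex_def intro!: derivative_eq_intros)
  have C: "frechet_derivative (Psi c d) (at (\<beta>0, s)) (k *\<^sub>C v) = k *\<^sub>C frechet_derivative (Psi c d) (at (\<beta>0, s)) v" for k v
    by (rule cdiffD(2)[OF P])
  have "((\<lambda>s. fst (Psi c d (\<beta>0, s))) has_field_derivative fst (Gv c d s)) (at s)"
    unfolding Gv_def
    by (rule has_field_derivative_along[OF has_derivative_fst[OF cdiffD(1)[OF P]] _ g])
       (simp add: C, simp add: scaleC_prod_def)
  then show "d2 (XX c d w) 0 s = fst (Gv c d s)"
    unfolding d2_def by (intro DERIV_imp_deriv) (simp add: XX_0[abs_def])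
  have "((\<lambda>s. snd (Psi c d (\<beta>0, s))) has_field_derivative snd (Gv c d s)) (at s)"
    unfolding Gv_def
    by (rule has_field_derivative_along[OF has_derivative_snd[OF cdiffD(1)[OF P]] _ g])
       (simp add: C, simp add: scaleC_prod_def)
  then show "d2 (YY c d w) 0 s = snd (Gv c d s)"
    unfolding d2_def by (intro DERIV_imp_deriv) (simp add: XX_0[abs_def])
  have sO: "(\<beta>0, s) \<in> Om c d" using s Sset_iff by blast
  show "d1 (XX c d w) 0 s = fst (vv c d w s)" "d1 (YY c d w) 0 s = snd (vv c d w s)"
    using d1_along[where T = "\<lambda>p. fst (Psi c d p)" and \<gamma> = "\<lambda>s. (\<beta>0, s)" and v = "\<lambda>s. (w, 0)" and s = s, OF holo_on_fst[OF Psi_holo[OF c d]] sO]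
      d1_along[where T = "\<lambda>p. snd (Psi c d p)" and \<gamma> = "\<lambda>s. (\<beta>0, s)" and v = "\<lambda>s. (w, 0)" and s = s, OF holo_on_snd[OF Psi_holo[OF c d]] sO]
    unfolding XX_def[abs_def] YY_def[abs_def] by (simp_all add: cdiff_fst[OF P] vv_def)
qed

text \<open>Both sides are (X_s Y_t - Y_s X_t) / X_s. This is the link between the sections
  delivered by the Kodaira map and the solutions of the linearized equation.\<close>

lemma Dt_eq_hh:
  assumes "c \<in> cp1_atlas" "d \<in> max_atlas AS" "s \<in> Sset c d" "fst (Gv c d s) \<noteq> 0"
  shows "Dt (XX c d w) (YY c d w) 0 s = hh c d w s"
  using assms(4) unfolding Dt_def cdiff_Psi_components[OF assms(1-3)] hh_def eta_def det2_def
  by (simp add: field_simps)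

end

section \<open>The differential equation along the deformed curves\<close>

lemma holo2_shrink:
  assumes "continuous_on (ball (0::complex) \<epsilon> \<times> ball s0 r) \<kappa>" "\<epsilon> > 0" "r > 0" "open Q" "\<kappa> (0, s0) \<in> Q"
  obtains \<epsilon>' r' where "\<epsilon>' > 0" "r' > 0" "ball (0::complex) \<epsilon>' \<subseteq> ball 0 \<epsilon>" "ball (s0::complex) r' \<subseteq> ball s0 r"
    "\<And>t s. t \<in> ball 0 \<epsilon>' \<Longrightarrow> s \<in> ball s0 r' \<Longrightarrow> \<kappa> (t, s) \<in> Q"
proof -
  have "open ((ball 0 \<epsilon> \<times> ball s0 r) \<inter> \<kappa> -` Q)"
    by (rule continuous_open_preimage[OF assms(1) open_Times[OF open_ball open_ball] assms(4)])
  moreover have "(0, s0) \<in> (ball 0 \<epsilon> \<times> ball s0 r) \<inter> \<kappa> -` Q" using assms by simp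
  ultimately obtain A B where AB: "open A" "open B" "(0, s0) \<in> A \<times> B" "A \<times> B \<subseteq> (ball 0 \<epsilon> \<times> ball s0 r) \<inter> \<kappa> -` Q"
    by (rule open_prod_elim)
  obtain \<epsilon>' where e: "\<epsilon>' > 0" "ball 0 \<epsilon>' \<subseteq> A" using AB openE[of A 0] by auto
  obtain r' where r': "r' > 0" "ball s0 r' \<subseteq> B" using AB openE[of B s0] by auto
  have sub: "(t, s) \<in> (ball 0 \<epsilon> \<times> ball s0 r) \<inter> \<kappa> -` Q" if "t \<in> ball 0 \<epsilon>'" "s \<in> ball s0 r'" for t s
    using that e(2) r'(2) AB(4) by blast
  show thesis
  proof (rule that[OF e(1) r'(1)])
    show "ball (0 :: complex) \<epsilon>' \<subseteq> ball 0 \<epsilon>" 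
    proof
      fix t :: complex assume "t \<in> ball 0 \<epsilon>'"
      then have "(t, s0) \<in> (ball 0 \<epsilon> \<times> ball s0 r) \<inter> \<kappa> -` Q" by (rule sub) (simp add: r'(1))
      then show "t \<in> ball 0 \<epsilon>" by simp
    qed
    show "ball s0 r' \<subseteq> ball s0 r" 
    proof
      fix s assume "s \<in> ball s0 r'"
      then have "(0, s) \<in> (ball 0 \<epsilon> \<times> ball s0 r) \<inter> \<kappa> -` Q" by (rule sub[rotated]) (simp add: e(1))
      then show "s \<in> ball s0 r" by simp
    qed
    show "\<kappa> (t, s) \<in> Q" if "t \<in> ball 0 \<epsilon>'" "s \<in> ball s0 r'" for t s using sub[OF that] by simp
  qed
qed

lemma continuous_on_pack:
  assumes "\<And>i. continuous_on S (y i)"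
  shows "continuous_on S (\<lambda>x. pack (\<lambda>i. y i x) :: complex ^ 'b::finite)"
  unfolding pack_def using assms by (intro continuous_intros)

context kodaira_family
begin

lemma Om_line_V: "(\<beta>0, s) + t *\<^sub>C (w, 0) \<in> Om c d \<Longrightarrow> bb w t \<in> V"
  by (simp add: XX_YY_Om)

text \<open>Near a point of \<open>L a\<close> all curves \<open>L (bb w t)\<close> solve the equation, so the variation \<open>hh\<close>
  solves its linearization.\<close>

lemma hh_solves_linearization:
  fixes f :: "complex \<times> (complex ^ 'b) \<Rightarrow> complex"
  assumes n: "CARD('b) = n + 1" and c: "c \<in> cp1_atlas" and d: "d \<in> max_atlas AS" and s: "s \<in> Sset c d"
    and G: "fst (Gv c d s) \<noteq> 0" and L: "\<And>b. b \<in> V \<Longrightarrow> L b = range (F b)"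
    and f: "holo_on U f" and Q: "open Q" "Q \<subseteq> U \<times> UNIV"
    and eq: "\<And>r y. (r, y) \<in> Q \<Longrightarrow> (\<exists>j\<in>lifts AS (n + 1) L. \<exists>x yy. j d = Some (x, yy) \<and> r = (x, pack yy) \<and> y = yy (n + 1)) \<Longrightarrow> y = f r"
    and sQ: "((XX c d w 0 s, pack (\<lambda>i. (Dx (XX c d w) ^^ i) (YY c d w) 0 s)), (Dx (XX c d w) ^^ (n + 1)) (YY c d w) 0 s) \<in> Q"
  shows "(Dx (XX c d w) ^^ (n + 1)) (Dt (XX c d w) (YY c d w)) 0 s =
    (\<Sum>i\<le>n. partial_y f i (XX c d w 0 s, pack (\<lambda>i. (Dx (XX c d w) ^^ i) (YY c d w) 0 s)) *
       (Dx (XX c d w) ^^ i) (Dt (XX c d w) (YY c d w)) 0 s)"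
    and "(Dx (XX c d w) ^^ (n + 1)) (YY c d w) 0 s = f (XX c d w 0 s, pack (\<lambda>i. (Dx (XX c d w) ^^ i) (YY c d w) 0 s))"
proof -
  let ?X = "XX c d w" and ?Y = "YY c d w"
  note oO = open_Om[OF c complex_atlasD(4)[OF AS d]]
  have sO: "(\<beta>0, s) \<in> Om c d" using s Sset_iff by blast
  have \<gamma>: "holo_on UNIV (\<lambda>s. (\<beta>0, s))" "holo_on UNIV (\<lambda>s. (w, 0 :: complex))"
    by (intro holo_on_Pair holo_on_const holo_on_ident)+
  obtain \<epsilon>1 r1 where 1: "\<epsilon>1 > 0" "r1 > 0" "ball s r1 \<subseteq> UNIV"
    "\<And>t s'. t \<in> ball 0 \<epsilon>1 \<Longrightarrow> s' \<in> ball s r1 \<Longrightarrow> (\<beta>0, s') + t *\<^sub>C (w, 0) \<in> Om c d"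
    "holo2 (ball 0 \<epsilon>1) (ball s r1) (\<lambda>t s'. fst (Psi c d ((\<beta>0, s') + t *\<^sub>C (w, 0))))"
    by (rule holo2_along[OF oO holo_on_fst[OF Psi_holo[OF c d]] open_UNIV \<gamma>, of s]) (use sO in auto)
  obtain \<epsilon>2 r2 where 2: "\<epsilon>2 > 0" "r2 > 0" "ball s r2 \<subseteq> UNIV"
    "\<And>t s'. t \<in> ball 0 \<epsilon>2 \<Longrightarrow> s' \<in> ball s r2 \<Longrightarrow> (\<beta>0, s') + t *\<^sub>C (w, 0) \<in> Om c d"
    "holo2 (ball 0 \<epsilon>2) (ball s r2) (\<lambda>t s'. snd (Psi c d ((\<beta>0, s') + t *\<^sub>C (w, 0))))"
    by (rule holo2_along[OF oO holo_on_snd[OF Psi_holo[OF c d]] open_UNIV \<gamma>, of s]) (use sO in auto)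
  define \<epsilon> r where "\<epsilon> = min \<epsilon>1 \<epsilon>2" and "r = min r1 r2"
  have er: "\<epsilon> > 0" "r > 0" using 1 2 by (auto simp: \<epsilon>_def r_def)
  have HX: "holo2 (ball 0 \<epsilon>) (ball s r) ?X" and HY: "holo2 (ball 0 \<epsilon>) (ball s r) ?Y"
    unfolding XX_def[abs_def] YY_def[abs_def]
    by (rule holo2_subset[OF 1(5)]; simp add: \<epsilon>_def r_def subset_ball) (rule holo2_subset[OF 2(5)]; simp add: \<epsilon>_def r_def subset_ball)
  have OmD: "(\<beta>0, s') + t *\<^sub>C (w, 0) \<in> Om c d" if "t \<in> ball 0 \<epsilon>" "s' \<in> ball s r" for t s'
    using 1(4)[of t s'] that by (simp add: \<epsilon>_def r_def)
  have "continuous_on (ball 0 \<epsilon> \<times> ball s r) (\<lambda>(t, s). d2 ?X t s)"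
    using holo2_d2[OF HX open_ball open_ball] by (simp add: holo2_def)
  \<comment> \<open>The discs are reduced so that all nearby curves stay transverse to the lines x =
    const.\<close>
  then obtain \<epsilon>' r' where e': "\<epsilon>' > 0" "r' > 0" "ball (0 :: complex) \<epsilon>' \<subseteq> ball 0 \<epsilon>" "ball s r' \<subseteq> ball s r"
    and reg': "\<And>t s'. t \<in> ball 0 \<epsilon>' \<Longrightarrow> s' \<in> ball s r' \<Longrightarrow> (\<lambda>(t, s). d2 ?X t s) (t, s') \<in> - {0}"
  proof (rule holo2_shrink[OF _ er])
    show "open (- {0 :: complex})" by (simp add: open_Compl)
    show "(\<lambda>(t, s). d2 ?X t s) (0, s) \<in> - {0}" using G cdiff_Psi_components(1)[OF c d s] by simp
  qed (rule that; assumption)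
  note HX' = holo2_subset[OF HX e'(3,4)] and HY' = holo2_subset[OF HY e'(3,4)]
  have reg1: "d2 ?X t s' \<noteq> 0" if "t \<in> ball 0 \<epsilon>'" "s' \<in> ball s r'" for t s' using reg'[OF that] by simp
  define J :: "complex \<Rightarrow> complex \<Rightarrow> complex \<times> (complex ^ 'b)" where
    "J = (\<lambda>t s. (?X t s, pack (\<lambda>i. (Dx ?X ^^ i) ?Y t s)))"
  define \<kappa> where "\<kappa> = (\<lambda>p. (J (fst p) (snd p), (Dx ?X ^^ (n + 1)) ?Y (fst p) (snd p)))"
  have "continuous_on (ball 0 \<epsilon>' \<times> ball s r') (\<lambda>p. g (fst p) (snd p))" if "holo2 (ball 0 \<epsilon>') (ball s r') g" for g
    using that by (simp add: holo2_def case_prod_unfold)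
  note cont = this[OF HX'] this[OF holo2_Dx_pow[OF open_ball open_ball HX' reg1 HY']]
  have "continuous_on (ball 0 \<epsilon>' \<times> ball s r') \<kappa>"
    unfolding \<kappa>_def J_def by (intro continuous_on_Pair continuous_on_pack cont)
  \<comment> \<open>A second reduction keeps the full jets of order n + 1 inside Q, the only place
    where the lifts are known to satisfy the equation.\<close>
  then obtain \<epsilon>'' r'' where e'': "\<epsilon>'' > 0" "r'' > 0" "ball (0 :: complex) \<epsilon>'' \<subseteq> ball 0 \<epsilon>'" "ball s r'' \<subseteq> ball s r'"
    and Q'': "\<And>t s'. t \<in> ball 0 \<epsilon>'' \<Longrightarrow> s' \<in> ball s r'' \<Longrightarrow> \<kappa> (t, s') \<in> Q"
  proof (rule holo2_shrink[OF _ e'(1,2) Q(1)])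
    show "\<kappa> (0, s) \<in> Q" using sQ by (simp only: \<kappa>_def J_def fst_conv snd_conv)
  qed (rule that; assumption)
  note HX'' = holo2_subset[OF HX' e''(3,4)] and HY'' = holo2_subset[OF HY' e''(3,4)]
  have reg: "d2 ?X t s' \<noteq> 0" if "t \<in> ball 0 \<epsilon>''" "s' \<in> ball s r''" for t s'
    using that e''(3,4) by (intro reg1) blast+
  have JQ: "(J t s', (Dx ?X ^^ (n + 1)) ?Y t s') \<in> Q" if "t \<in> ball 0 \<epsilon>''" "s' \<in> ball s r''" for t s'
    using Q''[OF that] by (simp only: \<kappa>_def fst_conv snd_conv)
  have JU: "J t s' \<in> U" if "t \<in> ball 0 \<epsilon>''" "s' \<in> ball s r''" for t s'
    using JQ[OF that] Q(2) by blast
  have ode: "(Dx ?X ^^ (n + 1)) ?Y t s' = f (J t s')" if ts: "t \<in> ball 0 \<epsilon>''" "s' \<in> ball s r''" for t s'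
  proof -
    have dom: "(\<beta>0, u) + t *\<^sub>C (w, 0) \<in> Om c d" if "u \<in> ball s r''" for u
      using ts(1) that e'(3,4) e''(3,4) by (intro OmD) blast+
    have V: "bb w t \<in> V" using dom[OF ts(2)] by (rule Om_line_V)
    let ?j = "curve_jet AS (n + 1) (L (bb w t)) (F (bb w t) (chart_inv c s'))"
    have "?j d = Some (?X t s', \<lambda>i. if i \<le> n + 1 then (Dx ?X ^^ i) ?Y t s' else 0)"
      using HX'' HY'' ts(1)
      by (intro curve_jet_eq[where B = "ball s r''"] c d L V open_ball ts(2) dom reg) (auto simp: holo2_def)
    moreover have "?j \<in> lifts AS (n + 1) L" unfolding lifts_def using L[OF V] by blast
    \<comment> \<open>Only the indices up to n enter the vector, so the cut-off in
      \<open>curve_jet\<close> has no effect on it.\<close>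
    moreover have "(pack (\<lambda>i. if i \<le> n + 1 then (Dx ?X ^^ i) ?Y t s' else 0) :: complex ^ 'b) = pack (\<lambda>i. (Dx ?X ^^ i) ?Y t s')"
      unfolding pack_eq_sum[OF n] by (intro sum.cong) auto
    ultimately have "\<exists>j\<in>lifts AS (n + 1) L. \<exists>x yy. j d = Some (x, yy) \<and> J t s' = (x, pack yy) \<and> (Dx ?X ^^ (n + 1)) ?Y t s' = yy (n + 1)"
      unfolding J_def by (intro bexI[of _ ?j] exI conjI) (assumption | simp del: funpow.simps)+
    then show ?thesis by (rule eq[OF JQ[OF ts]])
  qed
  have 0: "0 \<in> ball (0 :: complex) \<epsilon>''" "s \<in> ball s r''" using e''(1,2) by auto
  show "(Dx ?X ^^ (n + 1)) ?Y 0 s = f (?X 0 s, pack (\<lambda>i. (Dx ?X ^^ i) ?Y 0 s))"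
    using ode[OF 0] by (simp only: J_def)
  show "(Dx ?X ^^ (n + 1)) (Dt ?X ?Y) 0 s = (\<Sum>i\<le>n. partial_y f i (?X 0 s, pack (\<lambda>i. (Dx ?X ^^ i) ?Y 0 s)) * (Dx ?X ^^ i) (Dt ?X ?Y) 0 s)"
    using variation_solves_linearization[OF n open_ball open_ball HX'' HY'' reg J_def f JU ode 0]
    by (simp only: J_def)
qed

text \<open>With the abscissa x as coordinate on the curve \<open>F a\<close>, the deformations W i
  of \<open>normal_sections_powers\<close> become \<open>lam ^ i / mu\<close>. They solve the
  linearization, so \<open>W_fun_eq_0\<close> applies.\<close>

lemma W_fun_eq_0_family:
  fixes f :: "complex \<times> (complex ^ 'b) \<Rightarrow> complex"
  assumes n: "CARD('b) = n + 1" "1 \<le> n" and k: "3 \<le> k" "k \<le> n + 1" and d: "d \<in> max_atlas AS"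
    and L: "\<And>b. b \<in> V \<Longrightarrow> L b = range (F b)"
    and U: "open U" "holo_on U f" and Q: "open Q" "Q \<subseteq> U \<times> UNIV" "(q, f q) \<in> Q"
    and eq: "\<And>r y. (r, y) \<in> Q \<Longrightarrow> (\<exists>j\<in>lifts AS (n + 1) L. \<exists>x yy. j d = Some (x, yy) \<and> r = (x, pack yy) \<and> y = yy (n + 1)) \<Longrightarrow> y = f r"
    and p: "p \<in> L a" and jet: "curve_jet AS (n + 1) (L a) p d = Some (x, yy)" "q = (x, pack yy)" "f q = yy (n + 1)"
  shows "W_fun n k f q = 0"
proof -
  obtain z where z: "p = F a z" using p L[OF V(2)] by blast
  obtain c where c: "c \<in> cp1_atlas" "z \<in> fst c" using complex_atlasD(2)[OF complex_atlas_cp1] by blast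
  define s0 where "s0 = snd c z"
  have zs: "z = chart_inv c s0" using cp1_chart_inv'(3)[OF c] by (simp add: s0_def)
  note c = c(1)
  obtain Y where Y: "graph_at d (L a) (F a (chart_inv c s0)) Y"
    using jet(1) unfolding curve_jet_def z zs by (auto split: if_splits)
  obtain B T where BT: "open B" "s0 \<in> B" "open T" "Y holomorphic_on T"
    "\<And>s. s \<in> B \<Longrightarrow> F a (chart_inv c s) \<in> fst d \<and> fst (snd d (F a (chart_inv c s))) \<in> T \<and>
       snd (snd d (F a (chart_inv c s))) = Y (fst (snd d (F a (chart_inv c s))))"
    by (rule graph_function_eq[where L = L, OF c V(2) L[OF V(2)] Y]) (rule that; assumption)
  have s0: "s0 \<in> Sset c d" using BT(2,5) by (simp add: Sset_def)
  \<comment> \<open>For t = 0 the direction w plays no part, so the direction 0 may be used to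
    describe the base curve.\<close>
  define X0 Y0 where "X0 = XX c d 0 0" and "Y0 = YY c d 0 0"
  have X0w: "XX c d w 0 = X0" "YY c d w 0 = Y0" for w by (simp_all add: X0_def Y0_def XX_0 fun_eq_iff)
  have XY: "fst (snd d (F a (chart_inv c s))) = X0 s" "snd (snd d (F a (chart_inv c s))) = Y0 s" for s
    using XX_YY_chart[of c d 0 0 s] by (simp_all add: X0_def Y0_def prod_eq_iff)
  have dX0: "deriv X0 s = fst (Gv c d s)" "deriv Y0 s = snd (Gv c d s)" if "s \<in> Sset c d" for s
    using cdiff_Psi_components(1,2)[OF c d that, of 0] by (simp_all add: d2_def X0_def Y0_def)
  have oS: "open (Sset c d)" by (rule open_Sset[OF c complex_atlasD(4)[OF AS d]])
  have hol0: "X0 holomorphic_on Sset c d" "Y0 holomorphic_on Sset c d"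
  proof -
    have "holo_on (Sset c d) (\<lambda>s. Psi c d (\<beta>0, s))"
      by (rule holo_on_compose[OF holo_on_Pair[OF holo_on_const holo_on_ident] Psi_holo[OF c d]]) (simp add: Sset_iff)
    then show "X0 holomorphic_on Sset c d" "Y0 holomorphic_on Sset c d"
      unfolding X0_def Y0_def XX_0[abs_def]
      by (intro holo_on_holomorphic[OF holo_on_fst] holo_on_holomorphic[OF holo_on_snd]; assumption)+
  qed
  \<comment> \<open>The jet exists in d, so the curve is a graph y = Y(x) there. If the x-velocity
    vanished, the y-velocity would vanish too by the chain rule, against
    \<open>Gv_nonzero\<close>.\<close>
  have G0: "fst (Gv c d s0) \<noteq> 0"
  proof
    assume 0: "fst (Gv c d s0) = 0"
    have X': "(X0 has_field_derivative 0) (at s0)"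
      using holomorphic_derivI[OF hol0(1) oS s0] dX0(1)[OF s0] 0 by simp
    have "X0 s0 \<in> T" using BT(2,5) XY by metis
    then have "(Y has_field_derivative deriv Y (X0 s0)) (at (X0 s0))"
      using holomorphic_derivI[OF BT(4,3)] by blast
    then have "((\<lambda>s. Y (X0 s)) has_field_derivative deriv Y (X0 s0) * 0) (at s0)"
      by (rule DERIV_chain2[OF _ X'])
    then have "deriv (\<lambda>s. Y (X0 s)) s0 = 0" by (simp add: DERIV_imp_deriv)
    moreover have "deriv Y0 s0 = deriv (\<lambda>s. Y (X0 s)) s0"
      using eventually_nhds_in_open[OF BT(1,2)] BT(5)
      by (intro deriv_cong_ev refl) (auto elim!: eventually_mono simp: XY)
    ultimately have "Gv c d s0 = 0" using 0 dX0(2)[OF s0] by (simp add: prod_eq_iff)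
    then show False using Gv_nonzero[OF c d s0] by simp
  qed
  obtain W e r where r: "r > 0" "ball s0 r \<subseteq> Sset c d" "\<And>s. s \<in> ball s0 r \<Longrightarrow> fst (Gv c d s) \<noteq> 0"
    "e holomorphic_on ball s0 r" "\<And>s. s \<in> ball s0 r \<Longrightarrow> e s \<noteq> 0"
    "\<And>i s. i \<le> n \<Longrightarrow> s \<in> ball s0 r \<Longrightarrow> hh c d (W i) s = (s - s0) ^ i * e s"
    by (rule normal_sections_powers[OF c d s0 G0 n(1)]) (rule that; assumption)
  have "X0 holomorphic_on ball s0 r" using hol0(1) r(2) holomorphic_on_subset by blast
  then obtain r' where r': "r' > 0" "ball s0 r' \<subseteq> ball s0 r" "inj_on X0 (ball s0 r')"
    using has_complex_derivative_locally_injective[of X0 "ball s0 r" s0] r(1) dX0(1)[OF s0] G0 by auto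
  define D I where "D = ball s0 r'" and "I = X0 ` D"
  have DS: "s \<in> Sset c d" "fst (Gv c d s) \<noteq> 0" "s \<in> ball s0 r" if "s \<in> D" for s
    using that r'(2) r(2,3) by (auto simp: D_def)
  have D: "open D" "s0 \<in> D" "D \<subseteq> Sset c d" "D \<subseteq> ball s0 r" using r'(1) DS by (auto simp: D_def)
  have holD: "X0 holomorphic_on D" "Y0 holomorphic_on D" "e holomorphic_on D"
    using hol0 r(4) D(3,4) holomorphic_on_subset by blast+
  have injD: "inj_on X0 D" using r'(3) by (simp add: D_def)
  have I: "open I" unfolding I_def using open_mapping_thm3[OF holD(1) D(1) injD] .
  obtain \<sigma> where \<sigma>: "\<sigma> holomorphic_on I" "\<And>s. s \<in> D \<Longrightarrow> \<sigma> (X0 s) = s"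
    unfolding I_def using holomorphic_has_inverse[OF holD(1) D(1) injD] by metis
  have \<sigma>I: "\<sigma> x \<in> D" "X0 (\<sigma> x) = x" if "x \<in> I" for x using that \<sigma>(2) by (auto simp: I_def)
  define Z where "Z = (\<lambda>x. Y0 (\<sigma> x))"
  have comp: "(\<lambda>x. u (\<sigma> x)) holomorphic_on I" if "u holomorphic_on D" for u
    using holomorphic_on_compose_gen[OF \<sigma>(1) that] \<sigma>I(1) by (simp add: o_def image_subset_iff)
  have Z: "Z holomorphic_on I" unfolding Z_def by (rule comp[OF holD(2)])
  have d2X: "d2 (XX c d w) 0 s \<noteq> 0" if "s \<in> D" for w s
    using cdiff_Psi_components(1)[OF c d DS(1)[OF that]] DS(2)[OF that] by simp
  \<comment> \<open>At t = 0 only the base curve enters \<open>Dx\<close>, whatever w is; the curve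
    is the graph of Z.\<close>
  have DxZ: "(Dx (XX c d w) ^^ i) (YY c d w) 0 s = (deriv ^^ i) Z (X0 s)" if s: "s \<in> D" for w i s
    using Dx_pow_graph[of D "XX c d w" 0 I Z "YY c d w" s i] D(1) holD(1) d2X I Z s \<sigma>(2)
    unfolding X0w by (simp add: I_def Z_def)
  define J :: "complex \<Rightarrow> complex \<times> (complex ^ 'b)" where "J = (\<lambda>x. (x, pack (\<lambda>i. (deriv ^^ i) Z x)))"
  have contJ: "continuous_on I (\<lambda>x. (J x, (deriv ^^ (n + 1)) Z x))"
    unfolding J_def
    by (intro continuous_on_Pair continuous_on_pack continuous_on_id holomorphic_on_imp_continuous_on holomorphic_higher_deriv Z I)
  \<comment> \<open>The neighbourhood on which the jet of Z lies in Q. It contains X0 s0, since the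
    jet there is (q, f q).\<close>
  define I' where "I' = I \<inter> (\<lambda>x. (J x, (deriv ^^ (n + 1)) Z x)) -` Q"
  have I': "open I'" unfolding I'_def by (rule continuous_open_preimage[OF contJ I Q(1)])
  have I'I: "x \<in> I" "(J x, (deriv ^^ (n + 1)) Z x) \<in> Q" if "x \<in> I'" for x using that by (auto simp: I'_def)
  have DO: "(\<beta>0, s) \<in> Om c d" if "s \<in> D" for s
    using DS(1)[OF that] Sset_iff by blast
  have "curve_jet AS (n + 1) (L (bb 0 0)) (F (bb 0 0) (chart_inv c s0)) d =
      Some (XX c d 0 0 s0, \<lambda>i. if i \<le> n + 1 then (Dx (XX c d 0) ^^ i) (YY c d 0) 0 s0 else 0)"
    using V(2) DO
    by (intro curve_jet_eq[where B = D] c d L D(1,2) d2X) (auto simp: X0w holD)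
  then have "x = X0 s0" and yy: "yy = (\<lambda>i. if i \<le> n + 1 then (deriv ^^ i) Z (X0 s0) else 0)"
    using jet(1) unfolding z zs DxZ[OF D(2)] X0w by auto
  have "(pack yy :: complex ^ 'b) = pack (\<lambda>i. (deriv ^^ i) Z (X0 s0))"
    unfolding yy pack_eq_sum[OF n(1)] by (intro sum.cong) auto
  then have qJ: "q = J (X0 s0)" using jet(2) \<open>x = X0 s0\<close> by (simp add: J_def)
  have "f q = (deriv ^^ (n + 1)) Z (X0 s0)" using jet(3) yy by (simp del: funpow.simps)
  then have x0: "X0 s0 \<in> I'" using Q(3) D(2) by (simp add: I'_def I_def qJ del: funpow.simps)
  have lin: "(Dx (XX c d w) ^^ (n + 1)) (Dt (XX c d w) (YY c d w)) 0 (\<sigma> x) =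
      (\<Sum>i\<le>n. partial_y f i (J x) * (Dx (XX c d w) ^^ i) (Dt (XX c d w) (YY c d w)) 0 (\<sigma> x))"
    "(deriv ^^ (n + 1)) Z x = f (J x)" if x: "x \<in> I'" for x w
  proof -
    note s = \<sigma>I[OF I'I(1)[OF x]]
    have J: "(XX c d w 0 (\<sigma> x), pack (\<lambda>i. (Dx (XX c d w) ^^ i) (YY c d w) 0 (\<sigma> x))) = J x"
      unfolding DxZ[OF s(1)] X0w s(2) J_def ..
    have "((XX c d w 0 (\<sigma> x), pack (\<lambda>i. (Dx (XX c d w) ^^ i) (YY c d w) 0 (\<sigma> x))), (Dx (XX c d w) ^^ (n + 1)) (YY c d w) 0 (\<sigma> x)) \<in> Q"
      using I'I(2)[OF x] unfolding DxZ[OF s(1)] X0w s(2) J_def .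
    note H = hh_solves_linearization[OF n(1) c d DS(1,2)[OF s(1)] L U(2) Q(1,2) eq this]
    show "(Dx (XX c d w) ^^ (n + 1)) (Dt (XX c d w) (YY c d w)) 0 (\<sigma> x) =
      (\<Sum>i\<le>n. partial_y f i (J x) * (Dx (XX c d w) ^^ i) (Dt (XX c d w) (YY c d w)) 0 (\<sigma> x))"
      using H(1) unfolding J .
    show "(deriv ^^ (n + 1)) Z x = f (J x)" using H(2) unfolding DxZ[OF s(1)] X0w s(2) J_def .
  qed
  \<comment> \<open>s - s0 and 1 / e, the data of \<open>normal_sections_powers\<close>, as
    functions of x.\<close>
  define lam mu where "lam = (\<lambda>x. \<sigma> x - s0)" and "mu = (\<lambda>x. 1 / e (\<sigma> x))"
  have e0: "e s \<noteq> 0" if "s \<in> D" for s using r(5) DS(3)[OF that] by blast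
  have "W_fun n k f (J (X0 s0)) = 0"
  proof (rule W_fun_eq_0[OF n k U I' x0 _ J_def _ lin(2)])
    show "Z holomorphic_on I'" using Z I'I(1) holomorphic_on_subset by blast
    show "J x \<in> U" if "x \<in> I'" for x using I'I(2)[OF that] Q(2) by blast
    have "lam holomorphic_on I" "mu holomorphic_on I"
      unfolding lam_def mu_def using \<sigma>(1) comp[OF holD(3)] e0 \<sigma>I(1) by (auto intro!: holomorphic_intros)
    then show "lam holomorphic_on I'" "mu holomorphic_on I'" using I'I(1) holomorphic_on_subset by blast+
    show "inj_on lam I'"
    proof (rule inj_onI)
      fix x y assume "x \<in> I'" "y \<in> I'" "lam x = lam y"
      then have "X0 (\<sigma> x) = X0 (\<sigma> y)" by (simp add: lam_def)
      then show "x = y" using \<sigma>I(2) I'I(1) \<open>x \<in> I'\<close> \<open>y \<in> I'\<close> by metis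
    qed
    show "mu x \<noteq> 0" if "x \<in> I'" for x using e0[OF \<sigma>I(1)[OF I'I(1)[OF that]]] by (simp add: mu_def)
    fix i x assume i: "i \<le> n" and x: "x \<in> I'"
    let ?H = "\<lambda>x. lam x ^ i / mu x"
    note s = \<sigma>I[OF I'I(1)[OF x]]
    have H: "?H holomorphic_on I"
      unfolding lam_def mu_def using \<sigma>(1) comp[OF holD(3)] e0 \<sigma>I(1) by (auto intro!: holomorphic_intros)
    \<comment> \<open>The variation in the direction W i, as a function of x, is exactly
      \<open>lam ^ i / mu\<close>, by \<open>Dt_eq_hh\<close>; its \<open>Dx\<close>-derivatives are
      then x-derivatives.\<close>
    have "(Dx (XX c d (W i)) ^^ j) (Dt (XX c d (W i)) (YY c d (W i))) 0 (\<sigma> x) = (deriv ^^ j) ?H (XX c d (W i) 0 (\<sigma> x))" for j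
    proof (rule Dx_pow_graph[where B = D and T = I, OF D(1) _ d2X I H _ _ s(1)])
      show "XX c d (W i) 0 holomorphic_on D" unfolding X0w by (rule holD(1))
      show "XX c d (W i) 0 s \<in> I" if "s \<in> D" for s unfolding X0w I_def using that by blast
      show "Dt (XX c d (W i)) (YY c d (W i)) 0 s = ?H (XX c d (W i) 0 s)" if "s \<in> D" for s
        using Dt_eq_hh[OF c d DS(1,2)[OF that]] r(6)[OF i DS(3)[OF that]] \<sigma>(2)[OF that]
        unfolding X0w by (simp add: lam_def mu_def)
    qed
    then show "(deriv ^^ (n + 1)) ?H x = (\<Sum>j\<le>n. partial_y f j (J x) * (deriv ^^ j) ?H x)"
      using lin(1)[OF x, of "W i"] unfolding X0w s(2) by (simp only:)
  qed
  then show ?thesis unfolding qJ .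
qed

end

theorem theorem6:
  fixes AS :: "('s::{t2_space, second_countable_topology}, complex \<times> complex) chart set"
    and AB :: "('m::{t2_space, second_countable_topology}, complex ^ 'b::finite) chart set"
    and L0 :: "'s set" and L :: "'m \<Rightarrow> 's set" and a0 :: 'm and n :: nat
  assumes surface: "complex_atlas AS"
    and n: "n \<ge> 2"
    and curve: "rational_curve AS L0" "normal_bundle_iso_O AS L0 n"
    and parameters: "complex_atlas AB" "CARD('b) = n + 1"
    and family: "complete_family AS AB L" "L a0 = L0"
  shows "\<forall>d\<in>max_atlas AS. \<forall>(f :: complex \<times> (complex ^ 'b) \<Rightarrow> complex) q.
           local_equation n (lifts AS (n + 1) L) d f q \<longrightarrow>
           (\<forall>k\<in>{3..n + 1}. \<forall>v. (\<forall>i<k. v i \<in> E_line n f q) \<longrightarrow> gen_wilczynski n k f q v = 0)"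
proof (intro ballI allI impI)
  fix d and f :: "complex \<times> (complex ^ 'b) \<Rightarrow> complex" and q k v
  assume d: "d \<in> max_atlas AS" and le: "local_equation n (lifts AS (n + 1) L) d f q" and k: "k \<in> {3..n + 1}"
  from le obtain U Q where U: "open U" "holo_on U f" and Q: "open Q" "Q \<subseteq> U \<times> UNIV" "(q, f q) \<in> Q"
    and eq: "\<forall>(r, w)\<in>Q. (\<exists>j\<in>lifts AS (n + 1) L. \<exists>x y. j d = Some (x, y) \<and> r = (x, pack y) \<and> w = y (n + 1)) \<longleftrightarrow> w = f r"
    unfolding local_equation_def by (elim exE conjE)
  \<comment> \<open>The equivalence defining a local equation is read from right to left at (q, f
    q): some curve of the family has this jet.\<close>
  have "\<exists>j\<in>lifts AS (n + 1) L. \<exists>x y. j d = Some (x, y) \<and> q = (x, pack y) \<and> f q = y (n + 1)"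
    using bspec[OF eq Q(3)] by simp
  then obtain a p x y where p: "p \<in> L a" and jet: "curve_jet AS (n + 1) (L a) p d = Some (x, y)"
      "q = (x, pack y)" "f q = y (n + 1)"
    unfolding lifts_def by blast
  \<comment> \<open>Completeness is used at the parameter a of the curve through the jet, which may
    be any curve of the family.\<close>
  obtain V F where V: "a \<in> V" "family_param AS AB L V F"
    and bij: "bij_betw (kodaira_map AS AB F a) (tangent_space AB a) {\<nu>. normal_section AS (F a) UNIV \<nu>}"
    using family(1) unfolding complete_family_def by blast
  obtain cb where cb: "cb \<in> AB" "a \<in> fst cb" using complex_atlasD(2)[OF parameters(1)] by blast
  have fam: "kodaira_family AS AB F V a cb"
    by unfold_locales (use surface parameters V bij cb in \<open>auto simp: family_param_def\<close>)
  have L: "L b = range (F b)" if "b \<in> V" for b using V(2) that by (simp add: family_param_def)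
  have "W_fun n k f q = 0"
  proof (rule kodaira_family.W_fun_eq_0_family[OF fam parameters(2) _ _ _ d L U Q _ p jet])
    show "w = f r" if "(r, w) \<in> Q"
      "\<exists>j\<in>lifts AS (n + 1) L. \<exists>x y. j d = Some (x, y) \<and> r = (x, pack y) \<and> w = y (n + 1)" for r w
      using bspec[OF eq that(1)] that(2) by simp
  qed (use n k in auto)
  then show "gen_wilczynski n k f q v = 0" by (simp add: gen_wilczynski_def)
qed

end
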